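(* Let $X$ and $Y$ be polyhedra with free actions of $\mathbb Z/2$. Then for their join, \[ \operatorname{hind} (X*Y) = \operatorname{hind} X + \operatorname{hind} Y + 1. \]
   Context: Polyhedra are finite simplicial complexes (geometric realizations), and a group action on a polyhedron is assumed to preserve some finite triangulation. For a polyhedron $X$ with a free action of $G=\mathbb Z/p$ ($p$ prime), let $X\to EG$ be the (unique up to equivariant homotopy) equivariant map to the universal free $G$-space, inducing $H^*(BG;\mathbb F_p)\to H^*(X/G;\mathbb F_p)$. The homological index is $\operatorname{hind} X=\max\{k : H^k(BG;\mathbb F_p)\to H^k(X/G;\mathbb F_p)\text{ is nonzero}\}$. The join $X*Y$ is $X\times Y\times[0,1]/\sim$ where $(x,y_1,0)\sim(x,y_2,0)$ and $(x_1,y,1)\sim(x_2,y,1)$; writing its points as $(1-t)x\oplus ty$, $G$ acts by $g\cdot((1-t)x\oplus ty)=(1-t)(gx)\oplus t(gy)$. *)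

theory Defs
  imports "HOL-Analysis.Analysis" "HOL-Homology.Homology" "HOL-Algebra.Group_Action"
begin

section \<open>Quotient spaces\<close>

definition quotient_topology :: "'a topology \<Rightarrow> ('a \<Rightarrow> 'b) \<Rightarrow> 'b topology" where
  "quotient_topology X q =
     topology (\<lambda>U. U \<subseteq> q ` topspace X \<and> openin X {x \<in> topspace X. q x \<in> U})"

lemma openin_quotient_topology:
  "openin (quotient_topology X q) U \<longleftrightarrow>
     U \<subseteq> q ` topspace X \<and> openin X {x \<in> topspace X. q x \<in> U}"
proof -
  have "istopology (\<lambda>U. U \<subseteq> q ` topspace X \<and> openin X {x \<in> topspace X. q x \<in> U})"
    unfolding istopology_def
  proof (rule conjI; intro allI impI)
    fix S T
    assume "S \<subseteq> q ` topspace X \<and> openin X {x \<in> topspace X. q x \<in> S}"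
      and "T \<subseteq> q ` topspace X \<and> openin X {x \<in> topspace X. q x \<in> T}"
    moreover have "{x \<in> topspace X. q x \<in> S \<inter> T} =
        {x \<in> topspace X. q x \<in> S} \<inter> {x \<in> topspace X. q x \<in> T}"
      by blast
    ultimately show "S \<inter> T \<subseteq> q ` topspace X \<and> openin X {x \<in> topspace X. q x \<in> S \<inter> T}"
      by auto
  next
    fix \<K>
    assume "\<forall>K\<in>\<K>. K \<subseteq> q ` topspace X \<and> openin X {x \<in> topspace X. q x \<in> K}"
    moreover have "{x \<in> topspace X. q x \<in> \<Union>\<K>} = (\<Union>K\<in>\<K>. {x \<in> topspace X. q x \<in> K})"
      by blast
    ultimately show "\<Union>\<K> \<subseteq> q ` topspace X \<and> openin X {x \<in> topspace X. q x \<in> \<Union>\<K>}"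
      by auto
  qed
  then show ?thesis
    by (simp add: quotient_topology_def topology_inverse')
qed

lemma topspace_quotient_topology [simp]: "topspace (quotient_topology X q) = q ` topspace X"
proof -
  have "{x \<in> topspace X. q x \<in> q ` topspace X} = topspace X"
    by blast
  then have "openin (quotient_topology X q) (q ` topspace X)"
    by (simp add: openin_quotient_topology)
  then show ?thesis
    by (metis openin_quotient_topology openin_subset openin_topspace subset_antisym)
qed

lemma quotient_map_quotient_topology: "quotient_map X (quotient_topology X q) q"
  by (auto simp: quotient_map_def openin_quotient_topology)


section \<open>Actions of discrete groups on spaces\<close>

definition continuous_action ::
    "('g, 'm) monoid_scheme \<Rightarrow> 'a topology \<Rightarrow> ('g \<Rightarrow> 'a \<Rightarrow> 'a) \<Rightarrow> bool" where
  "continuous_action G X \<phi> \<longleftrightarrow>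
     group_action G (topspace X) \<phi> \<and> (\<forall>g\<in>carrier G. continuous_map X X (\<phi> g))"

definition free_action ::
    "('g, 'm) monoid_scheme \<Rightarrow> 'a topology \<Rightarrow> ('g \<Rightarrow> 'a \<Rightarrow> 'a) \<Rightarrow> bool" where
  "free_action G X \<phi> \<longleftrightarrow>
     continuous_action G X \<phi> \<and>
     (\<forall>g\<in>carrier G. \<forall>x\<in>topspace X. \<phi> g x = x \<longrightarrow> g = \<one>\<^bsub>G\<^esub>)"

definition equivariant_map ::
    "('g, 'm) monoid_scheme \<Rightarrow> 'a topology \<Rightarrow> ('g \<Rightarrow> 'a \<Rightarrow> 'a) \<Rightarrow>
     'b topology \<Rightarrow> ('g \<Rightarrow> 'b \<Rightarrow> 'b) \<Rightarrow> ('a \<Rightarrow> 'b) \<Rightarrow> bool" where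
  "equivariant_map G X \<phi> Y \<psi> f \<longleftrightarrow>
     continuous_map X Y f \<and>
     (\<forall>g\<in>carrier G. \<forall>x\<in>topspace X. f (\<phi> g x) = \<psi> g (f x))"

definition orbit_space ::
    "('g, 'm) monoid_scheme \<Rightarrow> 'a topology \<Rightarrow> ('g \<Rightarrow> 'a \<Rightarrow> 'a) \<Rightarrow> 'a set topology" where
  "orbit_space G X \<phi> = quotient_topology X (orbit G \<phi>)"

text \<open>
  The finite simplicial complex \<open>\<K>\<close> together with the homeomorphism \<open>h\<close> from its
  polyhedron onto \<open>X\<close> is a finite triangulation of \<open>X\<close> whose simplices are permuted
  by the group. The elements of \<open>G\<close> need not act affinely on the simplices.
\<close>

definition invariant_triangulation ::
    "('g, 'm) monoid_scheme \<Rightarrow> 'a topology \<Rightarrow> ('g \<Rightarrow> 'a \<Rightarrow> 'a) \<Rightarrow>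
     'e::euclidean_space set set \<Rightarrow> ('e \<Rightarrow> 'a) \<Rightarrow> bool" where
  "invariant_triangulation G X \<phi> \<K> h \<longleftrightarrow>
     simplicial_complex \<K> \<and>
     homeomorphic_map (top_of_set (\<Union>\<K>)) X h \<and>
     (\<forall>g\<in>carrier G. \<forall>S\<in>\<K>. \<exists>T\<in>\<K>. \<phi> g ` (h ` S) = h ` T)"


section \<open>Joins\<close>

definition join_rel ::
    "'a topology \<Rightarrow> 'b topology \<Rightarrow> (('a \<times> 'b \<times> real) \<times> ('a \<times> 'b \<times> real)) set" where
  "join_rel X Y =
     {((x, y, t), (x', y', t')).
        (x, y, t) \<in> topspace X \<times> topspace Y \<times> {0..1} \<and>
        (x', y', t') \<in> topspace X \<times> topspace Y \<times> {0..1} \<and>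
        ((x, y, t) = (x', y', t') \<or>
         t = 0 \<and> t' = 0 \<and> x = x' \<or>
         t = 1 \<and> t' = 1 \<and> y = y')}"

lemma equiv_join_rel: "equiv (topspace X \<times> topspace Y \<times> {0..1}) (join_rel X Y)"
  by (rule equivI) (auto simp: join_rel_def refl_on_def sym_def trans_def)

definition join_space :: "'a topology \<Rightarrow> 'b topology \<Rightarrow> ('a \<times> 'b \<times> real) set topology" where
  "join_space X Y =
     quotient_topology (prod_topology X (prod_topology Y (top_of_set {0..1})))
       (\<lambda>z. join_rel X Y `` {z})"

definition join_action ::
    "'a topology \<Rightarrow> ('g \<Rightarrow> 'a \<Rightarrow> 'a) \<Rightarrow> 'b topology \<Rightarrow> ('g \<Rightarrow> 'b \<Rightarrow> 'b) \<Rightarrow>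
     'g \<Rightarrow> ('a \<times> 'b \<times> real) set \<Rightarrow> ('a \<times> 'b \<times> real) set" where
  "join_action X \<phi> Y \<psi> g =
     (\<lambda>c\<in>topspace (join_space X Y). (\<lambda>(x, y, t). (\<phi> g x, \<psi> g y, t)) ` c)"


section \<open>Singular cohomology with coefficients in an abelian group\<close>

definition cochain_group ::
    "nat \<Rightarrow> 'a topology \<Rightarrow> ('r, 'm) monoid_scheme \<Rightarrow> ('a chain \<Rightarrow> 'r) monoid" where
  "cochain_group p X A =
     \<lparr>carrier = hom (chain_group p X) A \<inter> extensional (carrier (chain_group p X)),
      monoid.mult = (\<lambda>u v. \<lambda>c\<in>carrier (chain_group p X). u c \<otimes>\<^bsub>A\<^esub> v c),
      one = (\<lambda>c\<in>carrier (chain_group p X). \<one>\<^bsub>A\<^esub>)\<rparr>"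

definition coboundary :: "nat \<Rightarrow> 'a topology \<Rightarrow> ('a chain \<Rightarrow> 'r) \<Rightarrow> 'a chain \<Rightarrow> 'r" where
  "coboundary p X u =
     (\<lambda>c\<in>carrier (chain_group (Suc p) X). u (chain_boundary (Suc p) c))"

definition cocycle_set ::
    "nat \<Rightarrow> 'a topology \<Rightarrow> ('r, 'm) monoid_scheme \<Rightarrow> ('a chain \<Rightarrow> 'r) set" where
  "cocycle_set p X A =
     {u \<in> carrier (cochain_group p X A). coboundary p X u = \<one>\<^bsub>cochain_group (Suc p) X A\<^esub>}"

definition coboundary_set ::
    "nat \<Rightarrow> 'a topology \<Rightarrow> ('r, 'm) monoid_scheme \<Rightarrow> ('a chain \<Rightarrow> 'r) set" where
  "coboundary_set p X A =
     (case p of 0 \<Rightarrow> {\<one>\<^bsub>cochain_group 0 X A\<^esub>}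
      | Suc q \<Rightarrow> coboundary q X ` carrier (cochain_group q X A))"

definition cohomology_group ::
    "nat \<Rightarrow> 'a topology \<Rightarrow> ('r, 'm) monoid_scheme \<Rightarrow> ('a chain \<Rightarrow> 'r) set monoid" where
  "cohomology_group p X A =
     subgroup_generated (cochain_group p X A) (cocycle_set p X A) Mod coboundary_set p X A"

definition cochain_map ::
    "nat \<Rightarrow> 'a topology \<Rightarrow> ('a \<Rightarrow> 'b) \<Rightarrow> ('b chain \<Rightarrow> 'r) \<Rightarrow> 'a chain \<Rightarrow> 'r" where
  "cochain_map p X f u = (\<lambda>c\<in>carrier (chain_group p X). u (chain_map p f c))"

text \<open>
  For continuous \<open>f\<close> the cosets in the following union all coincide, so the union is the
  cohomology class of the pullback of any cocycle representing \<open>\<xi>\<close>.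
\<close>

definition cohom_induced ::
    "nat \<Rightarrow> 'a topology \<Rightarrow> ('r, 'm) monoid_scheme \<Rightarrow> ('a \<Rightarrow> 'b) \<Rightarrow>
     ('b chain \<Rightarrow> 'r) set \<Rightarrow> ('a chain \<Rightarrow> 'r) set" where
  "cohom_induced p X A f \<xi> =
     (\<Union>u\<in>\<xi>. coboundary_set p X A #>\<^bsub>cochain_group p X A\<^esub> cochain_map p X f u)"


section \<open>The homological index\<close>

abbreviation Z2 :: "int monoid" where
  "Z2 \<equiv> integer_mod_group 2"

text \<open>
  The universal free \<open>\<int>/2\<close>-space is the infinite-dimensional sphere with the antipodal
  action. On unit vectors the topology of pointwise convergence is the \<open>\<ell>\<^sup>2\<close>-norm topology,
  so this is a contractible metrizable space.
\<close>

definition EZ2 :: "(nat \<Rightarrow> real) topology" where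
  "EZ2 = subtopology (powertop_real UNIV) (\<Union>n. topspace (nsphere n))"

definition EZ2_action :: "int \<Rightarrow> (nat \<Rightarrow> real) \<Rightarrow> nat \<Rightarrow> real" where
  "EZ2_action g = (\<lambda>a\<in>topspace EZ2. if g = \<one>\<^bsub>Z2\<^esub> then a else (\<lambda>i. - a i))"

definition BZ2 :: "(nat \<Rightarrow> real) set topology" where
  "BZ2 = orbit_space Z2 EZ2 EZ2_action"

text \<open>
  An equivariant map \<open>f\<close> sends orbits to orbits, so the map of orbit spaces which it
  induces is \<open>image f\<close>. Since \<open>f\<close> exists and is unique up to equivariant homotopy for a
  polyhedron with a free action, its choice does not affect the index.
\<close>

definition hind :: "'a topology \<Rightarrow> (int \<Rightarrow> 'a \<Rightarrow> 'a) \<Rightarrow> nat" where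
  "hind X \<phi> =
     Max {k. \<exists>f. equivariant_map Z2 X \<phi> EZ2 EZ2_action f \<and>
            (\<exists>\<xi>\<in>carrier (cohomology_group k BZ2 Z2).
               cohom_induced k (orbit_space Z2 X \<phi>) Z2 (image f) \<xi> \<noteq>
               \<one>\<^bsub>cohomology_group k (orbit_space Z2 X \<phi>) Z2\<^esub>)}"

end

theory Submission
  imports Defs "HOL-Library.Z2"
begin

text \<open>
  For a free involution \<open>T\<close> on \<open>X\<close>, call singular chains \<open>c\<^sub>0, \<dots>, c\<^sub>k\<close> with
  \<open>\<partial>c\<^sub>i\<^sub>+\<^sub>1 = c\<^sub>i + T c\<^sub>i\<close> modulo 2 a Smith sequence. The index of \<open>X\<close> is the largest \<open>k\<close>
  for which there is such a sequence with \<open>c\<^sub>0\<close> of odd augmentation: such a sequence is a chain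
  map from the chains of the \<open>k\<close>-sphere, the image of \<open>c\<^sub>k\<close> in the orbit space is a cycle on
  which \<open>w\<^sup>k\<close> is nonzero, and conversely every cycle of the orbit space lifts, after subdivision,
  to the top of a Smith sequence. If the augmentation of \<open>c\<^sub>0\<close> is even, the sequence can be
  filled in after mapping it to the contractible space \<open>EG\<close>, so that all classes of \<open>BG\<close> vanish
  on the cycle.

  Lower bound for the join: continue a sequence \<open>c\<^sub>0, \<dots>, c\<^sub>m\<close> of \<open>X\<close> by the joins of the
  cycle \<open>c\<^sub>m + T c\<^sub>m\<close> with the members of a sequence of \<open>Y\<close>.

  Upper bound: the join is covered by two invariant open sets \<open>U\<close> and \<open>V\<close> that map equivariantly
  to \<open>X\<close> and \<open>Y\<close>. If the index of \<open>X\<close> is less than \<open>k\<close>, then \<open>w\<^sup>k\<close> has a representative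
  that vanishes on \<open>U\<close>; the cap product with it shortens a Smith sequence of small chains by
  \<open>k\<close> and moves it into \<open>V\<close>.
\<close>

section \<open>Chains modulo 2\<close>

text \<open>The prime 2 is what makes the formula an equality. Modulo 2 the operators
  \<open>1 - T\<close> and \<open>1 + T\<close> coincide, so a Smith sequence has only one kind of
  step, and shortening it by any \<open>k\<close> gives a sequence of the same kind; this is the
  chain-level trace of the cohomology of \<open>BG\<close> being a polynomial ring on
  \<open>w\<close>. For odd primes the two operators alternate and products of classes of odd degree
  vanish. The obstacle is to pass between classes of orbit spaces and chains upstairs without
  computing the cohomology of \<open>BZ2\<close> and without a Gysin sequence or a Kuenneth formula.
  Two facts of linear algebra replace them. The chains of a free space form a free module over the
  group ring, so modulo 2 the kernel of \<open>1 + T\<close> is its image. Over the field with two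
  elements, a vector outside a subspace is detected by a functional that kills the subspace. Chains
  keep integer coefficients and are compared by \<open>\<approx>\<^sub>2\<close>, so that
  boundaries, chain maps and subdivision are the integral ones; an additive function to
  \<open>bit\<close> sees only the class modulo 2.\<close>

definition even_chain :: "('a \<Rightarrow>\<^sub>0 int) \<Rightarrow> bool" where
  "even_chain c \<longleftrightarrow> (\<exists>d. c = frag_cmul 2 d)"

definition cong2 :: "('a \<Rightarrow>\<^sub>0 int) \<Rightarrow> ('a \<Rightarrow>\<^sub>0 int) \<Rightarrow> bool" (infix "\<approx>\<^sub>2" 50) where
  "c \<approx>\<^sub>2 d \<longleftrightarrow> even_chain (c - d)"

lemma even_chain_0 [simp]: "even_chain 0"
  unfolding even_chain_def by (metis frag_cmul_zero2)

lemma even_chain_cmul2 [simp]: "even_chain (frag_cmul 2 d)"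
  unfolding even_chain_def by blast

lemma even_chain_double [simp]: "even_chain (c + c)"
proof -
  have "c + c = frag_cmul 2 c"
    using frag_cmul_distrib [of 1 1 c] by simp
  then show ?thesis by simp
qed

lemma even_chain_add: "even_chain c \<Longrightarrow> even_chain d \<Longrightarrow> even_chain (c + d)"
  unfolding even_chain_def by (metis frag_cmul_distrib2)

lemma even_chain_minus [simp]: "even_chain (- c) \<longleftrightarrow> even_chain c"
proof -
  have "even_chain (- d)" if "even_chain d" for d :: "'a \<Rightarrow>\<^sub>0 int"
    using that unfolding even_chain_def
    by (metis frag_cmul_cmul frag_cmul_minus_one mult.commute)
  then show ?thesis
    by (metis minus_minus)
qed

lemma even_chain_diff: "even_chain c \<Longrightarrow> even_chain d \<Longrightarrow> even_chain (c - d)"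
  using even_chain_add [of c "- d"] by simp

lemma cong2_0_iff: "c \<approx>\<^sub>2 0 \<longleftrightarrow> even_chain c"
  by (simp add: cong2_def)

lemma cong2_refl [simp, intro!]: "c \<approx>\<^sub>2 c"
  by (simp add: cong2_def)

lemma cong2_sym: "c \<approx>\<^sub>2 d \<Longrightarrow> d \<approx>\<^sub>2 c"
  unfolding cong2_def by (metis even_chain_minus minus_diff_eq)

lemma cong2_trans [trans]: "c \<approx>\<^sub>2 d \<Longrightarrow> d \<approx>\<^sub>2 e \<Longrightarrow> c \<approx>\<^sub>2 e"
  unfolding cong2_def using even_chain_add [of "c - d" "d - e"] by simp

lemma cong2_add: "c \<approx>\<^sub>2 d \<Longrightarrow> c' \<approx>\<^sub>2 d' \<Longrightarrow> c + c' \<approx>\<^sub>2 d + d'"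
  unfolding cong2_def using even_chain_add [of "c - d" "c' - d'"] by (simp add: algebra_simps)

lemma cong2_diff: "c \<approx>\<^sub>2 d \<Longrightarrow> c' \<approx>\<^sub>2 d' \<Longrightarrow> c - c' \<approx>\<^sub>2 d - d'"
  unfolding cong2_def using even_chain_diff [of "c - d" "c' - d'"] by (simp add: algebra_simps)

lemma cong2_minus: "- c \<approx>\<^sub>2 c"
proof -
  have "- c - c = - (c + c)" by simp
  then show ?thesis
    unfolding cong2_def by (simp only: even_chain_minus even_chain_double)
qed

lemma cong2_diff_add: "c - d \<approx>\<^sub>2 c + d"
  using cong2_add [OF cong2_refl cong2_minus, of c d] by simp

lemma cong2_sum: "(\<And>i. i \<in> I \<Longrightarrow> f i \<approx>\<^sub>2 g i) \<Longrightarrow> sum f I \<approx>\<^sub>2 sum g I"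
  by (induction I rule: infinite_finite_induct) (auto intro: cong2_add)

lemma cong2_cmul_power: "frag_cmul ((-1) ^ k) c \<approx>\<^sub>2 c"
  by (cases "even k") (auto simp: cong2_minus)

lemma even_chain_cong2: "c \<approx>\<^sub>2 d \<Longrightarrow> even_chain c \<longleftrightarrow> even_chain d"
  by (metis cong2_0_iff cong2_sym cong2_trans)

lemma even_chain_extend: "even_chain c \<Longrightarrow> even_chain (frag_extend f c)"
  unfolding even_chain_def by (metis frag_extend_cmul)

lemma cong2_extend: "c \<approx>\<^sub>2 d \<Longrightarrow> frag_extend f c \<approx>\<^sub>2 frag_extend f d"
  unfolding cong2_def by (metis even_chain_extend frag_extend_diff)

lemma cong2_chain_map: "c \<approx>\<^sub>2 d \<Longrightarrow> chain_map p g c \<approx>\<^sub>2 chain_map p g d"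
  unfolding chain_map_def by (rule cong2_extend)

lemma cong2_chain_boundary: "c \<approx>\<^sub>2 d \<Longrightarrow> chain_boundary p c \<approx>\<^sub>2 chain_boundary p d"
  unfolding chain_boundary_def by (simp add: cong2_extend)

lemma cong2_frag_extend_fun:
  assumes "Poly_Mapping.keys c \<subseteq> S" "\<And>x. x \<in> S \<Longrightarrow> f x \<approx>\<^sub>2 g x"
  shows "frag_extend f c \<approx>\<^sub>2 frag_extend g c"
  using assms
  by (induction c rule: frag_induction) (auto simp: frag_extend_diff intro: cong2_diff)

text \<open>Halving does not change the support, so the half is again a chain of \<open>X\<close>
  and cochains of \<open>X\<close> can be evaluated on it.\<close>

lemma even_chain_singular:
  assumes "even_chain c" "singular_chain p X c"
  obtains d where "singular_chain p X d" "c = frag_cmul 2 d"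
proof -
  obtain d where d: "c = frag_cmul 2 d"
    using assms(1) even_chain_def by blast
  have "Poly_Mapping.keys c = Poly_Mapping.keys d"
    unfolding d by auto
  then have "singular_chain p X d"
    using assms(2) by (simp add: singular_chain_def)
  then show thesis using d that by blast
qed

lemma chain_boundary_of_cong2:
  "p > 0 \<Longrightarrow> chain_boundary p (frag_of f) \<approx>\<^sub>2 (\<Sum>k\<le>p. frag_of (singular_face p k f))"
  by (simp add: chain_boundary_of cong2_sum cong2_cmul_power)

subsection \<open>Homomorphisms to the field with two elements\<close>

lemma bit_add_self [simp]: "(b::bit) + b = 0"
  by (cases b) auto

lemma additive_even_chain:
  fixes u :: "('a \<Rightarrow>\<^sub>0 int) \<Rightarrow> bit"
  assumes "Modules.additive u" "even_chain c"
  shows "u c = 0"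
proof -
  obtain d where "c = frag_cmul (1 + 1) d"
    using assms(2) unfolding even_chain_def by auto
  then have "c = d + d"
    by (simp only: frag_cmul_distrib frag_cmul_one)
  then show ?thesis
    using Modules.additive.add [OF assms(1)] by simp
qed

lemma additive_cong2:
  fixes u :: "('a \<Rightarrow>\<^sub>0 int) \<Rightarrow> bit"
  assumes "Modules.additive u" "c \<approx>\<^sub>2 d"
  shows "u c = u d"
proof -
  have "u c - u d = 0"
    using assms Modules.additive.diff [OF assms(1)] additive_even_chain cong2_def by metis
  then show ?thesis by (cases "u c"; cases "u d") auto
qed

lemma additive_frag_extend:
  fixes u :: "('a \<Rightarrow>\<^sub>0 int) \<Rightarrow> 'c::ab_group_add"
  shows "Modules.additive u \<Longrightarrow> Modules.additive (\<lambda>c. u (frag_extend f c))"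
  unfolding Modules.additive_def by (simp add: frag_extend_add)

lemma additive_chain_boundary:
  "Modules.additive u \<Longrightarrow> Modules.additive (\<lambda>c. u (chain_boundary p c))"
  unfolding Modules.additive_def by (simp add: chain_boundary_add)

lemma additive_plus:
  "Modules.additive u \<Longrightarrow> Modules.additive v \<Longrightarrow> Modules.additive (\<lambda>c. u c + v c)"
  unfolding Modules.additive_def by (simp add: algebra_simps)

text \<open>Collapsing all generators to one and reading off its coefficient makes additivity a
  property of \<open>frag_extend\<close>. The chain may have any degree.\<close>

definition augm :: "('a \<Rightarrow>\<^sub>0 int) \<Rightarrow> bit" where
  "augm c = of_int (Poly_Mapping.lookup (frag_extend (\<lambda>_. frag_of ()) c) ())"

lemma additive_augm: "Modules.additive augm"
  by (simp add: Modules.additive_def augm_def frag_extend_add lookup_add)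

lemma augm_of [simp]: "augm (frag_of x) = 1"
  by (simp add: augm_def)

lemma augm_0 [simp]: "augm 0 = 0"
  by (simp add: augm_def)

lemma augm_add: "augm (c + d) = augm c + augm d"
  using Modules.additive.add [OF additive_augm] .

lemma augm_diff: "augm (c - d) = augm c - augm d"
  using Modules.additive.diff [OF additive_augm] .

lemma augm_cong2: "c \<approx>\<^sub>2 d \<Longrightarrow> augm c = augm d"
  by (rule additive_cong2 [OF additive_augm])

lemma augm_extend_of: "augm (frag_extend (frag_of \<circ> f) c) = augm c"
  unfolding augm_def frag_extend_compose by (simp add: o_def)

lemma augm_chain_map [simp]: "augm (chain_map p f c) = augm c"
  unfolding chain_map_def by (rule augm_extend_of)

lemma augm_boundary [simp]: "augm (chain_boundary (Suc 0) c) = 0"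
proof -
  have "augm (chain_boundary (Suc 0) c) = 0" if "Poly_Mapping.keys c \<subseteq> UNIV"
    using that
    by (induction c rule: frag_induction)
      (auto simp: chain_boundary_of chain_boundary_diff augm_diff augm_add)
  then show ?thesis by simp
qed

text \<open>A subgroup that contains all doubles and is maximal among those avoiding \<open>g\<close> has index two.\<close>

lemma exists_separating_additive:
  fixes B :: "'a::ab_group_add set"
  assumes sub: "0 \<in> B" "\<And>x y. x \<in> B \<Longrightarrow> y \<in> B \<Longrightarrow> x - y \<in> B"
    and double: "\<And>x. x + x \<in> B" and g: "g \<notin> B"
  shows "\<exists>u :: 'a \<Rightarrow> bit. Modules.additive u \<and> (\<forall>x\<in>B. u x = 0) \<and> u g = 1"
proof -
  define \<A> where "\<A> = {M. B \<subseteq> M \<and> g \<notin> M \<and> (\<forall>x\<in>M. \<forall>y\<in>M. x - y \<in> M)}"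
  have "\<exists>M\<in>\<A>. \<forall>M'\<in>\<A>. M \<subseteq> M' \<longrightarrow> M' = M"
  proof (rule subset_Zorn_nonempty)
    show "\<A> \<noteq> {}"
      using sub g by (auto simp: \<A>_def)
    fix \<C> assume \<C>: "\<C> \<noteq> {}" "subset.chain \<A> \<C>"
    then have \<C>\<A>: "\<C> \<subseteq> \<A>" and total: "\<And>M N. M \<in> \<C> \<Longrightarrow> N \<in> \<C> \<Longrightarrow> M \<subseteq> N \<or> N \<subseteq> M"
      by (auto simp: subset_chain_def)
    have "x - y \<in> \<Union>\<C>" if xy: "x \<in> \<Union>\<C>" "y \<in> \<Union>\<C>" for x y
    proof -
      obtain M N where MN: "M \<in> \<C>" "N \<in> \<C>" "x \<in> M" "y \<in> N"
        using xy by blast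
      obtain L where "L \<in> \<C>" "x \<in> L" "y \<in> L"
        using total [OF MN(1,2)] MN by blast
      then show ?thesis
        using \<C>\<A> by (auto simp: \<A>_def)
    qed
    moreover have "B \<subseteq> M" "g \<notin> M" if "M \<in> \<C>" for M
      using that \<C>\<A> by (auto simp: \<A>_def)
    then have "B \<subseteq> \<Union>\<C>" "g \<notin> \<Union>\<C>"
      using \<C>(1) by blast+
    ultimately show "\<Union>\<C> \<in> \<A>"
      by (auto simp: \<A>_def)
  qed
  then obtain M where M: "M \<in> \<A>" and maxM: "\<And>M'. M' \<in> \<A> \<Longrightarrow> M \<subseteq> M' \<Longrightarrow> M' = M"
    by blast
  have BM: "B \<subseteq> M" and gM: "g \<notin> M" and diffM: "\<And>x y. x \<in> M \<Longrightarrow> y \<in> M \<Longrightarrow> x - y \<in> M"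
    using M by (auto simp: \<A>_def)
  have 0: "0 \<in> M" using BM sub by blast
  have negM: "- x \<in> M" if "x \<in> M" for x
    using diffM [OF 0 that] by simp
  have addM: "x + y \<in> M" if "x \<in> M" "y \<in> M" for x y
    using diffM [OF that(1) negM [OF that(2)]] by simp
  have index2: "g - x \<in> M" if x: "x \<notin> M" for x
  proof (rule ccontr)
    assume gx: "g - x \<notin> M"
    \<comment> \<open>Doubles lie in \<open>M\<close>, so adjoining \<open>x\<close> adds a single
      coset. This coset avoids \<open>g\<close> by assumption, and the larger subgroup contradicts
      maximality.\<close>
    let ?M' = "M \<union> (+) x ` M"
    have dd: "a - b \<in> ?M'" if ab: "a \<in> ?M'" "b \<in> ?M'" for a b
    proof -
      have xx: "x + x \<in> M" using double BM by blast
      have "x + (m - m') \<in> ?M'" "m - m' \<in> ?M'" if "m \<in> M" "m' \<in> M" for m m'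
        using diffM [OF that] by auto
      moreover have "m - (x + m') \<in> ?M'" if "m \<in> M" "m' \<in> M" for m m'
      proof -
        have "m - (x + m') = x + ((m - m') - (x + x))"
          by (simp add: algebra_simps)
        moreover have "(m - m') - (x + x) \<in> M"
          using diffM that xx by blast
        ultimately show ?thesis by (metis UnCI image_eqI)
      qed
      moreover have "(x + m) - m' = x + (m - m')" "(x + m) - (x + m') = m - m'" for m m'
        by simp_all
      moreover have "a \<in> M \<or> (\<exists>m\<in>M. a = x + m)" "b \<in> M \<or> (\<exists>m\<in>M. b = x + m)"
        using ab by auto
      ultimately show ?thesis
        by metis
    qed
    have "g \<noteq> x + m" if "m \<in> M" for m
      using gx that by auto
    then have "?M' \<in> \<A>"
      using BM gM dd by (auto simp: \<A>_def)
    then have "?M' = M"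
      using maxM by blast
    moreover have "x \<in> ?M'"
      using 0 by force
    ultimately show False using x by blast
  qed
  define u :: "'a \<Rightarrow> bit" where "u = (\<lambda>x. if x \<in> M then 0 else 1)"
  have "u (x + y) = u x + u y" for x y
  proof (cases "x \<in> M \<or> y \<in> M")
    case True
    then show ?thesis
    proof
      assume "x \<in> M"
      then have "x + y \<in> M \<longleftrightarrow> y \<in> M"
        using addM [of x y] diffM [of "x + y" x] by auto
      then show ?thesis using \<open>x \<in> M\<close> by (simp add: u_def)
    next
      assume "y \<in> M"
      then have "x + y \<in> M \<longleftrightarrow> x \<in> M"
        using addM [of x y] diffM [of "x + y" y] by auto
      then show ?thesis using \<open>y \<in> M\<close> by (simp add: u_def)
    qed
  next
    case False
    then have "g - x \<in> M" "g - y \<in> M"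
      using index2 by auto
    then have "(g + g) - ((g - x) + (g - y)) \<in> M"
      using diffM addM BM double by blast
    then have "x + y \<in> M"
      by (simp add: algebra_simps)
    then show ?thesis
      using False by (simp add: u_def)
  qed
  then show ?thesis
    using BM gM by (intro exI [of _ u]) (auto simp: Modules.additive_def u_def)
qed

text \<open>The form in which functionals are produced. With a boundary map, or a boundary plus a
  transfer, in the place of \<open>L\<close>, a chain that does not bound yields a cocycle that
  detects it; this stands in for universal coefficients.\<close>

lemma exists_separating_additive_mod2:
  fixes L :: "'b::ab_group_add \<Rightarrow> ('a \<Rightarrow>\<^sub>0 int)"
  assumes A: "0 \<in> A" "\<And>x y. x \<in> A \<Longrightarrow> y \<in> A \<Longrightarrow> x - y \<in> A"
    and L: "\<And>x y. L (x - y) = L x - L y" and g: "\<And>x. x \<in> A \<Longrightarrow> \<not> g \<approx>\<^sub>2 L x"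
  obtains u :: "('a \<Rightarrow>\<^sub>0 int) \<Rightarrow> bit"
  where "Modules.additive u" "\<And>x. x \<in> A \<Longrightarrow> u (L x) = 0" "u g = 1"
proof -
  define B where "B = {c. \<exists>x\<in>A. c \<approx>\<^sub>2 L x}"
  have "\<exists>u :: ('a \<Rightarrow>\<^sub>0 int) \<Rightarrow> bit. Modules.additive u \<and> (\<forall>c\<in>B. u c = 0) \<and> u g = 1"
  proof (rule exists_separating_additive)
    have L0: "L 0 = 0" using L [of 0 0] by simp
    then show "0 \<in> B" "\<And>c. c + c \<in> B"
      unfolding B_def using A(1) by (auto simp: cong2_0_iff intro!: bexI [of _ 0])
    fix c d assume "c \<in> B" "d \<in> B"
    then obtain x y where "x \<in> A" "y \<in> A" "c \<approx>\<^sub>2 L x" "d \<approx>\<^sub>2 L y"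
      unfolding B_def by blast
    then have "x - y \<in> A" "c - d \<approx>\<^sub>2 L (x - y)"
      unfolding L by (auto intro: A(2) cong2_diff)
    then show "c - d \<in> B"
      unfolding B_def by blast
  next
    show "g \<notin> B"
      unfolding B_def using g by blast
  qed
  moreover have "L x \<in> B" if "x \<in> A" for x
    unfolding B_def using that cong2_refl by blast
  ultimately show thesis
    using that by blast
qed

lemma sum_atMost_split:
  fixes g :: "nat \<Rightarrow> 'a::comm_monoid_add"
  shows "(\<Sum>i\<le>k + Suc j. g i) = (\<Sum>i\<le>k. g i) + (\<Sum>i\<le>j. g (Suc k + i))"
  by (induction j) (simp_all add: add.assoc)

section \<open>Free involutions and Smith sequences\<close>

definition smith_seq :: "nat \<Rightarrow> 'a topology \<Rightarrow> ('a \<Rightarrow> 'a) \<Rightarrow> (nat \<Rightarrow> 'a chain) \<Rightarrow> bool" where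
  "smith_seq k X T c \<longleftrightarrow>
     (\<forall>i\<le>k. singular_chain i X (c i)) \<and>
     (\<forall>i<k. chain_boundary (Suc i) (c (Suc i)) \<approx>\<^sub>2 c i + chain_map i T (c i))"

definition smith_index_ge :: "'a topology \<Rightarrow> ('a \<Rightarrow> 'a) \<Rightarrow> nat \<Rightarrow> bool" where
  "smith_index_ge X T k \<longleftrightarrow> (\<exists>c. smith_seq k X T c \<and> augm (c 0) = 1)"

lemma smith_seq_mono: "smith_seq k X T c \<Longrightarrow> l \<le> k \<Longrightarrow> smith_seq l X T c"
  by (auto simp: smith_seq_def)

lemma smith_index_ge_mono: "smith_index_ge X T k \<Longrightarrow> l \<le> k \<Longrightarrow> smith_index_ge X T l"
  unfolding smith_index_ge_def using smith_seq_mono by blast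

lemma chain_map_comm:
  assumes "singular_chain p X c" "\<And>x. x \<in> topspace X \<Longrightarrow> f (T x) = T' (f x)"
  shows "chain_map p f (chain_map p T c) = chain_map p T' (chain_map p f c)"
proof -
  have "chain_map p (f \<circ> T) c = chain_map p (T' \<circ> f) c"
    using assms by (intro chain_map_eq [OF assms(1)]) auto
  then show ?thesis by (simp add: chain_map_compose)
qed

lemma smith_seq_chain_map:
  assumes c: "smith_seq k X T c" and f: "continuous_map X Y f"
    and fT: "\<And>x. x \<in> topspace X \<Longrightarrow> f (T x) = T' (f x)"
  shows "smith_seq k Y T' (\<lambda>i. chain_map i f (c i))"
  unfolding smith_seq_def
proof (intro conjI allI impI)
  fix i assume "i \<le> k"
  then show "singular_chain i Y (chain_map i f (c i))"
    using c f singular_chain_chain_map unfolding smith_seq_def by blast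
next
  fix i assume i: "i < k"
  have ci: "singular_chain i X (c i)" "singular_chain (Suc i) X (c (Suc i))"
    using c i unfolding smith_seq_def by auto
  have "chain_boundary (Suc i) (chain_map (Suc i) f (c (Suc i)))
        = chain_map i f (chain_boundary (Suc i) (c (Suc i)))"
    using chain_boundary_chain_map [OF ci(2)] by simp
  also have "\<dots> \<approx>\<^sub>2 chain_map i f (c i + chain_map i T (c i))"
    using c i unfolding smith_seq_def by (intro cong2_chain_map) auto
  also have "\<dots> = chain_map i f (c i) + chain_map i T' (chain_map i f (c i))"
    by (simp add: chain_map_add chain_map_comm [OF ci(1), of f T T'] fT)
  finally show "chain_boundary (Suc i) (chain_map (Suc i) f (c (Suc i)))
      \<approx>\<^sub>2 chain_map i f (c i) + chain_map i T' (chain_map i f (c i))" .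
qed

lemma smith_index_ge_map:
  assumes "smith_index_ge X T k" "continuous_map X Y f"
    and "\<And>x. x \<in> topspace X \<Longrightarrow> f (T x) = T' (f x)"
  shows "smith_index_ge Y T' k"
proof -
  obtain c where c: "smith_seq k X T c" "augm (c 0) = 1"
    using assms(1) unfolding smith_index_ge_def by blast
  show ?thesis
    unfolding smith_index_ge_def
    using smith_seq_chain_map [OF c(1) assms(2,3)] c(2)
    by (intro exI [of _ "\<lambda>i. chain_map i f (c i)"]) simp
qed

text \<open>
  Freeness of the involution \<open>T\<close> is witnessed by countably many odd functions without a
  common zero, i.e. by an equivariant map \<open>F\<close> to the nonzero vectors.
\<close>

locale free_involution =
  fixes X :: "'a topology" and T :: "'a \<Rightarrow> 'a" and F :: "'a \<Rightarrow> nat \<Rightarrow> real"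
  assumes T_cont: "continuous_map X X T"
    and T_T: "x \<in> topspace X \<Longrightarrow> T (T x) = x"
    and F_cont: "continuous_map X euclideanreal (\<lambda>x. F x i)"
    and F_odd: "x \<in> topspace X \<Longrightarrow> F (T x) i = - F x i"
    and F_nonzero: "x \<in> topspace X \<Longrightarrow> \<exists>i. F x i \<noteq> 0"
begin

lemma T_in: "x \<in> topspace X \<Longrightarrow> T x \<in> topspace X"
  using T_cont by (auto simp: continuous_map_def)

lemma T_free: "x \<in> topspace X \<Longrightarrow> T x \<noteq> x"
  using F_odd F_nonzero by (metis neg_equal_zero)

lemma subspace:
  assumes "\<And>x. x \<in> U \<Longrightarrow> x \<in> topspace X \<Longrightarrow> T x \<in> U"
  shows "free_involution (subtopology X U) T F"
proof
  show "continuous_map (subtopology X U) (subtopology X U) T"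
    using assms T_cont by (auto simp: continuous_map_in_subtopology continuous_map_from_subtopology)
  show "continuous_map (subtopology X U) euclideanreal (\<lambda>x. F x i)" for i
    by (simp add: F_cont continuous_map_from_subtopology)
qed (use T_T F_odd F_nonzero in auto)

section \<open>Free orbits of simplices and the transfer \<open>1 + T\<close>\<close>

lemma simplex_T:
  assumes "singular_simplex p X s"
  shows "singular_simplex p X (simplex_map p T s)" "simplex_map p T (simplex_map p T s) = s"
    "simplex_map p T s \<noteq> s"
proof -
  show "singular_simplex p X (simplex_map p T s)"
    using assms T_cont singular_simplex_simplex_map by blast
  have "simplex_map p (T \<circ> T) s = s"
    by (rule simplex_map_id_gen [OF assms]) (simp add: T_T)
  then show "simplex_map p T (simplex_map p T s) = s"
    by (simp add: simplex_map_compose)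
  obtain x where x: "x \<in> standard_simplex p"
    using nonempty_standard_simplex by blast
  then have "s x \<in> topspace X"
    using assms by (auto simp: singular_simplex_def continuous_map_def)
  then have "simplex_map p T s x \<noteq> s x"
    using x T_free by (simp add: simplex_map_def)
  then show "simplex_map p T s \<noteq> s" by auto
qed

lemma chain_T:
  assumes "singular_chain p X c"
  shows "singular_chain p X (chain_map p T c)" "chain_map p T (chain_map p T c) = c"
proof -
  show "singular_chain p X (chain_map p T c)"
    using assms T_cont singular_chain_chain_map by blast
  have "chain_map p (T \<circ> T) c = c"
    by (rule chain_map_id_gen [OF assms]) (simp add: T_T)
  then show "chain_map p T (chain_map p T c) = c"
    by (simp add: chain_map_compose)
qed

text \<open>Choosing from the unordered pair makes the choice depend on the orbit only:
  \<open>s\<close> and its translate get the same representative.\<close>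

definition rep :: "nat \<Rightarrow> ((nat \<Rightarrow> real) \<Rightarrow> 'a) \<Rightarrow> ((nat \<Rightarrow> real) \<Rightarrow> 'a)" where
  "rep p s = (SOME t. t \<in> {s, simplex_map p T s})"

definition half :: "nat \<Rightarrow> 'a chain \<Rightarrow> 'a chain" where
  "half p = frag_extend (\<lambda>s. if rep p s = s then frag_of s else 0)"

lemma rep_cases: "rep p s = s \<or> rep p s = simplex_map p T s"
proof -
  have "rep p s \<in> {s, simplex_map p T s}"
    unfolding rep_def by (rule someI [of _ s]) simp
  then show ?thesis by blast
qed

lemma rep_T: "singular_simplex p X s \<Longrightarrow> rep p (simplex_map p T s) = rep p s"
  unfolding rep_def by (simp add: simplex_T insert_commute)

text \<open>By freeness the orbit of a simplex has two distinct members, of which just one is the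
  representative, so \<open>half\<close> keeps exactly one of the two terms \<open>s\<close> and
  \<open>T s\<close>.\<close>

lemma half_transfer:
  assumes "singular_chain p X c"
  shows "half p (c + chain_map p T c) = frag_extend (frag_of \<circ> rep p) c"
  using assms unfolding singular_chain_def
proof (induction c rule: frag_induction)
  case (one s)
  then have s: "singular_simplex p X s" by simp
  show ?case
  proof (cases "rep p s = s")
    case True
    then have "rep p (simplex_map p T s) \<noteq> simplex_map p T s"
      using rep_T [OF s] simplex_T(3) [OF s] by metis
    then show ?thesis
      using True by (simp add: half_def frag_extend_add)
  next
    case False
    then have "rep p s = simplex_map p T s" "rep p (simplex_map p T s) = simplex_map p T s"
      using rep_T [OF s] rep_cases by metis+
    then show ?thesis
      using False by (simp add: half_def frag_extend_add)
  qed
next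
  case (diff a b)
  have "half p (a - b + chain_map p T (a - b)) = half p (a + chain_map p T a) - half p (b + chain_map p T b)"
    unfolding half_def by (simp add: chain_map_diff frag_extend_diff frag_extend_add)
  then show ?case
    by (simp add: diff frag_extend_diff)
qed (auto simp: half_def)

text \<open>Moving every simplex to its representative changes a chain by a transfer modulo 2, since
  a simplex that moves contributes \<open>s - T s\<close>. The chain \<open>r\<close> collects the
  simplices that move.\<close>

lemma transfer_preimage:
  assumes "singular_chain p X c" "even_chain (frag_extend (frag_of \<circ> rep p) c)"
  obtains r where "singular_chain p X r" "c \<approx>\<^sub>2 r + chain_map p T r"
proof -
  define r where "r = frag_extend (\<lambda>s. if rep p s = s then 0 else frag_of s)"
  have "c - frag_extend (frag_of \<circ> rep p) c \<approx>\<^sub>2 r c + chain_map p T (r c)"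
    using assms(1) unfolding singular_chain_def
  proof (induction c rule: frag_induction)
    case (one s)
    show ?case
      using rep_cases [of p s] by (auto simp: r_def cong2_diff_add)
  next
    case (diff a b)
    have "r (a - b) + chain_map p T (r (a - b)) = (r a + chain_map p T (r a)) - (r b + chain_map p T (r b))"
      unfolding r_def by (simp add: frag_extend_diff chain_map_diff)
    moreover have "a - b - frag_extend (frag_of \<circ> rep p) (a - b) =
      (a - frag_extend (frag_of \<circ> rep p) a) - (b - frag_extend (frag_of \<circ> rep p) b)"
      by (simp add: frag_extend_diff)
    ultimately show ?case
      using cong2_diff [OF diff] by presburger
  qed (auto simp: r_def)
  moreover have "c - frag_extend (frag_of \<circ> rep p) c \<approx>\<^sub>2 c"
    using assms(2) by (simp add: cong2_def)
  ultimately have "c \<approx>\<^sub>2 r c + chain_map p T (r c)"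
    using cong2_sym cong2_trans by blast
  moreover have "singular_chain p X (r c)"
    unfolding r_def using assms(1)
    by (intro singular_chain_extend) (auto simp: singular_chain_def)
  ultimately show thesis using that by blast
qed

text \<open>Exactness of the Smith complex, by freeness of the chains over the group ring: if
  \<open>c + T c\<close> is even, then so is the sum of the representatives of
  \<open>c\<close>.\<close>

lemma ker_transfer:
  assumes "singular_chain p X c" "even_chain (c + chain_map p T c)"
  obtains r where "singular_chain p X r" "c \<approx>\<^sub>2 r + chain_map p T r"
proof -
  have "even_chain (half p (c + chain_map p T c))"
    using assms(2) unfolding half_def by (rule even_chain_extend)
  then show thesis
    using transfer_preimage assms(1) half_transfer that by metis
qed

text \<open>The square of \<open>1 + T\<close> is \<open>2 (1 + T)\<close>.\<close>

lemma transfer_transfer: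
  assumes "singular_chain p X c"
  shows "even_chain ((c + chain_map p T c) + chain_map p T (c + chain_map p T c))"
proof -
  have "(c + chain_map p T c) + chain_map p T (c + chain_map p T c) = (c + chain_map p T c) + (c + chain_map p T c)"
    by (simp add: chain_map_add chain_T [OF assms] add.commute)
  then show ?thesis by (simp only: even_chain_double)
qed

lemma boundary_transfer:
  assumes "singular_chain (Suc p) X c"
  shows "chain_boundary (Suc p) (c + chain_map (Suc p) T c) =
    chain_boundary (Suc p) c + chain_map p T (chain_boundary (Suc p) c)"
  using chain_boundary_chain_map [OF assms] by (simp add: chain_boundary_add)

text \<open>The boundary of \<open>c\<close> is killed by \<open>1 + T\<close>, hence is the
  transfer of some \<open>r\<close>. The transfer of \<open>r\<close> is congruent to a boundary and
  so is itself a cycle modulo 2, which is the hypothesis one dimension lower.\<close>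

lemma smith_seq_descend:
  assumes "singular_chain k X c" "even_chain (chain_boundary k (c + chain_map k T c))"
  obtains d where "smith_seq k X T d" "d k = c"
proof -
  have "\<exists>d. smith_seq k X T d \<and> d k = c"
    using assms
  proof (induction k arbitrary: c)
    case 0
    then show ?case
      by (intro exI [of _ "\<lambda>_. c"]) (auto simp: smith_seq_def)
  next
    case (Suc k)
    have b: "singular_chain k X (chain_boundary (Suc k) c)"
      using Suc.prems singular_chain_boundary_alt by blast
    moreover have "even_chain (chain_boundary (Suc k) c + chain_map k T (chain_boundary (Suc k) c))"
      using Suc.prems by (simp add: boundary_transfer)
    ultimately obtain r where r: "singular_chain k X r"
      "chain_boundary (Suc k) c \<approx>\<^sub>2 r + chain_map k T r"
      using ker_transfer by blast
    have "chain_boundary k (r + chain_map k T r) \<approx>\<^sub>2 chain_boundary k (chain_boundary (Suc k) c)"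
      using r(2) cong2_chain_boundary cong2_sym by blast
    then have "even_chain (chain_boundary k (r + chain_map k T r))"
      using chain_boundary_boundary_alt [OF Suc.prems(1)] by (simp add: cong2_0_iff)
    then obtain d where d: "smith_seq k X T d" "d k = r"
      using Suc.IH r(1) by blast
    then show ?case
      using Suc.prems(1) r(2) 
      by (intro exI [of _ "d(Suc k := c)"]) (auto simp: smith_seq_def le_Suc_eq less_Suc_eq)
  qed
  then show thesis using that by blast
qed

text \<open>
  The dual description: \<open>\<alpha>\<close> represents the power \<open>w\<^sup>k\<close> of the characteristic class. In
  the step, \<open>\<alpha> \<circ> half\<close> is a cochain whose transfer is \<open>\<alpha>\<close>.
\<close>

definition char_cochain :: "nat \<Rightarrow> ('a chain \<Rightarrow> bit) \<Rightarrow> bool" where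
  "char_cochain k \<alpha> \<longleftrightarrow> Modules.additive \<alpha> \<and>
     (\<forall>c. singular_chain k X c \<longrightarrow> \<alpha> (chain_map k T c) = \<alpha> c) \<and>
     (\<forall>c. singular_chain (Suc k) X c \<longrightarrow> \<alpha> (chain_boundary (Suc k) c) = 0) \<and>
     (\<forall>c. smith_seq k X T c \<longrightarrow> \<alpha> (c k) = augm (c 0))"

lemma char_cochain_exists: "\<exists>\<alpha>. char_cochain k \<alpha>"
proof (induction k)
  case 0
  show ?case
    by (intro exI [of _ augm]) (auto simp: char_cochain_def additive_augm)
next
  case (Suc k)
  then obtain \<alpha> where \<alpha>: "char_cochain k \<alpha>" by blast
  then have add: "Modules.additive \<alpha>" by (simp add: char_cochain_def)
  define a where "a c = \<alpha> (half k c)" for c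
  have adda: "Modules.additive a"
    unfolding a_def half_def using add by (rule additive_frag_extend)
  \<comment> \<open>As \<alpha> is invariant, it takes the same value on a simplex and on its
    representative.\<close>
  have a_transfer: "a (c + chain_map k T c) = \<alpha> c" if c: "singular_chain k X c" for c
  proof -
    have "\<alpha> (frag_extend (frag_of \<circ> rep k) c) = \<alpha> c"
      using c unfolding singular_chain_def
    proof (induction c rule: frag_induction)
      case (one s)
      then have "singular_chain k X (frag_of s)"
        by (simp add: singular_chain_of)
      then have "\<alpha> (frag_of (simplex_map k T s)) = \<alpha> (frag_of s)"
        using \<alpha> unfolding char_cochain_def by (metis chain_map_of)
      then show ?case
        using rep_cases [of k s] by auto
    qed (auto simp: Modules.additive.zero [OF add] frag_extend_diff Modules.additive.diff [OF add])
    then show ?thesis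
      by (simp add: a_def half_transfer [OF c])
  qed
  \<comment> \<open>The connecting map of the Smith-Gysin sequence: \<open>a\<close> has the cocycle
    \<alpha> as its transfer, so its coboundary is invariant although \<open>a\<close> itself need
    not be.\<close>
  have "char_cochain (Suc k) (\<lambda>c. a (chain_boundary (Suc k) c))"
    unfolding char_cochain_def
  proof (intro conjI allI impI)
    show "Modules.additive (\<lambda>c. a (chain_boundary (Suc k) c))"
      using adda by (rule additive_chain_boundary)
  next
    fix c assume c: "singular_chain (Suc k) X c"
    let ?b = "chain_boundary (Suc k) c"
    have b: "singular_chain k X ?b"
      using c singular_chain_boundary_alt by blast
    have "a ?b + a (chain_map k T ?b) = \<alpha> ?b"
      using a_transfer [OF b] by (simp only: Modules.additive.add [OF adda])
    also have "\<dots> = 0"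
      using \<alpha> c by (simp add: char_cochain_def)
    finally have "a (chain_map k T ?b) = a ?b"
      by (cases "a ?b"; cases "a (chain_map k T ?b)") auto
    then show "a (chain_boundary (Suc k) (chain_map (Suc k) T c)) = a ?b"
      using chain_boundary_chain_map [OF c, of T] by simp
  next
    fix c assume c: "singular_chain (Suc (Suc k)) X c"
    show "a (chain_boundary (Suc k) (chain_boundary (Suc (Suc k)) c)) = 0"
      using chain_boundary_boundary_alt [OF c] by (simp add: Modules.additive.zero [OF adda])
  next
    fix c assume c: "smith_seq (Suc k) X T c"
    then have "a (chain_boundary (Suc k) (c (Suc k))) = a (c k + chain_map k T (c k))"
      by (intro additive_cong2 [OF adda]) (auto simp: smith_seq_def)
    also have "\<dots> = \<alpha> (c k)"
      using c by (intro a_transfer) (auto simp: smith_seq_def)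
    also have "\<dots> = augm (c 0)"
      using c \<alpha> by (auto simp: smith_seq_def char_cochain_def)
    finally show "a (chain_boundary (Suc k) (c (Suc k))) = augm (c 0)" .
  qed
  then show ?case by blast
qed

end

section \<open>Cap products\<close>

abbreviation simplex_space :: "nat \<Rightarrow> (nat \<Rightarrow> real) topology" where
  "simplex_space p \<equiv> subtopology (powertop_real UNIV) (standard_simplex p)"

definition shift_coords :: "nat \<Rightarrow> (nat \<Rightarrow> real) \<Rightarrow> nat \<Rightarrow> real" where
  "shift_coords k x = (\<lambda>i. if i < k then 0 else x (i - k))"

definition front_face :: "nat \<Rightarrow> ((nat \<Rightarrow> real) \<Rightarrow> 'a) \<Rightarrow> (nat \<Rightarrow> real) \<Rightarrow> 'a" where
  "front_face k s = restrict s (standard_simplex k)"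

definition back_face :: "nat \<Rightarrow> nat \<Rightarrow> ((nat \<Rightarrow> real) \<Rightarrow> 'a) \<Rightarrow> (nat \<Rightarrow> real) \<Rightarrow> 'a" where
  "back_face k j s = restrict (s \<circ> shift_coords k) (standard_simplex j)"

text \<open>The Alexander-Whitney cap product with a cochain evaluated on the front face. A
  coefficient in the field with two elements only decides whether the back face is kept.\<close>

definition cap :: "nat \<Rightarrow> nat \<Rightarrow> ('a chain \<Rightarrow> bit) \<Rightarrow> 'a chain \<Rightarrow> 'a chain" where
  "cap k j \<alpha> = frag_extend (\<lambda>s. if \<alpha> (frag_of (front_face k s)) = 1 then frag_of (back_face k j s) else 0)"

lemma shift_coords_in:
  assumes "x \<in> standard_simplex j"
  shows "shift_coords k x \<in> standard_simplex (k + j)"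
proof -
  have "(\<Sum>i\<le>k + j. shift_coords k x i) = (\<Sum>i=k..k + j. shift_coords k x i)"
    by (rule sum.mono_neutral_right) (auto simp: shift_coords_def)
  also have "\<dots> = (\<Sum>i=0+k..j + k. shift_coords k x i)"
    by (simp add: add.commute)
  also have "\<dots> = (\<Sum>i\<le>j. x i)"
    unfolding sum.shift_bounds_cl_nat_ivl by (simp add: shift_coords_def atMost_atLeast0)
  finally show ?thesis
    using assms by (auto simp: standard_simplex_def shift_coords_def)
qed

lemma continuous_map_coordinate:
  "continuous_map (subtopology (powertop_real UNIV) S) euclideanreal (\<lambda>x. x (i::nat))"
  by (rule continuous_map_from_subtopology)
    (use continuous_map_product_coordinates [of i UNIV "\<lambda>_. euclideanreal"] in simp)

lemma continuous_map_shift_coords: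
  "continuous_map (simplex_space j)
     (simplex_space (k + j)) (shift_coords k)"
proof -
  have "continuous_map (simplex_space j) (powertop_real UNIV) (shift_coords k)"
    unfolding continuous_map_componentwise_UNIV
  proof
    fix i
    show "continuous_map (simplex_space j) euclideanreal (\<lambda>x. shift_coords k x i)"
      by (cases "i < k")
        (simp_all add: shift_coords_def continuous_map_coordinate)
  qed
  then show ?thesis
    using shift_coords_in by (auto simp: continuous_map_in_subtopology)
qed

lemma singular_simplex_front_face:
  assumes "singular_simplex (k + j) X s"
  shows "singular_simplex k X (front_face k s)"
proof -
  have "standard_simplex k \<subseteq> standard_simplex (k + j)"
    by (simp add: standard_simplex_mono)
  then have "continuous_map (simplex_space k) X s"
    using assms unfolding singular_simplex_def by (metis continuous_map_from_subtopology_mono)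
  then show ?thesis
    by (simp add: singular_simplex_def front_face_def continuous_map_eq)
qed

lemma singular_simplex_back_face:
  assumes "singular_simplex (k + j) X s"
  shows "singular_simplex j X (back_face k j s)"
proof -
  have "continuous_map (simplex_space j) X (s \<circ> shift_coords k)"
    using assms continuous_map_shift_coords continuous_map_compose
    unfolding singular_simplex_def by blast
  then show ?thesis
    by (simp add: singular_simplex_def back_face_def)
qed

lemma front_face_simplex_map:
  "front_face k (simplex_map (k + j) f s) = simplex_map k f (front_face k s)"
proof -
  have "standard_simplex k \<subseteq> standard_simplex (k + j)"
    by (simp add: standard_simplex_mono)
  then show ?thesis
    by (auto simp: front_face_def simplex_map_def fun_eq_iff)
qed

lemma back_face_simplex_map:
  "back_face k j (simplex_map (k + j) f s) = simplex_map j f (back_face k j s)"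
  by (auto simp: back_face_def simplex_map_def fun_eq_iff shift_coords_in)

lemma shift_simplical_face_low:
  "i \<le> k \<Longrightarrow> simplical_face i (shift_coords k x) = shift_coords (Suc k) x"
  by (auto simp: simplical_face_def shift_coords_def fun_eq_iff)

lemma shift_simplical_face_high:
  "simplical_face (k + i) (shift_coords k x) = shift_coords k (simplical_face i x)"
proof
  fix n
  show "simplical_face (k + i) (shift_coords k x) n = shift_coords k (simplical_face i x) n"
    by (cases "n < k"; cases "n < k + i"; cases "n = k + i")
      (auto simp: simplical_face_def shift_coords_def)
qed

lemma back_face_face_low:
  assumes "i \<le> k"
  shows "back_face k j (singular_face (k + Suc j) i s) = back_face (Suc k) j s"
  using assms by (auto simp: back_face_def singular_face_def fun_eq_iff shift_coords_in shift_simplical_face_low)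

lemma back_face_face_high:
  assumes "i \<le> Suc j"
  shows "back_face k j (singular_face (k + Suc j) (k + i) s) = singular_face (Suc j) i (back_face k (Suc j) s)"
  using assms simplical_face_in_standard_simplex [of "Suc j" i]
  by (auto simp: back_face_def singular_face_def fun_eq_iff shift_coords_in shift_simplical_face_high)

lemma front_face_face_low:
  assumes "i \<le> Suc k"
  shows "front_face k (singular_face (k + Suc j) i s) = singular_face (Suc k) i (front_face (Suc k) s)"
proof -
  have "standard_simplex k \<subseteq> standard_simplex (k + j)"
    by (simp add: standard_simplex_mono)
  then show ?thesis
    using assms simplical_face_in_standard_simplex [of "Suc k" i]
    by (auto simp: front_face_def singular_face_def fun_eq_iff)
qed

lemma simplical_face_standard:
  "x \<in> standard_simplex k \<Longrightarrow> k < i \<Longrightarrow> simplical_face i x = x"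
  by (auto simp: simplical_face_def standard_simplex_def fun_eq_iff)

lemma front_face_face_high:
  assumes "k < i"
  shows "front_face k (singular_face (k + Suc j) i s) = front_face k s"
proof -
  have "standard_simplex k \<subseteq> standard_simplex (k + j)"
    by (simp add: standard_simplex_mono)
  then show ?thesis
    using assms by (auto simp: front_face_def singular_face_def fun_eq_iff simplical_face_standard)
qed

lemma face_front_face: "singular_face (Suc k) (Suc k) (front_face (Suc k) s) = front_face k s"
  using front_face_face_low [of "Suc k" k 0 s] front_face_face_high [of k "Suc k" 0 s] by simp

lemma cong2_sum_if:
  fixes a :: "'i \<Rightarrow> bit"
  shows "(\<Sum>i\<in>I. if a i = 1 then x else 0) \<approx>\<^sub>2 (if (\<Sum>i\<in>I. a i) = 1 then x else 0)"
proof (induction I rule: infinite_finite_induct)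
  case (insert i I)
  show ?case
  proof (cases "a i = 1")
    case True
    have "(\<Sum>i\<in>insert i I. if a i = 1 then x else 0) \<approx>\<^sub>2 x + (if sum a I = 1 then x else 0)"
      using insert True cong2_add [OF cong2_refl insert.IH, of x] by simp
    also have "\<dots> \<approx>\<^sub>2 (if (\<Sum>i\<in>insert i I. a i) = 1 then x else 0)"
      using insert True by (cases "sum a I") (auto simp: cong2_0_iff)
    finally show ?thesis .
  next
    case False
    then show ?thesis
      using insert by simp
  qed
qed auto

lemma cap_diff: "cap k j \<alpha> (c - d) = cap k j \<alpha> c - cap k j \<alpha> d"
  by (simp add: cap_def frag_extend_diff)

lemma cap_add: "cap k j \<alpha> (c + d) = cap k j \<alpha> c + cap k j \<alpha> d"
  by (simp add: cap_def frag_extend_add)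

lemma cong2_cap: "c \<approx>\<^sub>2 d \<Longrightarrow> cap k j \<alpha> c \<approx>\<^sub>2 cap k j \<alpha> d"
  unfolding cap_def by (rule cong2_extend)

text \<open>Faces of index above \<open>k\<close> leave the front face alone and give the faces of
  positive index of the back face. Faces of index at most \<open>k\<close> all have the same back
  face \<open>b\<close>, and by the cocycle condition on the front face of dimension
  \<open>Suc k\<close> their coefficients add up to the value of \<alpha> on the front
  \<open>k\<close>-face. This supplies the one missing face, of index 0.\<close>

lemma boundary_cap_simplex:
  assumes add: "Modules.additive \<alpha>"
    and cocycle: "\<And>c. singular_chain (Suc k) X c \<Longrightarrow> \<alpha> (chain_boundary (Suc k) c) = 0"
    and s: "singular_simplex (k + Suc j) X s"
  shows "chain_boundary (Suc j) (cap k (Suc j) \<alpha> (frag_of s)) \<approx>\<^sub>2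
    cap k j \<alpha> (chain_boundary (k + Suc j) (frag_of s))"
proof -
  define b where "b = back_face (Suc k) j s"
  define u where "u = front_face (Suc k) s"
  define a where "a = \<alpha> (frag_of (front_face k s))"
  let ?f = "\<lambda>i. singular_face (k + Suc j) i s"
  let ?G = "\<lambda>i. if \<alpha> (frag_of (front_face k (?f i))) = 1 then frag_of (back_face k j (?f i)) else 0"
  have "singular_chain (Suc k) X (frag_of u)"
    unfolding u_def singular_chain_of by (rule singular_simplex_front_face [of _ j]) (use s in simp)
  then have "\<alpha> (chain_boundary (Suc k) (frag_of u)) = 0"
    by (rule cocycle)
  moreover have "\<alpha> (chain_boundary (Suc k) (frag_of u)) = \<alpha> (\<Sum>i\<le>Suc k. frag_of (singular_face (Suc k) i u))"
    by (rule additive_cong2 [OF add chain_boundary_of_cong2]) simp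
  ultimately have "(\<Sum>i\<le>k. \<alpha> (frag_of (singular_face (Suc k) i u))) + a = 0"
    by (simp only: Modules.additive.sum [OF add] Modules.additive.add [OF add] sum.atMost_Suc
        a_def u_def face_front_face)
  then have sum_a: "(\<Sum>i\<le>k. \<alpha> (frag_of (singular_face (Suc k) i u))) = a"
    by (cases a; cases "(\<Sum>i\<le>k. \<alpha> (frag_of (singular_face (Suc k) i u)))") auto
  have "(\<Sum>i\<le>k. ?G i) = (\<Sum>i\<le>k. if \<alpha> (frag_of (singular_face (Suc k) i u)) = 1 then frag_of b else 0)"
    unfolding u_def b_def
    by (rule sum.cong) (simp_all add: front_face_face_low back_face_face_low del: add_Suc_right)
  also have "\<dots> \<approx>\<^sub>2 (if a = 1 then frag_of b else 0)"
    using cong2_sum_if [of "\<lambda>i. \<alpha> (frag_of (singular_face (Suc k) i u))" "frag_of b" "{..k}"]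
    by (simp only: sum_a)
  finally have low: "(\<Sum>i\<le>k. ?G i) \<approx>\<^sub>2 (if a = 1 then frag_of b else 0)" .
  have high: "(\<Sum>i\<le>j. ?G (Suc k + i)) =
    (\<Sum>i\<le>j. if a = 1 then frag_of (singular_face (Suc j) (Suc i) (back_face k (Suc j) s)) else 0)"
  proof (rule sum.cong [OF refl])
    fix i assume "i \<in> {..j}"
    then have "back_face k j (?f (Suc k + i)) = singular_face (Suc j) (Suc i) (back_face k (Suc j) s)"
      using back_face_face_high [of "Suc i" j k s] by simp
    then show "?G (Suc k + i) = (if a = 1 then frag_of (singular_face (Suc j) (Suc i) (back_face k (Suc j) s)) else 0)"
      using front_face_face_high [of k "Suc k + i" j s] by (simp only: a_def lessI add_Suc le_add1 le_imp_less_Suc)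
  qed
  have b: "b = singular_face (Suc j) 0 (back_face k (Suc j) s)"
    using back_face_face_high [of 0 j k s] back_face_face_low [of k k j s] by (simp add: b_def)
  have "cap k j \<alpha> (chain_boundary (k + Suc j) (frag_of s)) \<approx>\<^sub>2 cap k j \<alpha> (\<Sum>i\<le>k + Suc j. frag_of (?f i))"
    by (rule cong2_cap [OF chain_boundary_of_cong2]) simp
  also have "cap k j \<alpha> (\<Sum>i\<le>k + Suc j. frag_of (?f i)) = (\<Sum>i\<le>k + Suc j. ?G i)"
    unfolding cap_def by (subst frag_extend_sum) (simp_all only: o_def frag_extend_of finite_atMost)
  also have "\<dots> = (\<Sum>i\<le>k. ?G i) + (\<Sum>i\<le>j. ?G (Suc k + i))"
    by (rule sum_atMost_split)
  also have "\<dots> \<approx>\<^sub>2 (if a = 1 then frag_of b else 0) + (\<Sum>i\<le>j. ?G (Suc k + i))"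
    using low by (rule cong2_add) simp
  also have "\<dots> = (if a = 1 then (\<Sum>i\<le>Suc j. frag_of (singular_face (Suc j) i (back_face k (Suc j) s))) else 0)"
    unfolding high b by (simp add: sum.atMost_Suc_shift del: sum.atMost_Suc)
  also have "\<dots> \<approx>\<^sub>2 chain_boundary (Suc j) (cap k (Suc j) \<alpha> (frag_of s))"
    using chain_boundary_of_cong2 [of "Suc j" "back_face k (Suc j) s", THEN cong2_sym]
    by (auto simp: cap_def a_def)
  finally show ?thesis by (rule cong2_sym)
qed

lemma boundary_cap:
  assumes add: "Modules.additive \<alpha>"
    and cocycle: "\<And>c. singular_chain (Suc k) X c \<Longrightarrow> \<alpha> (chain_boundary (Suc k) c) = 0"
    and c: "singular_chain (k + Suc j) X c"
  shows "chain_boundary (Suc j) (cap k (Suc j) \<alpha> c) \<approx>\<^sub>2 cap k j \<alpha> (chain_boundary (k + Suc j) c)"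
  using c unfolding singular_chain_def
proof (induction c rule: frag_induction)
  case (one s)
  then show ?case
    using boundary_cap_simplex [OF add cocycle] by blast
next
  case (diff a b)
  then show ?case
    unfolding cap_diff chain_boundary_diff by (intro cong2_diff)
qed (simp add: cap_def)

lemma cap_chain_map:
  assumes inv: "\<And>c. singular_chain k X c \<Longrightarrow> \<alpha> (chain_map k T c) = \<alpha> c"
    and c: "singular_chain (k + j) X c"
  shows "cap k j \<alpha> (chain_map (k + j) T c) = chain_map j T (cap k j \<alpha> c)"
  using c unfolding singular_chain_def
proof (induction c rule: frag_induction)
  case (one s)
  then have "singular_chain k X (frag_of (front_face k s))"
    by (simp add: singular_chain_of singular_simplex_front_face)
  then have "\<alpha> (frag_of (simplex_map k T (front_face k s))) = \<alpha> (frag_of (front_face k s))"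
    using inv by (metis chain_map_of)
  then show ?case
    by (simp add: cap_def front_face_simplex_map back_face_simplex_map)
qed (simp_all add: cap_diff chain_map_diff, simp add: cap_def)

lemma augm_cap:
  assumes add: "Modules.additive \<alpha>" and c: "singular_chain k X c"
  shows "augm (cap k 0 \<alpha> c) = \<alpha> c"
  using c unfolding singular_chain_def
proof (induction c rule: frag_induction)
  case (one s)
  then have "front_face k s = s"
    by (simp add: front_face_def singular_simplex_def extensional_restrict)
  then show ?case
    by (cases "\<alpha> (frag_of s)") (simp_all add: cap_def)
qed (simp_all add: cap_diff augm_diff Modules.additive.diff [OF add] Modules.additive.zero [OF add], simp add: cap_def)

text \<open>A simplex inside \<open>U\<close> has its front face inside \<open>U\<close>, where
  \<alpha> vanishes, so it is dropped; every simplex that survives lies in \<open>V\<close>.\<close>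

lemma singular_chain_cap:
  assumes c: "singular_chain (k + j) X c"
    and small: "\<And>s. s \<in> Poly_Mapping.keys c \<Longrightarrow> s ` standard_simplex (k + j) \<subseteq> U \<or> s ` standard_simplex (k + j) \<subseteq> V"
    and vanish: "\<And>c. singular_chain k (subtopology X U) c \<Longrightarrow> \<alpha> c = 0"
  shows "singular_chain j (subtopology X V) (cap k j \<alpha> c)"
  unfolding cap_def
proof (rule singular_chain_extend)
  fix s assume s: "s \<in> Poly_Mapping.keys c"
  then have sX: "singular_simplex (k + j) X s"
    using c by (auto simp: singular_chain_def)
  show "singular_chain j (subtopology X V)
    (if \<alpha> (frag_of (front_face k s)) = 1 then frag_of (back_face k j s) else 0)"
  proof (cases "s ` standard_simplex (k + j) \<subseteq> U")
    case True
    then have "singular_simplex (k + j) (subtopology X U) s"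
      using sX by (simp add: singular_simplex_subtopology)
    then have "\<alpha> (frag_of (front_face k s)) = 0"
      by (intro vanish) (simp add: singular_chain_of singular_simplex_front_face)
    then show ?thesis by simp
  next
    case False
    then have "singular_simplex (k + j) (subtopology X V) s"
      using sX small [OF s] by (simp add: singular_simplex_subtopology)
    then show ?thesis
      by (simp add: singular_chain_of singular_simplex_back_face)
  qed
qed

section \<open>Subdivision and coverings\<close>

abbreviation sd :: "nat \<Rightarrow> nat \<Rightarrow> 'a chain \<Rightarrow> 'a chain" where
  "sd p n \<equiv> singular_subdivision p ^^ n"

lemma singular_chain_subdivision_power:
  "singular_chain p X c \<Longrightarrow> singular_chain p X (sd p n c)"
  by (induction n) (auto simp: singular_chain_singular_subdivision)

lemma boundary_subdivision_power:
  assumes "singular_chain p X c"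
  shows "chain_boundary p (sd p n c) =
    sd (p - Suc 0) n (chain_boundary p c)"
  by (induction n)
    (auto simp: chain_boundary_singular_subdivision [OF singular_chain_subdivision_power [OF assms]])

lemma chain_map_subdivision_power:
  assumes "singular_chain p X c"
  shows "chain_map p g (sd p n c) = sd p n (chain_map p g c)"
proof (induction n)
  case (Suc n)
  then show ?case
    using naturality_singular_subdivision [OF singular_chain_subdivision_power [OF assms, of n], of g] by simp
qed auto

lemma cong2_subdivision_power:
  "c \<approx>\<^sub>2 d \<Longrightarrow> sd p n c \<approx>\<^sub>2 sd p n d"
proof (induction n)
  case (Suc n)
  then have "singular_subdivision p (sd p n c) \<approx>\<^sub>2
      singular_subdivision p (sd p n d)"
    by (metis cong2_extend singular_subdivision_def)
  then show ?case by simp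
qed auto

lemma subdivision_power_add:
  "sd p n (a + b) = sd p n a + sd p n b"
  by (induction n) (auto simp: singular_subdivision_add)

lemma subdivision_power_zero:
  "singular_chain 0 X c \<Longrightarrow> sd 0 n c = c"
  by (induction n) (auto simp: singular_subdivision_zero)

lemma smith_seq_subdivision:
  assumes c: "smith_seq k X T c"
  shows "smith_seq k X T (\<lambda>i. sd i n (c i))"
  unfolding smith_seq_def
proof (intro conjI allI impI)
  fix i assume "i \<le> k"
  then show "singular_chain i X (sd i n (c i))"
    using c singular_chain_subdivision_power unfolding smith_seq_def by blast
next
  fix i assume i: "i < k"
  then have ci: "singular_chain i X (c i)" "singular_chain (Suc i) X (c (Suc i))"
    using c unfolding smith_seq_def by auto
  have "chain_boundary (Suc i) (sd (Suc i) n (c (Suc i))) =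
    sd i n (chain_boundary (Suc i) (c (Suc i)))"
    using boundary_subdivision_power [OF ci(2)] by simp
  also have "\<dots> \<approx>\<^sub>2 sd i n (c i + chain_map i T (c i))"
    using c i by (intro cong2_subdivision_power) (auto simp: smith_seq_def)
  also have "\<dots> = sd i n (c i) + chain_map i T (sd i n (c i))"
    by (simp add: subdivision_power_add chain_map_subdivision_power [OF ci(1)])
  finally show "chain_boundary (Suc i) (sd (Suc i) n (c (Suc i))) \<approx>\<^sub>2
    sd i n (c i) + chain_map i T (sd i n (c i))" .
qed

lemma smith_seq_subtopology:
  "smith_seq k (subtopology X U) T c \<Longrightarrow> smith_seq k X T c"
  by (auto simp: smith_seq_def singular_chain_subtopology)

context free_involution
begin

text \<open>
  If the index of \<open>U\<close> is at most \<open>k\<close>, then the class \<open>w\<^sup>k\<^sup>+\<^sup>1\<close> vanishes on \<open>U\<close>: on chains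
  of \<open>U\<close> its cochain factors through the boundary by an invariant cochain, which is extended by
  zero and subtracted.
\<close>

lemma char_cochain_vanishing:
  assumes U: "\<And>x. x \<in> U \<Longrightarrow> x \<in> topspace X \<Longrightarrow> T x \<in> U"
    and index: "\<not> smith_index_ge (subtopology X U) T (Suc k)"
  obtains \<alpha> where "char_cochain (Suc k) \<alpha>"
    "\<And>c. singular_chain (Suc k) (subtopology X U) c \<Longrightarrow> \<alpha> c = 0"
proof -
  let ?U = "subtopology X U"
  interpret U: free_involution ?U T F
    using U by (rule subspace)
  obtain \<alpha> where \<alpha>: "char_cochain (Suc k) \<alpha>"
    using char_cochain_exists by blast
  then have add: "Modules.additive \<alpha>" by (simp add: char_cochain_def)
  show thesis
  proof (cases "\<forall>c. singular_chain (Suc k) ?U c \<longrightarrow> \<alpha> c = 0")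
    case True
    then show thesis using \<alpha> that by blast
  next
    case False
    then obtain c1 where c1: "singular_chain (Suc k) ?U c1" "\<alpha> c1 = 1"
      by auto
    \<comment> \<open>The functional \<open>v\<close> sought below has to satisfy
      \<open>v (chain_boundary (Suc k) c) = \<alpha> c\<close> on chains of \<open>U\<close> and to
      kill transfers. On the image of \<open>A\<close> under \<open>L\<close> this prescribes the
      value 0, and on the boundary of \<open>c1\<close> the value 1.\<close>
    define A where "A = {(c, r). singular_chain (Suc k) ?U c \<and> \<alpha> c = 0 \<and> singular_chain k ?U r}"
    define L where "L = (\<lambda>(c, r). chain_boundary (Suc k) c + (r + chain_map k T r))"
    \<comment> \<open>Otherwise \<open>c1 - c\<close> has a transfer as its boundary, so it is the
      top of a Smith sequence of \<open>U\<close>. Its augmentation is the value 1 of \<alpha> on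
      \<open>c1 - c\<close>, against the bound on the index of \<open>U\<close>.\<close>
    have no_top: "\<not> chain_boundary (Suc k) c1 \<approx>\<^sub>2 L (c, r)" if "(c, r) \<in> A" for c r
    proof
      assume eq: "chain_boundary (Suc k) c1 \<approx>\<^sub>2 L (c, r)"
      have c: "singular_chain (Suc k) ?U c" "\<alpha> c = 0" "singular_chain k ?U r"
        using that by (auto simp: A_def)
      let ?c = "c1 - c"
      have c': "singular_chain (Suc k) ?U ?c"
        using c1 c singular_chain_diff by blast
      have "chain_boundary (Suc k) ?c \<approx>\<^sub>2 r + chain_map k T r"
        using eq by (simp add: cong2_def chain_boundary_diff L_def algebra_simps)
      then have "chain_boundary (Suc k) ?c + chain_map k T (chain_boundary (Suc k) ?c) \<approx>\<^sub>2
        (r + chain_map k T r) + chain_map k T (r + chain_map k T r)"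
        by (intro cong2_add cong2_chain_map)
      then have "even_chain (chain_boundary (Suc k) (?c + chain_map (Suc k) T ?c))"
        using U.transfer_transfer [OF c(3)] even_chain_cong2 U.boundary_transfer [OF c'] by metis
      then obtain d where d: "smith_seq (Suc k) ?U T d" "d (Suc k) = ?c"
        using U.smith_seq_descend [OF c'] by blast
      then have "augm (d 0) = \<alpha> ?c"
        using \<alpha> smith_seq_subtopology unfolding char_cochain_def by metis
      also have "\<dots> = 1"
        using c1 c by (simp add: Modules.additive.diff [OF add])
      finally show False
        using index d(1) unfolding smith_index_ge_def by blast
    qed
    obtain v where addv: "Modules.additive v" and vA: "\<And>x. x \<in> A \<Longrightarrow> v (L x) = 0"
      and vc1: "v (chain_boundary (Suc k) c1) = (1::bit)"
    proof (rule exists_separating_additive_mod2 [of A L "chain_boundary (Suc k) c1"])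
      show "0 \<in> A"
        by (simp add: A_def zero_prod_def Modules.additive.zero [OF add])
      show "x - y \<in> A" if "x \<in> A" "y \<in> A" for x y
        using that by (auto simp: A_def Modules.additive.diff [OF add] intro: singular_chain_diff)
      show "L (x - y) = L x - L y" for x y
        by (cases x; cases y) (simp add: L_def chain_boundary_diff chain_map_diff)
    qed (use no_top in \<open>auto simp: A_def\<close>)
    have v_boundary: "v (chain_boundary (Suc k) c) = \<alpha> c" if c: "singular_chain (Suc k) ?U c" for c
    proof (cases "\<alpha> c = 0")
      case True
      then show ?thesis
        using vA [of "(c, 0)"] c by (simp add: A_def L_def)
    next
      case False
      then have "\<alpha> (c1 - c) = 0"
        using c1 by (simp add: Modules.additive.diff [OF add])
      then have "v (chain_boundary (Suc k) (c1 - c)) = 0"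
        using vA [of "(c1 - c, 0)"] singular_chain_diff [OF c1(1) c] by (simp add: A_def L_def)
      then have "v (chain_boundary (Suc k) c1) - v (chain_boundary (Suc k) c) = 0"
        by (simp only: chain_boundary_diff Modules.additive.diff [OF addv])
      then show ?thesis
        using vc1 False by (cases "v (chain_boundary (Suc k) c)") auto
    qed
    have v_transfer: "v (r + chain_map k T r) = 0" if "singular_chain k ?U r" for r
      using vA [of "(0, r)"] that by (simp add: A_def L_def Modules.additive.zero [OF add])
    define res where "res = frag_extend (\<lambda>s. if s ` standard_simplex k \<subseteq> U then frag_of s else 0)"
    have res_U: "singular_chain k ?U (res r)" if "singular_chain k X r" for r
      unfolding res_def using that
      by (intro singular_chain_extend) (auto simp: singular_chain_of singular_simplex_subtopology singular_chain_def)
    have res_id: "res r = r" if "singular_chain k ?U r" for r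
    proof -
      have "res r = frag_extend frag_of r"
        unfolding res_def using that by (intro frag_extend_eq) (auto simp: singular_chain_subtopology)
      then show ?thesis using frag_expansion by metis
    qed
    have res_T: "res (chain_map k T r) = chain_map k T (res r)" if "singular_chain k X r" for r
      using that unfolding singular_chain_def
    proof (induction r rule: frag_induction)
      case (one s)
      then have s: "singular_simplex k X s" by simp
      then have sX: "s x \<in> topspace X" if "x \<in> standard_simplex k" for x
        using that by (auto simp: singular_simplex_def continuous_map_def)
      have "simplex_map k T s ` standard_simplex k \<subseteq> U \<longleftrightarrow> s ` standard_simplex k \<subseteq> U"
        using U sX T_T T_in by (auto simp: simplex_map_def image_subset_iff) metis
      then show ?case by (simp add: res_def)
    qed (simp_all add: chain_map_diff, simp_all add: res_def frag_extend_diff chain_map_diff)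
    define b where "b = (\<lambda>c. v (res c))"
    have addb: "Modules.additive b"
      unfolding b_def res_def using addv by (rule additive_frag_extend)
    have b_transfer: "b (r + chain_map k T r) = 0" if r: "singular_chain k X r" for r
    proof -
      have "res (r + chain_map k T r) = res r + chain_map k T (res r)"
        using res_T [OF r] by (simp add: res_def frag_extend_add)
      then show ?thesis
        using v_transfer [OF res_U [OF r]] by (simp only: b_def)
    qed
    \<comment> \<open>Since \<open>b\<close> kills transfers, its coboundary is invariant and
      vanishes on the tops of Smith sequences, so adding it keeps every property of a characteristic
      cochain.\<close>
    define \<beta> where "\<beta> = (\<lambda>c. \<alpha> c + b (chain_boundary (Suc k) c))"
    have "char_cochain (Suc k) \<beta>"
      unfolding char_cochain_def
    proof (intro conjI allI impI)
      show "Modules.additive \<beta>"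
        unfolding \<beta>_def using add additive_chain_boundary [OF addb] by (rule additive_plus)
    next
      fix c assume c: "singular_chain (Suc k) X c"
      let ?b = "chain_boundary (Suc k) c"
      have "b ?b + b (chain_map k T ?b) = 0"
        using b_transfer [OF singular_chain_boundary_alt [OF c]] by (simp only: Modules.additive.add [OF addb])
      then have "b (chain_map k T ?b) = b ?b"
        by (cases "b ?b"; cases "b (chain_map k T ?b)") auto
      moreover have "\<alpha> (chain_map (Suc k) T c) = \<alpha> c"
        using \<alpha> c by (simp add: char_cochain_def)
      ultimately show "\<beta> (chain_map (Suc k) T c) = \<beta> c"
        using chain_boundary_chain_map [OF c, of T] by (simp only: \<beta>_def diff_Suc_Suc diff_zero)
    next
      fix c assume c: "singular_chain (Suc (Suc k)) X c"
      have "\<alpha> (chain_boundary (Suc (Suc k)) c) = 0"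
        using \<alpha> c by (simp add: char_cochain_def)
      then show "\<beta> (chain_boundary (Suc (Suc k)) c) = 0"
        using chain_boundary_boundary_alt [OF c] by (simp add: \<beta>_def Modules.additive.zero [OF addb])
    next
      fix c assume c: "smith_seq (Suc k) X T c"
      then have "b (chain_boundary (Suc k) (c (Suc k))) = b (c k + chain_map k T (c k))"
        by (intro additive_cong2 [OF addb]) (auto simp: smith_seq_def)
      also have "\<dots> = 0"
        using c by (intro b_transfer) (auto simp: smith_seq_def)
      finally show "\<beta> (c (Suc k)) = augm (c 0)"
        using \<alpha> c by (simp add: \<beta>_def char_cochain_def)
    qed
    moreover have "\<beta> c = 0" if c: "singular_chain (Suc k) ?U c" for c
      using v_boundary [OF c] res_id [OF singular_chain_boundary_alt [OF c]] by (simp add: \<beta>_def b_def)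
    ultimately show thesis using that by blast
  qed
qed

text \<open>The cap-product form of a familiar cup-product argument: if one power of
  \<open>w\<close> vanishes on \<open>U\<close> and another on \<open>V\<close>, then their product
  vanishes on the union.\<close>

theorem smith_index_cover:
  assumes U: "openin X U" "\<And>x. x \<in> U \<Longrightarrow> T x \<in> U" and V: "openin X V"
    and cover: "topspace X \<subseteq> U \<union> V"
    and index: "smith_index_ge X T (Suc k + l)" "\<not> smith_index_ge (subtopology X U) T (Suc k)"
  shows "smith_index_ge (subtopology X V) T l"
proof -
  obtain \<alpha> where \<alpha>: "char_cochain (Suc k) \<alpha>"
    and vanish: "\<And>c. singular_chain (Suc k) (subtopology X U) c \<Longrightarrow> \<alpha> c = 0"
    using char_cochain_vanishing index(2) U(2) by metis
  obtain c where c: "smith_seq (Suc k + l) X T c" "augm (c 0) = 1"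
    using index(1) by (auto simp: smith_index_ge_def)
  have "\<exists>n. \<forall>m\<ge>n. \<forall>s\<in>Poly_Mapping.keys (sd i m (c i)).
      s ` standard_simplex i \<subseteq> U \<or> s ` standard_simplex i \<subseteq> V" if i: "i \<le> Suc k + l" for i
  proof -
    have ci: "singular_chain i X (c i)"
      using c(1) i by (auto simp: smith_seq_def)
    obtain n where n: "\<And>m f. \<lbrakk>n \<le> m; f \<in> Poly_Mapping.keys (sd i m (c i))\<rbrakk>
                      \<Longrightarrow> \<exists>W \<in> {U, V}. f \<in> standard_simplex i \<rightarrow> W"
      by (rule sufficient_iterated_singular_subdivision_exists [of "{U, V}" X i "c i"])
        (use U V cover ci in auto)
    then show ?thesis
      by (intro exI [of _ n]) (auto simp: Pi_iff image_subset_iff)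
  qed
  then obtain n where n: "\<And>i m s. \<lbrakk>i \<le> Suc k + l; n i \<le> m; s \<in> Poly_Mapping.keys (sd i m (c i))\<rbrakk>
      \<Longrightarrow> s ` standard_simplex i \<subseteq> U \<or> s ` standard_simplex i \<subseteq> V"
    by metis
  \<comment> \<open>All members of the sequence have to be subdivided equally often, or the
    relations between them are lost; the sum is a common bound for the \<open>n i\<close>.\<close>
  define m where "m = (\<Sum>i\<le>Suc k + l. n i)"
  have nm: "n i \<le> m" if "i \<le> Suc k + l" for i
    unfolding m_def using that by (intro member_le_sum) auto
  define e where "e i = sd i m (c i)" for i
  have e: "smith_seq (Suc k + l) X T e"
    unfolding e_def using c(1) by (rule smith_seq_subdivision)
  have small: "s ` standard_simplex i \<subseteq> U \<or> s ` standard_simplex i \<subseteq> V"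
    if "i \<le> Suc k + l" "s \<in> Poly_Mapping.keys (e i)" for i s
    using n [OF that(1) nm [OF that(1)]] that(2) by (simp add: e_def)
  define d where "d j = cap (Suc k) j \<alpha> (e (Suc k + j))" for j
  have add: "Modules.additive \<alpha>"
    using \<alpha> by (simp add: char_cochain_def)
  have eX: "singular_chain i X (e i)" if "i \<le> Suc k + l" for i
    using e that by (simp add: smith_seq_def)
  have "smith_seq l (subtopology X V) T d"
    unfolding smith_seq_def
  proof (intro conjI allI impI)
    fix j assume j: "j \<le> l"
    show "singular_chain j (subtopology X V) (d j)"
      unfolding d_def
      by (rule singular_chain_cap [OF eX _ vanish]) (use j small in auto)
  next
    fix j assume j: "j < l"
    have ej: "singular_chain (Suc k + j) X (e (Suc k + j))" "singular_chain (Suc k + Suc j) X (e (Suc k + Suc j))"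
      using j by (intro eX; simp)+
    have "chain_boundary (Suc j) (d (Suc j)) \<approx>\<^sub>2 cap (Suc k) j \<alpha> (chain_boundary (Suc k + Suc j) (e (Suc k + Suc j)))"
      unfolding d_def
      by (rule boundary_cap [OF add _ ej(2)]) (use \<alpha> in \<open>simp add: char_cochain_def\<close>)
    also have "\<dots> \<approx>\<^sub>2 cap (Suc k) j \<alpha> (e (Suc k + j) + chain_map (Suc k + j) T (e (Suc k + j)))"
      using e j by (intro cong2_cap) (auto simp: smith_seq_def)
    also have "\<dots> = d j + chain_map j T (d j)"
      unfolding d_def cap_add
      by (subst cap_chain_map [OF _ ej(1)]) (use \<alpha> in \<open>simp_all add: char_cochain_def\<close>)
    finally show "chain_boundary (Suc j) (d (Suc j)) \<approx>\<^sub>2 d j + chain_map j T (d j)" .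
  qed
  \<comment> \<open>The lowest member of the shortened sequence records the value of \<alpha> on the
    top of the sequence \<open>e\<close> cut off at \<open>Suc k\<close>, and subdivision does
    nothing in degree 0.\<close>
  moreover have "augm (d 0) = 1"
  proof -
    have "augm (d 0) = \<alpha> (e (Suc k))"
      unfolding d_def using augm_cap [OF add eX [of "Suc k"]] by simp
    also have "\<dots> = augm (e 0)"
      using \<alpha> smith_seq_mono [OF e, of "Suc k"] unfolding char_cochain_def by simp
    also have "e 0 = c 0"
      unfolding e_def by (rule subdivision_power_zero [of X]) (use c(1) in \<open>simp add: smith_seq_def\<close>)
    finally show ?thesis using c(2) by simp
  qed
  ultimately show ?thesis
    unfolding smith_index_ge_def by blast
qed

text \<open>The sign of the function splits \<open>X\<close> into two open parts exchanged by
  \<open>T\<close>. Counting the points of the positive part modulo 2 gives a functional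
  \<open>p\<close> that vanishes on boundaries, while on a transfer it is the augmentation.\<close>

lemma smith_index_single_function:
  assumes j: "\<And>x. x \<in> topspace X \<Longrightarrow> F x j \<noteq> 0"
  shows "\<not> smith_index_ge X T (Suc 0)"
proof
  assume "smith_index_ge X T (Suc 0)"
  then obtain c where c: "smith_seq (Suc 0) X T c" "augm (c 0) = 1"
    by (auto simp: smith_index_ge_def)
  let ?v = "\<lambda>i::nat. if i = 0 then 1 else (0::real)"
  define p where "p c = augm (frag_extend (\<lambda>s. if F (s ?v) j > 0 then frag_of s else 0) c)" for c :: "'a chain"
  have addp: "Modules.additive p"
    unfolding p_def using additive_augm by (rule additive_frag_extend)
  have v: "?v \<in> standard_simplex q" for q
    using basis_in_standard_simplex [of 0 q] by simp
  have p_transfer: "p (r + chain_map 0 T r) = augm r" if "singular_chain 0 X r" for r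
    using that unfolding singular_chain_def
  proof (induction r rule: frag_induction)
    case (one s)
    then have "s ?v \<in> topspace X"
      using v by (auto simp: singular_simplex_def continuous_map_def)
    then have "F (s ?v) j \<noteq> 0" "F (simplex_map 0 T s ?v) j = - F (s ?v) j"
      using j F_odd v by (auto simp: simplex_map_def)
    then show ?case
      by (auto simp: p_def frag_extend_add augm_add)
  next
    case (diff a b)
    have "a - b + chain_map 0 T (a - b) = (a + chain_map 0 T a) - (b + chain_map 0 T b)"
      by (simp add: chain_map_diff)
    then show ?case
      by (simp only: Modules.additive.diff [OF addp] diff augm_diff)
  qed (simp add: p_def)
  have p_boundary: "p (chain_boundary (Suc 0) r) = 0" if "singular_chain (Suc 0) X r" for r
    using that unfolding singular_chain_def
  proof (induction r rule: frag_induction)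
    case (one s)
    then have s: "continuous_map (simplex_space (Suc 0)) X s"
      by (simp add: singular_simplex_def)
    then have "continuous_map (simplex_space (Suc 0)) euclideanreal ((\<lambda>x. F x j) \<circ> s)"
      using F_cont continuous_map_compose by blast
    then have "connectedin euclideanreal (((\<lambda>x. F x j) \<circ> s) ` standard_simplex (Suc 0))"
      by (rule connectedin_continuous_map_image)
        (simp add: connectedin_subtopology connectedin_standard_simplex)
    then have conn: "connected (((\<lambda>x. F x j) \<circ> s) ` standard_simplex (Suc 0))"
      by simp
    have nz: "F (s x) j \<noteq> 0" if "x \<in> standard_simplex (Suc 0)" for x
      using s that j by (auto simp: continuous_map_def)
    have sign: "F (s x) j > 0 \<longleftrightarrow> F (s y) j > 0"
      if "x \<in> standard_simplex (Suc 0)" "y \<in> standard_simplex (Suc 0)" for x y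
    proof -
      have "0 \<in> ((\<lambda>x. F x j) \<circ> s) ` standard_simplex (Suc 0)"
        if "F (s x) j < 0" "F (s y) j > 0" "x \<in> standard_simplex (Suc 0)" "y \<in> standard_simplex (Suc 0)" for x y
        using connectedD_interval [OF conn, of "F (s x) j" "F (s y) j" 0] that by force
      then show ?thesis
        using that nz [OF that(1)] nz [OF that(2)] nz
        by (smt (verit, del_insts) comp_apply imageE)
    qed
    \<comment> \<open>Both ends of a path have the sign found at its start, so they cancel in
      \<open>p\<close>.\<close>
    have "F (singular_face (Suc 0) i s ?v) j > 0 \<longleftrightarrow> F (s ?v) j > 0" if "i \<le> Suc 0" for i
    proof -
      have "simplical_face i ?v \<in> standard_simplex (Suc 0)"
        using that v by (intro simplical_face_in_standard_simplex) auto
      then have "F (s (simplical_face i ?v)) j > 0 \<longleftrightarrow> F (s ?v) j > 0"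
        using sign v by blast
      moreover have "singular_face (Suc 0) i s ?v = s (simplical_face i ?v)"
        using v [of 0] by (simp only: singular_face_def diff_Suc_Suc diff_zero restrict_apply' comp_apply)
      ultimately show ?thesis by metis
    qed
    then have "p (frag_of (singular_face (Suc 0) i s)) = (if F (s ?v) j > 0 then 1 else 0)" if "i \<le> Suc 0" for i
      using that by (simp add: p_def)
    moreover have "p (chain_boundary (Suc 0) (frag_of s)) = p (\<Sum>i\<le>Suc 0. frag_of (singular_face (Suc 0) i s))"
      by (rule additive_cong2 [OF addp chain_boundary_of_cong2]) simp
    ultimately show ?case
      by (simp add: Modules.additive.add [OF addp])
  qed (simp_all add: chain_boundary_diff Modules.additive.diff [OF addp], simp add: p_def)
  have "p (chain_boundary (Suc 0) (c (Suc 0))) = p (c 0 + chain_map 0 T (c 0))"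
    using c(1) by (intro additive_cong2 [OF addp]) (simp add: smith_seq_def)
  then show False
    using c p_boundary p_transfer by (simp add: smith_seq_def)
qed

end

text \<open>A Borsuk-Ulam bound: \<open>n\<close> odd functions without a common zero map
  \<open>X\<close> to a sphere of dimension \<open>n - 1\<close>. The last function alone splits its
  nonvanishing set into two parts, which costs one unit of the index, and the remaining functions
  serve on the rest by induction.\<close>

theorem smith_index_bounded:
  assumes "free_involution X T F" "\<And>x. x \<in> topspace X \<Longrightarrow> \<exists>i<n. F x i \<noteq> 0"
  shows "\<not> smith_index_ge X T n"
  using assms
proof (induction n arbitrary: X)
  case 0
  then have "topspace X = {}" by blast
  then show ?case
    by (auto simp: smith_index_ge_def smith_seq_def singular_chain_empty)
next
  case (Suc n)
  interpret free_involution X T F by (rule Suc.prems)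
  define U where "U = {x \<in> topspace X. F x n \<in> - {0}}"
  define V where "V = (\<Union>i<n. {x \<in> topspace X. F x i \<in> - {0}})"
  have open_i: "openin X {x \<in> topspace X. F x i \<in> - {0}}" for i
    by (rule openin_continuous_map_preimage [OF F_cont]) auto
  have "openin X U" "openin X V"
    unfolding U_def V_def using open_i by auto
  moreover have "T x \<in> U" if "x \<in> U" for x
    using that T_in F_odd by (auto simp: U_def)
  moreover have TV: "T x \<in> V" if "x \<in> V" for x
    using that T_in F_odd by (auto simp: V_def)
  moreover have "topspace X \<subseteq> U \<union> V"
    using Suc.prems(2) by (fastforce simp: U_def V_def less_Suc_eq)
  moreover have "\<not> smith_index_ge (subtopology X U) T (Suc 0)"
  proof -
    interpret U: free_involution "subtopology X U" T F
      by (rule subspace) (use T_in F_odd in \<open>auto simp: U_def\<close>)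
    show ?thesis
      by (rule U.smith_index_single_function [of n]) (simp add: U_def)
  qed
  moreover have "\<not> smith_index_ge (subtopology X V) T n"
    using TV by (intro Suc.IH subspace) (auto simp: V_def)
  ultimately show ?case
    using smith_index_cover [of U V 0 n] by (metis plus_1_eq_Suc One_nat_def)
qed

section \<open>Orbit spaces of free involutions\<close>

context free_involution
begin

definition orb :: "'a \<Rightarrow> 'a set" where
  "orb x = {x, T x}"

abbreviation Orb :: "'a set topology" where
  "Orb \<equiv> quotient_topology X orb"

lemma orb_T: "x \<in> topspace X \<Longrightarrow> orb (T x) = orb x"
  by (auto simp: orb_def T_T)

lemma orb_eq_iff: "x \<in> topspace X \<Longrightarrow> y \<in> topspace X \<Longrightarrow> orb x = orb y \<longleftrightarrow> y = x \<or> y = T x"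
  by (auto simp: orb_def T_T doubleton_eq_iff)

lemma continuous_map_orb: "continuous_map X Orb orb"
  using quotient_map_quotient_topology quotient_imp_continuous_map by blast

lemma chain_map_orb_T: "singular_chain p X c \<Longrightarrow> chain_map p orb (chain_map p T c) = chain_map p orb c"
  by (subst chain_map_comm [of p X c orb T id])
    (auto simp: orb_T intro: chain_map_ident singular_chain_chain_map continuous_map_orb)

lemma even_chain_orb_transfer:
  assumes "singular_chain p X c"
  shows "even_chain (chain_map p orb (c + chain_map p T c))"
  by (simp add: chain_map_add chain_map_orb_T [OF assms])

text \<open>At each point the two lifts are equal or opposite, and the signs of the products
  \<open>P i\<close> tell which. Both cases are open conditions, so connectedness of the simplex
  leaves only one of them.\<close>

lemma lift_unique:
  assumes s: "singular_simplex p X s" and t: "singular_simplex p X t"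
    and eq: "simplex_map p orb s = simplex_map p orb t"
  shows "t = s \<or> t = simplex_map p T s"
proof -
  let ?D = "simplex_space p"
  have sc: "continuous_map ?D X s" and tc: "continuous_map ?D X t"
    using s t by (auto simp: singular_simplex_def)
  have in_X: "s x \<in> topspace X" "t x \<in> topspace X" if "x \<in> standard_simplex p" for x
    using that sc tc by (auto simp: continuous_map_def)
  have cases: "t x = s x \<or> t x = T (s x)" if x: "x \<in> standard_simplex p" for x
  proof -
    have "orb (s x) = orb (t x)"
      using fun_cong [OF eq, of x] x by (simp add: simplex_map_def)
    then show ?thesis
      using in_X [OF x] orb_eq_iff by blast
  qed
  define P where "P i = (\<lambda>x. F (s x) i * F (t x) i)" for i
  have P_cont: "continuous_map ?D euclideanreal (P i)" for i
    unfolding P_def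
    using continuous_map_compose [OF sc F_cont [of i]] continuous_map_compose [OF tc F_cont [of i]]
    by (intro continuous_map_real_mult) (simp_all add: o_def)
  define A where "A = (\<Union>i. {x \<in> topspace ?D. P i x \<in> {0<..}})"
  define B where "B = (\<Union>i. {x \<in> topspace ?D. P i x \<in> {..<0}})"
  have "openin ?D {x \<in> topspace ?D. P i x \<in> {0<..}}" "openin ?D {x \<in> topspace ?D. P i x \<in> {..<0}}" for i
    by (rule openin_continuous_map_preimage [OF P_cont]; simp)+
  then have "openin ?D A" "openin ?D B"
    unfolding A_def B_def by blast+
  have A: "x \<in> A \<longleftrightarrow> t x = s x" and B: "x \<in> B \<longleftrightarrow> t x = T (s x)" if x: "x \<in> standard_simplex p" for x
  proof -
    have nz: "\<exists>i. F (s x) i \<noteq> 0"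
      using in_X x F_nonzero by blast
    have odd: "F (T (s x)) i = - F (s x) i" for i
      using in_X x F_odd by blast
    have pos: "(\<exists>i. P i x > 0) \<and> (\<nexists>i. P i x < 0)" if "t x = s x"
      using nz that by (auto simp: P_def not_less) (metis linorder_neq_iff mult_neg_neg mult_pos_pos)
    have neg: "(\<exists>i. P i x < 0) \<and> (\<nexists>i. P i x > 0)" if "t x = T (s x)"
      using nz that odd
      by (auto simp: P_def not_less zero_less_mult_iff) (metis linorder_neq_iff mult_neg_neg mult_pos_pos)
    show "x \<in> A \<longleftrightarrow> t x = s x" "x \<in> B \<longleftrightarrow> t x = T (s x)"
      using pos neg cases [OF x] x by (auto simp: A_def B_def)
  qed
  have "A \<inter> B = {}"
  proof -
    have "x \<notin> B" if "x \<in> A" for x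
    proof -
      have x: "x \<in> standard_simplex p" using that by (auto simp: A_def)
      then have "t x = s x" using A that by blast
      then show ?thesis using B [OF x] T_free in_X [OF x] by metis
    qed
    then show ?thesis by blast
  qed
  moreover have "topspace ?D \<subseteq> A \<union> B"
    using cases A B by auto
  moreover have "connected_space ?D"
    using connectedin_standard_simplex connectedin_def by blast
  ultimately have "A = {} \<or> B = {}"
    using \<open>openin ?D A\<close> \<open>openin ?D B\<close> unfolding connected_space_def by blast
  then have "(\<forall>x\<in>standard_simplex p. t x = s x) \<or> (\<forall>x\<in>standard_simplex p. t x = T (s x))"
    using cases A B by blast
  then show ?thesis
  proof
    assume "\<forall>x\<in>standard_simplex p. t x = s x"
    then have "t = s"
      using s t unfolding singular_simplex_def by (metis extensionalityI)
    then show ?thesis ..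
  next
    assume *: "\<forall>x\<in>standard_simplex p. t x = T (s x)"
    have "t = simplex_map p T s"
      by (rule extensionalityI [of _ "standard_simplex p"])
        (use t * in \<open>auto simp: singular_simplex_def simplex_map_def\<close>)
    then show ?thesis ..
  qed
qed

text \<open>By uniqueness of lifts the representative of a simplex depends on its image in the orbit
  space only, so an even image forces an even sum of representatives.\<close>

lemma ker_orb:
  assumes c: "singular_chain p X c" and even: "even_chain (chain_map p orb c)"
  obtains r where "singular_chain p X r" "c \<approx>\<^sub>2 r + chain_map p T r"
proof -
  \<comment> \<open>The lifts of a projected simplex form exactly the pair from which
    \<open>rep\<close> chooses, so the two choices from this set are the same term.\<close>
  define sel where "sel u = (SOME t. t \<in> {t. singular_simplex p X t \<and> simplex_map p orb t = u})" for u
  have rep_sel: "rep p s = sel (simplex_map p orb s)" if s: "singular_simplex p X s" for s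
  proof -
    have "simplex_map p orb (simplex_map p T s) = simplex_map p orb s"
      using s orb_T by (auto simp: simplex_map_def singular_simplex_def continuous_map_def fun_eq_iff Pi_iff)
    then have "{t. singular_simplex p X t \<and> simplex_map p orb t = simplex_map p orb s} = {s, simplex_map p T s}"
      using lift_unique [OF s] s simplex_T(1) [OF s] by (auto dest: sym)
    then show ?thesis
      unfolding rep_def sel_def by metis
  qed
  have "frag_extend (frag_of \<circ> sel) (chain_map p orb c) = frag_extend ((frag_of \<circ> sel) \<circ> simplex_map p orb) c"
    unfolding chain_map_def by (rule frag_extend_compose)
  also have "\<dots> = frag_extend (frag_of \<circ> rep p) c"
    using c rep_sel by (intro frag_extend_eq) (auto simp: singular_chain_def)
  finally have "even_chain (frag_extend (frag_of \<circ> rep p) c)"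
    using even_chain_extend [OF even] by metis
  then show thesis
    using transfer_preimage [OF c] that by blast
qed

section \<open>Local sections of the orbit map and lifting of small chains\<close>

definition sheet :: "nat \<Rightarrow> 'a set set" where
  "sheet i = orb ` {x \<in> topspace X. F x i > 0}"

definition sect :: "nat \<Rightarrow> 'a set \<Rightarrow> 'a" where
  "sect i w = (SOME x. x \<in> w \<and> F x i > 0)"

lemma sect_orb:
  assumes "x \<in> topspace X" "F x i > 0"
  shows "sect i (orb x) = x"
  unfolding sect_def
proof (rule some_equality)
  show "x \<in> orb x \<and> F x i > 0"
    using assms by (simp add: orb_def)
  show "y = x" if "y \<in> orb x \<and> F y i > 0" for y
    using that assms F_odd [OF assms(1), of i] by (auto simp: orb_def)
qed

lemma openin_orb_image:
  assumes "openin X W"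
  shows "openin Orb (orb ` W)"
proof -
  have W: "W \<subseteq> topspace X" using assms openin_subset by blast
  have "{x \<in> topspace X. orb x \<in> orb ` W} = W \<union> {x \<in> topspace X. T x \<in> W}"
  proof -
    have "x \<in> W \<or> T x \<in> W" if "x \<in> topspace X" "orb x = orb y" "y \<in> W" for x y
      using that W orb_eq_iff [of x y] by blast
    moreover have "orb x \<in> orb ` W" if "x \<in> topspace X" "T x \<in> W" for x
      using that orb_T by (metis image_eqI)
    ultimately show ?thesis using W by blast
  qed
  moreover have "openin X {x \<in> topspace X. T x \<in> W}"
    using openin_continuous_map_preimage [OF T_cont assms] .
  ultimately show ?thesis
    using assms W by (auto simp: openin_quotient_topology)
qed

lemma openin_F_pos: "openin X {x \<in> topspace X. F x i > 0}"
  using openin_continuous_map_preimage [OF F_cont [of i], of "{0<..}"] by simp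

lemma openin_sheet: "openin Orb (sheet i)"
  unfolding sheet_def by (rule openin_orb_image [OF openin_F_pos])

lemma sheets_cover: "topspace Orb \<subseteq> (\<Union>i. sheet i)"
proof -
  have "orb x \<in> (\<Union>i. sheet i)" if x: "x \<in> topspace X" for x
  proof -
    obtain i where "F x i \<noteq> 0" using F_nonzero x by blast
    then consider "F x i > 0" | "F (T x) i > 0"
      using F_odd [OF x, of i] by linarith
    then show ?thesis
    proof cases
      case 1
      then show ?thesis using x by (auto simp: sheet_def)
    next
      case 2
      then have "orb (T x) \<in> sheet i" using x T_in by (auto simp: sheet_def)
      then show ?thesis using orb_T [OF x] by auto
    qed
  qed
  then show ?thesis by auto
qed

text \<open>The preimage of \<open>W\<close> under the section is the image of an open set under the
  orbit map, which is open.\<close>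

lemma continuous_map_sect: "continuous_map (subtopology Orb (sheet i)) X (sect i)"
  unfolding continuous_map
proof (intro conjI allI impI)
  show "sect i ` topspace (subtopology Orb (sheet i)) \<subseteq> topspace X"
    by (auto simp: sheet_def sect_orb)
  fix W assume W: "openin X W"
  let ?P = "{x \<in> topspace X. F x i > 0}"
  have "{w \<in> topspace (subtopology Orb (sheet i)). sect i w \<in> W} = orb ` (W \<inter> ?P)"
    using openin_subset [OF W] by (auto simp: sheet_def sect_orb)
  moreover have "openin Orb (orb ` (W \<inter> ?P))"
    using W openin_F_pos openin_orb_image by blast
  moreover have "orb ` (W \<inter> ?P) \<subseteq> sheet i"
    by (auto simp: sheet_def)
  ultimately show "openin (subtopology Orb (sheet i)) {w \<in> topspace (subtopology Orb (sheet i)). sect i w \<in> W}"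
    by (simp add: openin_subtopology_Int2 openin_sheet openin_open_subtopology)
qed

text \<open>Over a sheet the quotient map has a section, so small simplices lift.\<close>

lemma subdivision_lifts:
  assumes z: "singular_chain p Orb z"
  obtains n c where "singular_chain p X c" "chain_map p orb c = sd p n z"
proof -
  obtain n where n: "\<And>m s. \<lbrakk>n \<le> m; s \<in> Poly_Mapping.keys (sd p m z)\<rbrakk>
                      \<Longrightarrow> \<exists>W \<in> range sheet. s \<in> standard_simplex p \<rightarrow> W"
    by (rule sufficient_iterated_singular_subdivision_exists [of "range sheet" Orb p z])
      (use openin_sheet sheets_cover z in auto)
  let ?z = "sd p n z"
  have "\<exists>t. singular_simplex p X t \<and> simplex_map p orb t = s" if s: "s \<in> Poly_Mapping.keys ?z" for s
  proof -
    obtain i where i: "s \<in> standard_simplex p \<rightarrow> sheet i"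
      using n [OF _ s] by auto
    have "singular_simplex p Orb s"
      using singular_chain_subdivision_power [OF z, of n] s by (auto simp: singular_chain_def)
    then have s': "singular_simplex p (subtopology Orb (sheet i)) s"
      using i by (auto simp: singular_simplex_subtopology)
    have "orb (sect i (s x)) = s x" if "x \<in> standard_simplex p" for x
    proof -
      have "s x \<in> sheet i" using i that by auto
      then obtain y where "y \<in> topspace X" "F y i > 0" "s x = orb y"
        by (auto simp: sheet_def)
      then show ?thesis by (simp only: sect_orb)
    qed
    then have "simplex_map p orb (simplex_map p (sect i) s) = s"
      by (intro extensionalityI [of _ "standard_simplex p"])
        (use s' in \<open>auto simp: simplex_map_def singular_simplex_def\<close>)
    then show ?thesis
      using singular_simplex_simplex_map [OF s' continuous_map_sect] by blast
  qed
  then obtain l where l: "\<And>s. s \<in> Poly_Mapping.keys ?z \<Longrightarrow> singular_simplex p X (l s) \<and> simplex_map p orb (l s) = s"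
    by metis
  have "singular_chain p X (frag_extend (frag_of \<circ> l) ?z)"
    using l by (intro singular_chain_extend) (auto simp: singular_chain_of)
  moreover have "chain_map p orb (frag_extend (frag_of \<circ> l) ?z) = ?z"
  proof -
    have "chain_map p orb (frag_extend (frag_of \<circ> l) ?z) = frag_extend (frag_of \<circ> simplex_map p orb \<circ> l) ?z"
      unfolding chain_map_def by (rule frag_extend_compose)
    also have "\<dots> = frag_extend frag_of ?z"
      using l by (intro frag_extend_eq) auto
    also have "\<dots> = ?z" using frag_expansion by metis
    finally show ?thesis .
  qed
  ultimately show thesis using that by blast
qed

text \<open>A filling in the orbit space lifts after subdivision, so that the top of the sequence
  becomes a boundary plus a transfer. This form is inherited by all lower members, but in degree 0
  boundaries and transfers both have even augmentation.\<close>

lemma smith_top_not_boundary: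
  assumes c: "smith_seq k X T c" "augm (c 0) = 1" and g: "singular_chain (Suc k) Orb g"
  shows "\<not> chain_map k orb (c k) \<approx>\<^sub>2 chain_boundary (Suc k) g"
proof
  assume eq: "chain_map k orb (c k) \<approx>\<^sub>2 chain_boundary (Suc k) g"
  obtain n h where h: "singular_chain (Suc k) X h" "chain_map (Suc k) orb h = sd (Suc k) n g"
    using subdivision_lifts [OF g] by blast
  define e where "e i = sd i n (c i)" for i
  have e: "smith_seq k X T e"
    unfolding e_def using c(1) by (rule smith_seq_subdivision)
  have ck: "singular_chain k X (c k)" using c(1) by (simp add: smith_seq_def)
  have "chain_map k orb (e k) = sd k n (chain_map k orb (c k))"
    unfolding e_def by (rule chain_map_subdivision_power [OF ck])
  also have "\<dots> \<approx>\<^sub>2 sd k n (chain_boundary (Suc k) g)"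
    using eq by (rule cong2_subdivision_power)
  also have "\<dots> = chain_boundary (Suc k) (chain_map (Suc k) orb h)"
    using boundary_subdivision_power [OF g, of n] h(2) by simp
  also have "\<dots> = chain_map k orb (chain_boundary (Suc k) h)"
    using chain_boundary_chain_map [OF h(1), of orb] by simp
  finally have "even_chain (chain_map k orb (e k - chain_boundary (Suc k) h))"
    by (simp add: cong2_def chain_map_diff)
  moreover have "singular_chain k X (e k - chain_boundary (Suc k) h)"
    using e h(1) by (intro singular_chain_diff singular_chain_boundary_alt) (simp_all add: smith_seq_def)
  ultimately obtain r where r: "singular_chain k X r" "e k - chain_boundary (Suc k) h \<approx>\<^sub>2 r + chain_map k T r"
    using ker_orb by blast
  \<comment> \<open>Downward induction: the \<open>r\<close> of one level is the \<open>h\<close> of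
    the level below. Taking boundaries shows that \<open>1 + T\<close> kills what remains there, so
    it is again a transfer.\<close>
  have "\<exists>h r. singular_chain (Suc j) X h \<and> singular_chain j X r \<and>
      e j - chain_boundary (Suc j) h \<approx>\<^sub>2 r + chain_map j T r" if "j \<le> k" for j
    using that
  proof (induction j rule: inc_induct)
    case base
    show ?case using h(1) r by blast
  next
    case (step j)
    then obtain h r where h: "singular_chain (Suc (Suc j)) X h" and r: "singular_chain (Suc j) X r"
      and eq: "e (Suc j) - chain_boundary (Suc (Suc j)) h \<approx>\<^sub>2 r + chain_map (Suc j) T r"
      by blast
    let ?b = "chain_boundary (Suc j) r"
    have ej: "singular_chain j X (e j)" using e step.hyps by (simp add: smith_seq_def)
    have b: "singular_chain j X ?b" using r singular_chain_boundary_alt by blast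
    have "e j + chain_map j T (e j) \<approx>\<^sub>2 chain_boundary (Suc j) (e (Suc j))"
      by (rule cong2_sym) (use e step.hyps in \<open>simp add: smith_seq_def\<close>)
    also have "\<dots> = chain_boundary (Suc j) (e (Suc j) - chain_boundary (Suc (Suc j)) h)"
      by (simp add: chain_boundary_diff chain_boundary_boundary_alt [OF h])
    also have "\<dots> \<approx>\<^sub>2 chain_boundary (Suc j) (r + chain_map (Suc j) T r)"
      using eq by (rule cong2_chain_boundary)
    also have "\<dots> = ?b + chain_map j T ?b"
      by (rule boundary_transfer [OF r])
    finally have "even_chain ((e j + chain_map j T (e j)) - (?b + chain_map j T ?b))"
      by (simp only: cong2_def)
    also have "(e j + chain_map j T (e j)) - (?b + chain_map j T ?b) = (e j - ?b) + chain_map j T (e j - ?b)"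
      by (simp add: chain_map_diff)
    finally have "even_chain ((e j - ?b) + chain_map j T (e j - ?b))" .
    then obtain r' where "singular_chain j X r'" "e j - ?b \<approx>\<^sub>2 r' + chain_map j T r'"
      using ker_transfer singular_chain_diff [OF ej b] by blast
    then show ?case using r by blast
  qed
  then obtain h r where "e 0 - chain_boundary (Suc 0) h \<approx>\<^sub>2 r + chain_map 0 T r"
    by blast
  then have "augm (e 0 - chain_boundary (Suc 0) h) = augm (r + chain_map 0 T r)"
    by (rule augm_cong2)
  then have "augm (e 0) = 0"
    by (simp only: augm_diff augm_boundary augm_add augm_chain_map) simp
  moreover have "e 0 = c 0"
    unfolding e_def by (rule subdivision_power_zero [of X]) (use c(1) in \<open>simp add: smith_seq_def\<close>)
  ultimately show False using c(2) by simp
qed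

end

section \<open>Acyclicity of the universal space\<close>

text \<open>The contraction makes a cycle homologous to one supported at a point, which bounds in
  positive degree; in degree 0 its vanishing has to be assumed.\<close>

lemma contractible_cycle_boundary:
  assumes hom: "homotopic_with (\<lambda>x. True) X X id (\<lambda>x. a)" and c: "singular_relcycle p X {} c"
    and zero: "p = 0 \<Longrightarrow> chain_map 0 (\<lambda>x. a) c = 0"
  obtains g where "singular_chain (Suc p) X g" "chain_boundary (Suc p) g = c"
proof (cases "c = 0")
  case True
  then show ?thesis using that [of 0] by simp
next
  case False
  let ?k = "\<lambda>x::'a. a"
  have cX: "singular_chain p X c"
    using c singular_cycle by blast
  have "topspace X \<noteq> {}"
    using False cX singular_chain_empty by blast
  then have a: "a \<in> topspace X"
    using homotopic_with_imp_continuous_maps [OF hom] by (auto simp: continuous_map_def)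
  have "homologous_rel p X {} (chain_map p id c) (chain_map p ?k c)"
    using hom c by (intro homotopic_imp_homologous_rel_chain_maps) auto
  then have c_hom: "homologous_rel p X {} c (chain_map p ?k c)"
    by (simp add: chain_map_ident [OF cX])
  have "singular_relboundary p X {} (chain_map p ?k c)"
  proof (cases "p = 0")
    case True
    then show ?thesis using zero by simp
  next
    case False
    let ?A = "subtopology X {a}"
    have "continuous_map X ?A ?k"
      using a by (simp add: continuous_map_in_subtopology)
    then have "singular_relcycle p ?A {} (chain_map p ?k c)"
      using c by (auto intro: singular_relcycle_chain_map)
    moreover have "topspace ?A = {a}"
      using a by auto
    ultimately have "singular_relboundary p ?A {} (chain_map p ?k c)"
      using singular_boundary_eq_cycle_singleton [of ?A a p] False by (metis One_nat_def Suc_leI neq0_conv)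
    then have "singular_relboundary p X {} (chain_map p id (chain_map p ?k c))"
      by (rule singular_relboundary_chain_map) (auto simp: continuous_map_from_subtopology)
    moreover have "singular_chain p X (chain_map p ?k c)"
      using cX a by (intro singular_chain_chain_map [of p X]) auto
    ultimately show ?thesis
      by (simp add: chain_map_ident)
  qed
  then have "singular_relboundary p X {} c"
    using c_hom singular_relboundary_add [of p X "{}" "c - chain_map p ?k c" "chain_map p ?k c"]
    by (simp add: homologous_rel_def)
  then show ?thesis
    using that by (auto simp: singular_boundary)
qed

text \<open>A Bockstein argument. In positive degree the boundary of \<open>c\<close> is
  \<open>2 b\<close> with \<open>b\<close> an integral cycle; if \<open>b\<close> bounds
  \<open>g\<close>, then \<open>c - 2 g\<close> is an integral cycle and bounds as well. In degree 0
  a multiple of a point is subtracted, which is even because the augmentation is.\<close>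

lemma mod2_acyclic:
  assumes con: "contractible_space X" and c: "singular_chain p X c"
    and even: "even_chain (chain_boundary p c)" and zero: "p = 0 \<Longrightarrow> augm c = 0"
  obtains g where "singular_chain (Suc p) X g" "c \<approx>\<^sub>2 chain_boundary (Suc p) g"
proof -
  obtain a where hom: "homotopic_with (\<lambda>x. True) X X id (\<lambda>x. a)"
    using con by (auto simp: contractible_space_def)
  let ?k = "\<lambda>x::'a. a"
  show thesis
  proof (cases "c = 0")
    case True
    then show ?thesis using that [of 0] by simp
  next
    case False
    have "topspace X \<noteq> {}"
      using False c singular_chain_empty by blast
    then have a: "a \<in> topspace X"
      using homotopic_with_imp_continuous_maps [OF hom] by (auto simp: continuous_map_def)
    let ?A = "subtopology X {a}"
    have tA: "topspace ?A = {a}"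
      using a by auto
    have kA: "continuous_map X ?A ?k"
      using a by (simp add: continuous_map_in_subtopology)
    let ?pt = "\<lambda>q. frag_of (restrict (\<lambda>_. a) (standard_simplex q))"
    show ?thesis
    proof (cases p)
      case 0
      obtain m where m: "chain_map 0 ?k c = frag_cmul m (?pt 0)"
        using singular_chain_singleton [OF tA] singular_chain_chain_map [OF c kA] 0 by blast
      have "singular_relcycle 0 X {} (c - frag_cmul m (?pt 0))"
      proof -
        have "singular_simplex 0 ?A (restrict (\<lambda>_. a) (standard_simplex 0))"
          using singular_simplex_singleton [OF tA] by blast
        then have "singular_chain 0 X (?pt 0)"
          by (auto simp: singular_chain_of singular_simplex_subtopology)
        then show ?thesis
          using c 0 by (auto simp: singular_cycle chain_boundary_def intro!: singular_chain_diff singular_chain_cmul)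
      qed
      moreover have "chain_map 0 ?k (c - frag_cmul m (?pt 0)) = 0"
        by (simp add: chain_map_diff m) (simp add: simplex_map_def o_def cong: restrict_cong)
      ultimately obtain g where g: "singular_chain (Suc 0) X g" "chain_boundary (Suc 0) g = c - frag_cmul m (?pt 0)"
        using contractible_cycle_boundary [OF hom] by metis
      have "augm (frag_cmul m (?pt 0)) = 0"
        using zero 0 augm_chain_map [of 0 ?k c] m by simp
      then have "(of_int m :: bit) = 0"
        by (simp add: augm_def frag_extend_cmul)
      then have "even m"
        by (metis even_of_int_iff dvd_0_right)
      then have "even_chain (frag_cmul m (?pt 0))"
        unfolding even_chain_def by (metis dvdE frag_cmul_cmul)
      then show ?thesis
        using that [of g] g 0 by (simp add: cong2_def)
    next
      case (Suc q)
      have cq: "singular_chain (Suc q) X c" using c Suc by simp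
      have bX: "singular_chain q X (chain_boundary (Suc q) c)"
        using cq singular_chain_boundary_alt by blast
      then obtain b where b: "singular_chain q X b" "chain_boundary (Suc q) c = frag_cmul 2 b"
        using even even_chain_singular Suc by metis
      have "frag_cmul 2 (chain_boundary q b) = 0"
        using chain_boundary_boundary_alt [OF cq] b(2) by (simp add: chain_boundary_cmul)
      then have "singular_relcycle q X {} b"
        using b(1) by (simp add: singular_cycle)
      \<comment> \<open>In degree 0 the augmentation of \<open>b\<close> matters: twice its image at
        the point is the boundary of a 1-chain there, hence 0, and chains have no torsion.\<close>
      moreover have "chain_map 0 ?k b = 0" if "q = 0"
      proof -
        have "chain_boundary (Suc 0) (chain_map (Suc 0) ?k c) = 0"
          using chain_boundary_of_singleton [OF tA singular_chain_chain_map [OF cq kA]] that by simp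
        then have "frag_cmul 2 (chain_map 0 ?k b) = 0"
          using chain_boundary_chain_map [OF cq, of ?k] b(2) that by simp
        then show ?thesis by simp
      qed
      ultimately obtain g where g: "singular_chain (Suc q) X g" "chain_boundary (Suc q) g = b"
        using contractible_cycle_boundary [OF hom] by metis
      have "singular_relcycle (Suc q) X {} (c - frag_cmul 2 g)"
        using cq g b by (auto simp: singular_cycle chain_boundary_diff chain_boundary_cmul
            intro!: singular_chain_diff singular_chain_cmul)
      then obtain h where h: "singular_chain (Suc (Suc q)) X h" "chain_boundary (Suc (Suc q)) h = c - frag_cmul 2 g"
        using contractible_cycle_boundary [OF hom] by (metis nat.distinct(1))
      then show ?thesis
        using that [of h] Suc by (simp add: cong2_def)
    qed
  qed
qed

text \<open>An equivariant contraction built degree by degree. If \<open>g\<close> fills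
  \<open>e k\<close> up to a transfer, then \<open>e (Suc k) - (g + T g)\<close> is a cycle modulo 2
  and bounds, so the old \<open>g\<close> becomes the new \<open>r\<close>. The even augmentation is
  what starts the process.\<close>

lemma (in free_involution) contractible_fill:
  assumes con: "contractible_space X" and e: "smith_seq k X T e" "augm (e 0) = 0"
  obtains g r where "singular_chain (Suc k) X g" "singular_chain k X r"
    "e k \<approx>\<^sub>2 chain_boundary (Suc k) g + (r + chain_map k T r)"
proof -
  have "\<exists>g r. singular_chain (Suc k) X g \<and> singular_chain k X r \<and>
    e k \<approx>\<^sub>2 chain_boundary (Suc k) g + (r + chain_map k T r)"
    using e(1)
  proof (induction k)
    case 0
    then have "singular_chain 0 X (e 0)" by (simp add: smith_seq_def)
    then obtain g where "singular_chain (Suc 0) X g" "e 0 \<approx>\<^sub>2 chain_boundary (Suc 0) g"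
      using mod2_acyclic [OF con, of 0 "e 0"] e(2) by (auto simp: chain_boundary_def)
    then show ?case
      by (intro exI [of _ g] exI [of _ 0]) simp
  next
    case (Suc k)
    then obtain g r where g: "singular_chain (Suc k) X g" and r: "singular_chain k X r"
      and eq: "e k \<approx>\<^sub>2 chain_boundary (Suc k) g + (r + chain_map k T r)"
      using smith_seq_mono by (metis le_SucI order_refl)
    let ?d = "e (Suc k) - (g + chain_map (Suc k) T g)"
    let ?b = "chain_boundary (Suc k) g"
    have d: "singular_chain (Suc k) X ?d"
      using Suc.prems g chain_T(1) [OF g]
      by (intro singular_chain_diff singular_chain_add) (auto simp: smith_seq_def)
    have "chain_boundary (Suc k) ?d = chain_boundary (Suc k) (e (Suc k)) - (?b + chain_map k T ?b)"
      by (simp only: chain_boundary_diff boundary_transfer [OF g])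
    also have "\<dots> \<approx>\<^sub>2 (e k + chain_map k T (e k)) - (?b + chain_map k T ?b)"
      using Suc.prems by (intro cong2_diff) (auto simp: smith_seq_def)
    also have "\<dots> = (e k - ?b) + chain_map k T (e k - ?b)"
      by (simp add: chain_map_diff)
    also have "\<dots> \<approx>\<^sub>2 (r + chain_map k T r) + chain_map k T (r + chain_map k T r)"
    proof -
      have "e k - ?b \<approx>\<^sub>2 r + chain_map k T r"
        using cong2_diff [OF eq cong2_refl, of ?b] by simp
      then show ?thesis by (intro cong2_add cong2_chain_map)
    qed
    finally have "even_chain (chain_boundary (Suc k) ?d)"
      using transfer_transfer [OF r] even_chain_cong2 by blast
    then obtain h where h: "singular_chain (Suc (Suc k)) X h" "?d \<approx>\<^sub>2 chain_boundary (Suc (Suc k)) h"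
      using mod2_acyclic [OF con d] by blast
    have "e (Suc k) \<approx>\<^sub>2 chain_boundary (Suc (Suc k)) h + (g + chain_map (Suc k) T g)"
      using cong2_add [OF h(2) cong2_refl, of "g + chain_map (Suc k) T g"] by simp
    then show ?case using h(1) g by blast
  qed
  then show thesis using that by blast
qed

subsection \<open>The infinite sphere\<close>

lemma topspace_EZ2: "topspace EZ2 = {x. \<exists>n. (\<Sum>i\<le>n. (x i)\<^sup>2) = 1 \<and> (\<forall>i>n. x i = 0)}"
  by (auto simp: EZ2_def nsphere)

lemma continuous_map_into_EZ2:
  "continuous_map X EZ2 f \<longleftrightarrow>
     (\<forall>i. continuous_map X euclideanreal (\<lambda>x. f x i)) \<and> f ` topspace X \<subseteq> topspace EZ2"
  unfolding EZ2_def continuous_map_in_subtopology continuous_map_componentwise_UNIV by auto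

lemma continuous_map_EZ2_coord: "continuous_map EZ2 euclideanreal (\<lambda>x. x i)"
  unfolding EZ2_def by (rule continuous_map_coordinate)

abbreviation antipode :: "(nat \<Rightarrow> real) \<Rightarrow> nat \<Rightarrow> real" where
  "antipode \<equiv> EZ2_action 1"

lemma antipode: "x \<in> topspace EZ2 \<Longrightarrow> antipode x = (\<lambda>i. - x i)"
  by (simp add: EZ2_action_def)

lemma minus_in_EZ2: "x \<in> topspace EZ2 \<Longrightarrow> (\<lambda>i. - x i) \<in> topspace EZ2"
  by (auto simp: topspace_EZ2)

lemma free_involution_EZ2: "free_involution EZ2 antipode (\<lambda>x. x)"
proof
  show "continuous_map EZ2 EZ2 antipode"
    unfolding continuous_map_into_EZ2
  proof (intro conjI allI)
    fix i
    have "continuous_map EZ2 euclideanreal (\<lambda>x. - x i)"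
      by (intro continuous_map_minus continuous_map_EZ2_coord)
    then show "continuous_map EZ2 euclideanreal (\<lambda>x. antipode x i)"
      by (rule continuous_map_eq) (simp add: antipode)
  qed (auto simp: antipode minus_in_EZ2)
  show "antipode (antipode x) = x" if "x \<in> topspace EZ2" for x
    using that by (simp add: antipode minus_in_EZ2)
  show "\<exists>i. x i \<noteq> 0" if "x \<in> topspace EZ2" for x
    using that by (auto simp: topspace_EZ2) (metis (no_types, lifting) power_zero_numeral sum.neutral zero_neq_one)
qed (auto simp: antipode continuous_map_EZ2_coord)

text \<open>The clamped expression is affine in \<open>t\<close>, equal to 0 at
  \<open>1/(j+2)\<close> and to 1 at \<open>1/(j+1)\<close>; the factor turns it into an angle up to
  a quarter turn.\<close>

definition ramp :: "nat \<Rightarrow> real \<Rightarrow> real" where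
  "ramp j t = pi / 2 * max 0 (min 1 ((real j + 1) * (real j + 2) * t - (real j + 1)))"

text \<open>
  \<open>rotate_shift t\<close> is an isometry for every \<open>t\<close>: it rotates the basis vector \<open>e\<^sub>j\<close> to
  \<open>e\<^sub>j\<^sub>+\<^sub>1\<close> during the time interval from \<open>1/(j+2)\<close> to \<open>1/(j+1)\<close>, after all later
  basis vectors have been shifted. This moves the identity to the shift without dividing by
  norms, whose continuity is not visible coordinatewise.
\<close>

definition rotate_shift :: "real \<Rightarrow> (nat \<Rightarrow> real) \<Rightarrow> nat \<Rightarrow> real" where
  "rotate_shift t x j = cos (ramp j t) * x j + (if j = 0 then 0 else sin (ramp (j - 1) t) * x (j - 1))"

text \<open>The time intervals of neighbouring ramps meet only at \<open>1/(j+2)\<close>: until then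
  ramp \<open>j\<close> is still 0, and from then on ramp \<open>Suc j\<close> is a right angle.
  This removes the mixed terms from the norm.\<close>

lemma ramp_orthogonal: "cos (ramp (Suc j) t) * sin (ramp j t) = 0"
proof (cases "t \<le> 1 / (real j + 2)")
  case True
  then have "(real j + 2) * t \<le> 1"
    by (simp add: field_simps)
  then have "(real j + 1) * ((real j + 2) * t) \<le> (real j + 1) * 1"
    by (intro mult_left_mono) auto
  then have "ramp j t = 0"
    by (simp add: ramp_def algebra_simps)
  then show ?thesis by simp
next
  case False
  then have "(real j + 2) * t \<ge> 1"
    by (simp add: field_simps)
  then have "(real j + 3) * ((real j + 2) * t) \<ge> (real j + 3) * 1"
    by (intro mult_left_mono) auto
  then have "min 1 ((real (Suc j) + 1) * (real (Suc j) + 2) * t - (real (Suc j) + 1)) = 1"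
    by (simp add: algebra_simps)
  then have "ramp (Suc j) t = pi / 2"
    by (simp only: ramp_def)
  then show ?thesis by (simp only: cos_pi_half mult_zero_left)
qed

lemma rotate_shift_in:
  assumes "x \<in> topspace EZ2"
  shows "rotate_shift t x \<in> topspace EZ2"
proof -
  obtain n where n: "(\<Sum>i\<le>n. (x i)\<^sup>2) = 1" "\<And>i. i > n \<Longrightarrow> x i = 0"
    using assms by (auto simp: topspace_EZ2)
  have 0: "(rotate_shift t x 0)\<^sup>2 = (cos (ramp 0 t) * x 0)\<^sup>2"
    by (simp add: rotate_shift_def)
  have S: "(rotate_shift t x (Suc j))\<^sup>2 = (cos (ramp (Suc j) t) * x (Suc j))\<^sup>2 + (sin (ramp j t) * x j)\<^sup>2" for j
  proof -
    have "(rotate_shift t x (Suc j))\<^sup>2 = (cos (ramp (Suc j) t) * x (Suc j))\<^sup>2 + (sin (ramp j t) * x j)\<^sup>2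
        + 2 * (cos (ramp (Suc j) t) * sin (ramp j t)) * (x (Suc j) * x j)"
      by (simp add: rotate_shift_def power2_eq_square algebra_simps)
    then show ?thesis by (simp add: ramp_orthogonal)
  qed
  \<comment> \<open>Reindexing brings the squared cosine and sine of the same coordinate together. A
    shift enlarges the support by at most one, hence the witness \<open>Suc n\<close>.\<close>
  have "(\<Sum>j\<le>Suc n. (rotate_shift t x j)\<^sup>2) =
    (cos (ramp 0 t) * x 0)\<^sup>2 + (\<Sum>j\<le>n. (cos (ramp (Suc j) t) * x (Suc j))\<^sup>2) + (\<Sum>j\<le>n. (sin (ramp j t) * x j)\<^sup>2)"
    unfolding sum.atMost_Suc_shift 0 S by (simp add: sum.distrib)
  also have "\<dots> = (\<Sum>j\<le>Suc n. (cos (ramp j t) * x j)\<^sup>2) + (\<Sum>j\<le>n. (sin (ramp j t) * x j)\<^sup>2)"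
    unfolding sum.atMost_Suc_shift by simp
  also have "\<dots> = (\<Sum>j\<le>n. ((cos (ramp j t))\<^sup>2 + (sin (ramp j t))\<^sup>2) * (x j)\<^sup>2)"
    using n(2) by (simp only: power_mult_distrib sum.distrib distrib_right sum.atMost_Suc) simp
  also have "\<dots> = 1"
    using n(1) by simp
  finally have "(\<Sum>j\<le>Suc n. (rotate_shift t x j)\<^sup>2) = 1" .
  moreover have "\<forall>j>Suc n. rotate_shift t x j = 0"
    using n(2) by (auto simp: rotate_shift_def)
  ultimately show ?thesis
    unfolding topspace_EZ2 by blast
qed

lemma continuous_map_of_time:
  fixes g :: "real \<Rightarrow> real"
  assumes "continuous_on UNIV g"
  shows "continuous_map (prod_topology (top_of_set S) X) euclideanreal (\<lambda>z. g (fst z))"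
proof -
  have "continuous_map (prod_topology (top_of_set S) X) euclideanreal fst"
    using continuous_map_fst [of "top_of_set S" X] by (auto simp: continuous_map_in_subtopology)
  moreover have "continuous_map euclideanreal euclideanreal g"
    using assms by simp
  ultimately have "continuous_map (prod_topology (top_of_set S) X) euclideanreal (g \<circ> fst)"
    by (rule continuous_map_compose)
  then show ?thesis by (simp add: o_def)
qed

text \<open>The identity is rotated into the shift. The image of the shift is orthogonal to the
  first basis vector, so it can be moved there along quarter circles. Each coordinate of either
  homotopy involves at most two coordinates of the point, which gives continuity.\<close>

lemma contractible_EZ2: "contractible_space EZ2"
proof -
  let ?P = "prod_topology (top_of_set {0..1::real}) EZ2"
  define sh :: "(nat \<Rightarrow> real) \<Rightarrow> nat \<Rightarrow> real" where "sh x = (\<lambda>j. if j = 0 then 0 else x (j - 1))" for x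
  define cone :: "real \<Rightarrow> (nat \<Rightarrow> real) \<Rightarrow> nat \<Rightarrow> real"
    where "cone t x = (\<lambda>j. if j = 0 then sin (pi / 2 * t) else cos (pi / 2 * t) * x (j - 1))" for t x
  have coord: "continuous_map ?P euclideanreal (\<lambda>z. snd z j)" for j
    using continuous_map_compose [OF continuous_map_snd continuous_map_EZ2_coord [of j]] by (simp add: o_def)
  have ramp_cont: "continuous_on UNIV (ramp j)" for j
    unfolding ramp_def by (intro continuous_intros)
  have "continuous_map ?P EZ2 (\<lambda>z. rotate_shift (fst z) (snd z))"
    unfolding continuous_map_into_EZ2
  proof (intro conjI allI)
    fix j
    have "continuous_map ?P euclideanreal (\<lambda>z. cos (ramp j (fst z)))" for j
      by (rule continuous_map_of_time) (intro continuous_intros ramp_cont)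
    moreover have "continuous_map ?P euclideanreal (\<lambda>z. sin (ramp j (fst z)))" for j
      by (rule continuous_map_of_time) (intro continuous_intros ramp_cont)
    ultimately show "continuous_map ?P euclideanreal (\<lambda>z. rotate_shift (fst z) (snd z) j)"
      unfolding rotate_shift_def
      by (cases "j = 0") (auto intro!: continuous_map_add continuous_map_real_mult coord)
  qed (auto simp: rotate_shift_in)
  moreover have "rotate_shift 0 x = x" for x
    by (auto simp: rotate_shift_def ramp_def fun_eq_iff)
  moreover have "rotate_shift 1 x = sh x" for x
  proof -
    have "ramp j 1 = pi / 2" for j
    proof -
      have "min 1 ((real j + 1) * (real j + 2) * 1 - (real j + 1)) = 1"
        by (simp add: algebra_simps)
      then show ?thesis by (simp only: ramp_def)
    qed
    then have "cos (ramp j 1) = 0" "sin (ramp j 1) = 1" for j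
      by (simp_all only: cos_pi_half sin_pi_half)
    then show ?thesis
      by (auto simp: rotate_shift_def sh_def fun_eq_iff)
  qed
  ultimately have 1: "homotopic_with (\<lambda>x. True) EZ2 EZ2 id sh"
    unfolding homotopic_with_def
    by (intro exI [of _ "\<lambda>z. rotate_shift (fst z) (snd z)"]) auto
  have cone_in: "cone t x \<in> topspace EZ2" if x: "x \<in> topspace EZ2" for t x
  proof -
    obtain n where n: "(\<Sum>i\<le>n. (x i)\<^sup>2) = 1" "\<And>i. i > n \<Longrightarrow> x i = 0"
      using x by (auto simp: topspace_EZ2)
    have "(\<Sum>j\<le>Suc n. (cone t x j)\<^sup>2) = (sin (pi / 2 * t))\<^sup>2 + (cos (pi / 2 * t))\<^sup>2 * (\<Sum>i\<le>n. (x i)\<^sup>2)"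
      unfolding sum.atMost_Suc_shift by (simp add: cone_def power_mult_distrib sum_distrib_left)
    then have "(\<Sum>j\<le>Suc n. (cone t x j)\<^sup>2) = 1"
      using n(1) by simp
    moreover have "\<forall>j>Suc n. cone t x j = 0"
      using n(2) by (auto simp: cone_def)
    ultimately show ?thesis
      unfolding topspace_EZ2 by blast
  qed
  have "continuous_map ?P EZ2 (\<lambda>z. cone (fst z) (snd z))"
    unfolding continuous_map_into_EZ2
  proof (intro conjI allI)
    fix j
    have "continuous_map ?P euclideanreal (\<lambda>z. cos (pi / 2 * fst z))"
      by (rule continuous_map_of_time) (intro continuous_intros)
    moreover have "continuous_map ?P euclideanreal (\<lambda>z. sin (pi / 2 * fst z))"
      by (rule continuous_map_of_time) (intro continuous_intros)
    ultimately show "continuous_map ?P euclideanreal (\<lambda>z. cone (fst z) (snd z) j)"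
      unfolding cone_def
      by (cases "j = 0") (auto intro!: continuous_map_real_mult coord)
  qed (auto simp: cone_in)
  moreover have "cone 0 x = sh x" "cone 1 x = (\<lambda>j. if j = 0 then 1 else 0)" for x
    by (auto simp: cone_def sh_def fun_eq_iff)
  ultimately have 2: "homotopic_with (\<lambda>x. True) EZ2 EZ2 sh (\<lambda>x. (\<lambda>j. if j = 0 then 1 else 0))"
    unfolding homotopic_with_def
    by (intro exI [of _ "\<lambda>z. cone (fst z) (snd z)"]) auto
  show ?thesis
    unfolding contractible_space_def using homotopic_with_trans [OF 1 2] by blast
qed

section \<open>Cohomology with coefficients in the field with two elements\<close>

lemma carrier_Z2: "carrier Z2 = {0, 1}"
  by (auto simp: carrier_integer_mod_group)

lemma carrier_chain_group [simp]: "carrier (chain_group p X) = singular_chain_set p X"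
  by (auto simp: chain_group_def singular_chain_def)

lemma cochain_iff:
  "u \<in> carrier (cochain_group k X Z2) \<longleftrightarrow>
     (\<forall>c. singular_chain k X c \<longrightarrow> u c \<in> {0, 1}) \<and>
     (\<forall>c d. singular_chain k X c \<longrightarrow> singular_chain k X d \<longrightarrow> u (c + d) = (u c + u d) mod 2) \<and>
     u \<in> extensional (singular_chain_set k X)"
  unfolding cochain_group_def hom_def by (auto simp: carrier_Z2 Pi_iff)

lemma one_cochain_group: "\<one>\<^bsub>cochain_group k X Z2\<^esub> = (\<lambda>c\<in>singular_chain_set k X. 0)"
  by (simp add: cochain_group_def)

lemma mult_cochain_group:
  "u \<otimes>\<^bsub>cochain_group k X Z2\<^esub> v = (\<lambda>c\<in>singular_chain_set k X. (u c + v c) mod 2)"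
  by (simp add: cochain_group_def)

lemma additive_cochain:
  fixes w :: "'a chain \<Rightarrow> bit"
  assumes "Modules.additive w"
  shows "(\<lambda>c\<in>singular_chain_set k X. if w c = 1 then 1 else 0) \<in> carrier (cochain_group k X Z2)"
  unfolding cochain_iff using Modules.additive.add [OF assms]
  by (auto simp: singular_chain_add)

lemma cochain_zero:
  assumes "u \<in> carrier (cochain_group k X Z2)"
  shows "u 0 = 0"
proof -
  have "u (0 + 0) = (u 0 + u 0) mod 2" "u 0 \<in> {0, 1}"
    using assms unfolding cochain_iff by (blast intro: singular_chain_0)+
  then show ?thesis by auto
qed

lemma cochain_even_chain:
  assumes u: "u \<in> carrier (cochain_group k X Z2)" and c: "singular_chain k X c" "even_chain c"
  shows "u c = 0"
proof -
  obtain d where d: "singular_chain k X d" "c = frag_cmul 2 d"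
    using even_chain_singular [OF c(2,1)] by blast
  then have "c = d + d"
    using frag_cmul_distrib [of 1 1 d] by simp
  then have "u c = (u d + u d) mod 2"
    using u d(1) unfolding cochain_iff by blast
  moreover have "u d \<in> {0, 1}" using u d(1) unfolding cochain_iff by blast
  ultimately show ?thesis by auto
qed

lemma cochain_cong2:
  assumes u: "u \<in> carrier (cochain_group k X Z2)"
    and c: "singular_chain k X c" and d: "singular_chain k X d" and cd: "c \<approx>\<^sub>2 d"
  shows "u c = u d"
proof -
  have "u (c - d) = 0"
    using cd singular_chain_diff [OF c d] by (intro cochain_even_chain [OF u]) (auto simp: cong2_def)
  moreover have "u ((c - d) + d) = (u (c - d) + u d) mod 2"
    using u singular_chain_diff [OF c d] d unfolding cochain_iff by blast
  moreover have "u d \<in> {0, 1}" using u d unfolding cochain_iff by blast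
  ultimately show ?thesis by auto
qed

lemma cochain_mult:
  assumes "u \<in> carrier (cochain_group k X Z2)" "v \<in> carrier (cochain_group k X Z2)"
  shows "u \<otimes>\<^bsub>cochain_group k X Z2\<^esub> v \<in> carrier (cochain_group k X Z2)"
  unfolding cochain_iff
proof (intro conjI allI impI)
  fix c d assume c: "singular_chain k X c" and d: "singular_chain k X d"
  have "u (c + d) = (u c + u d) mod 2" "v (c + d) = (v c + v d) mod 2"
    using assms c d unfolding cochain_iff by blast+
  then show "(u \<otimes>\<^bsub>cochain_group k X Z2\<^esub> v) (c + d) =
    ((u \<otimes>\<^bsub>cochain_group k X Z2\<^esub> v) c + (u \<otimes>\<^bsub>cochain_group k X Z2\<^esub> v) d) mod 2"
    using c d singular_chain_add [OF c d] by (simp add: mult_cochain_group) presburger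
next
  fix c assume "singular_chain k X c"
  then show "(u \<otimes>\<^bsub>cochain_group k X Z2\<^esub> v) c \<in> {0, 1}"
    by (simp add: mult_cochain_group) presburger
qed (simp add: mult_cochain_group)

lemma cochain_eqI:
  assumes "u \<in> carrier (cochain_group k X Z2)" "v \<in> carrier (cochain_group k X Z2)"
    and "\<And>c. singular_chain k X c \<Longrightarrow> u c = v c"
  shows "u = v"
  using assms unfolding cochain_iff by (metis extensionalityI mem_Collect_eq)

lemma one_cochain_closed: "\<one>\<^bsub>cochain_group k X Z2\<^esub> \<in> carrier (cochain_group k X Z2)"
  unfolding cochain_iff by (auto simp: one_cochain_group singular_chain_add)

lemma cochain_mult_self:
  assumes "u \<in> carrier (cochain_group k X Z2)"
  shows "u \<otimes>\<^bsub>cochain_group k X Z2\<^esub> u = \<one>\<^bsub>cochain_group k X Z2\<^esub>"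
  by (rule ext) (simp add: mult_cochain_group one_cochain_group)

lemma group_cochain_group: "group (cochain_group k X Z2)"
proof (rule groupI)
  fix u v w
  assume uvw: "u \<in> carrier (cochain_group k X Z2)" "v \<in> carrier (cochain_group k X Z2)"
    "w \<in> carrier (cochain_group k X Z2)"
  show "u \<otimes>\<^bsub>cochain_group k X Z2\<^esub> v \<otimes>\<^bsub>cochain_group k X Z2\<^esub> w =
    u \<otimes>\<^bsub>cochain_group k X Z2\<^esub> (v \<otimes>\<^bsub>cochain_group k X Z2\<^esub> w)"
    by (rule ext) (simp add: mult_cochain_group mod_simps algebra_simps)
next
  fix u assume u: "u \<in> carrier (cochain_group k X Z2)"
  have "u c mod 2 = u c" if "singular_chain k X c" for c
    using u that unfolding cochain_iff by fastforce
  then show "\<one>\<^bsub>cochain_group k X Z2\<^esub> \<otimes>\<^bsub>cochain_group k X Z2\<^esub> u = u"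
    by (intro cochain_eqI [OF cochain_mult [OF one_cochain_closed u] u])
      (simp add: mult_cochain_group one_cochain_group)
  show "\<exists>v\<in>carrier (cochain_group k X Z2). v \<otimes>\<^bsub>cochain_group k X Z2\<^esub> u = \<one>\<^bsub>cochain_group k X Z2\<^esub>"
    using u cochain_mult_self by blast
qed (auto simp: cochain_mult one_cochain_closed)

lemma inv_cochain_group:
  assumes "u \<in> carrier (cochain_group k X Z2)"
  shows "inv\<^bsub>cochain_group k X Z2\<^esub> u = u"
  using group.inv_equality [OF group_cochain_group cochain_mult_self [OF assms] assms assms] .

lemma coboundary_closed:
  assumes "u \<in> carrier (cochain_group k X Z2)"
  shows "coboundary k X u \<in> carrier (cochain_group (Suc k) X Z2)"
  using assms unfolding cochain_iff
  by (auto simp: coboundary_def chain_boundary_add singular_chain_add dest: singular_chain_boundary_alt)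

lemma coboundary_mult:
  assumes "u \<in> carrier (cochain_group k X Z2)" "v \<in> carrier (cochain_group k X Z2)"
  shows "coboundary k X (u \<otimes>\<^bsub>cochain_group k X Z2\<^esub> v) =
    coboundary k X u \<otimes>\<^bsub>cochain_group (Suc k) X Z2\<^esub> coboundary k X v"
  by (rule ext) (auto simp: coboundary_def mult_cochain_group dest: singular_chain_boundary_alt)

lemma coboundary_one: "coboundary k X \<one>\<^bsub>cochain_group k X Z2\<^esub> = \<one>\<^bsub>cochain_group (Suc k) X Z2\<^esub>"
  by (rule ext) (auto simp: coboundary_def one_cochain_group dest: singular_chain_boundary_alt)

lemma cocycle_iff:
  "u \<in> cocycle_set k X Z2 \<longleftrightarrow> u \<in> carrier (cochain_group k X Z2) \<and>
     (\<forall>c. singular_chain (Suc k) X c \<longrightarrow> u (chain_boundary (Suc k) c) = 0)"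
  unfolding cocycle_set_def
  by (auto simp: coboundary_def one_cochain_group fun_eq_iff)

lemma subgroupI_cochain:
  assumes "S \<subseteq> carrier (cochain_group k X Z2)" "\<one>\<^bsub>cochain_group k X Z2\<^esub> \<in> S"
    and "\<And>u v. u \<in> S \<Longrightarrow> v \<in> S \<Longrightarrow> u \<otimes>\<^bsub>cochain_group k X Z2\<^esub> v \<in> S"
  shows "subgroup S (cochain_group k X Z2)"
proof (rule group.subgroupI [OF group_cochain_group])
  show "inv\<^bsub>cochain_group k X Z2\<^esub> u \<in> S" if "u \<in> S" for u
    using assms(1) that inv_cochain_group by (metis subsetD)
qed (use assms in auto)

lemma subgroup_cocycle_set: "subgroup (cocycle_set k X Z2) (cochain_group k X Z2)"
proof (rule subgroupI_cochain)
  show "\<one>\<^bsub>cochain_group k X Z2\<^esub> \<in> cocycle_set k X Z2"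
    by (auto simp: cocycle_iff one_cochain_closed) (auto simp: one_cochain_group dest: singular_chain_boundary_alt)
  show "u \<otimes>\<^bsub>cochain_group k X Z2\<^esub> v \<in> cocycle_set k X Z2"
    if "u \<in> cocycle_set k X Z2" "v \<in> cocycle_set k X Z2" for u v
    using that by (auto simp: cocycle_iff cochain_mult)
      (auto simp: mult_cochain_group dest: singular_chain_boundary_alt)
qed (auto simp: cocycle_iff)

lemma subgroup_coboundary_set: "subgroup (coboundary_set k X Z2) (cochain_group k X Z2)"
proof (cases k)
  case 0
  then show ?thesis
    unfolding coboundary_set_def
    by (simp add: group.triv_subgroup group_cochain_group)
next
  case (Suc q)
  have "subgroup (coboundary q X ` carrier (cochain_group q X Z2)) (cochain_group (Suc q) X Z2)"
  proof (rule subgroupI_cochain)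
    show "\<one>\<^bsub>cochain_group (Suc q) X Z2\<^esub> \<in> coboundary q X ` carrier (cochain_group q X Z2)"
      using coboundary_one one_cochain_closed by (metis image_eqI)
    show "u \<otimes>\<^bsub>cochain_group (Suc q) X Z2\<^esub> v \<in> coboundary q X ` carrier (cochain_group q X Z2)"
      if uv: "u \<in> coboundary q X ` carrier (cochain_group q X Z2)" "v \<in> coboundary q X ` carrier (cochain_group q X Z2)" for u v
    proof -
      obtain u' v' where "u = coboundary q X u'" "v = coboundary q X v'"
        and uv': "u' \<in> carrier (cochain_group q X Z2)" "v' \<in> carrier (cochain_group q X Z2)"
        using uv by blast
      then have "u \<otimes>\<^bsub>cochain_group (Suc q) X Z2\<^esub> v = coboundary q X (u' \<otimes>\<^bsub>cochain_group q X Z2\<^esub> v')"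
        by (simp add: coboundary_mult)
      then show ?thesis using cochain_mult [OF uv'] by blast
    qed
  qed (auto simp: coboundary_closed)
  then show ?thesis by (simp add: coboundary_set_def Suc)
qed

lemma coboundary_subset_cocycle: "coboundary_set k X Z2 \<subseteq> cocycle_set k X Z2"
proof (cases k)
  case 0
  then show ?thesis
    using subgroup.one_closed [OF subgroup_cocycle_set, of 0 X] by (simp add: coboundary_set_def)
next
  case (Suc q)
  have "coboundary q X u \<in> cocycle_set (Suc q) X Z2" if u: "u \<in> carrier (cochain_group q X Z2)" for u
    unfolding cocycle_iff
  proof (intro conjI allI impI)
    show "coboundary q X u \<in> carrier (cochain_group (Suc q) X Z2)"
      using u by (rule coboundary_closed)
    fix c assume c: "singular_chain (Suc (Suc q)) X c"
    show "coboundary q X u (chain_boundary (Suc (Suc q)) c) = 0"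
      using chain_boundary_boundary_alt [OF c] singular_chain_boundary_alt [OF c] cochain_zero [OF u]
      by (simp add: coboundary_def)
  qed
  then show ?thesis by (auto simp: coboundary_set_def Suc)
qed

lemma cohomology_class_iff:
  "\<xi> \<in> carrier (cohomology_group k X Z2) \<longleftrightarrow>
     (\<exists>u\<in>cocycle_set k X Z2. \<xi> = coboundary_set k X Z2 #>\<^bsub>cochain_group k X Z2\<^esub> u)"
proof -
  have "carrier (subgroup_generated (cochain_group k X Z2) (cocycle_set k X Z2)) = cocycle_set k X Z2"
    by (rule subgroup.carrier_subgroup_generated_subgroup [OF subgroup_cocycle_set])
  then show ?thesis
    unfolding cohomology_group_def FactGroup_def RCOSETS_def by (auto simp: r_coset_def)
qed

lemma one_cohomology_group: "\<one>\<^bsub>cohomology_group k X Z2\<^esub> = coboundary_set k X Z2"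
  by (simp add: cohomology_group_def FactGroup_def)

section \<open>Detection of cohomology classes by cycles modulo 2\<close>

lemma cochain_map_closed:
  assumes "continuous_map X Y f" "u \<in> carrier (cochain_group k Y Z2)"
  shows "cochain_map k X f u \<in> carrier (cochain_group k X Z2)"
  using assms(2) singular_chain_chain_map [OF _ assms(1)] unfolding cochain_iff
  by (auto simp: cochain_map_def chain_map_add singular_chain_add)

text \<open>If all members of a coset pull back to coboundaries, every coset in the union defining
  \<open>cohom_induced\<close> is the trivial one. Conversely, the pullback of a single cocycle lies
  in that union, which is nontrivial once this pullback is not a coboundary.\<close>

lemma cohom_induced_nontrivial_iff:
  assumes f: "continuous_map X Y f"
  shows "(\<exists>\<xi>\<in>carrier (cohomology_group k Y Z2). cohom_induced k X Z2 f \<xi> \<noteq> \<one>\<^bsub>cohomology_group k X Z2\<^esub>)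
   \<longleftrightarrow> (\<exists>u\<in>cocycle_set k Y Z2. cochain_map k X f u \<notin> coboundary_set k X Z2)"
  (is "?lhs \<longleftrightarrow> ?rhs")
proof
  let ?GX = "cochain_group k X Z2" and ?HX = "coboundary_set k X Z2"
  let ?GY = "cochain_group k Y Z2" and ?HY = "coboundary_set k Y Z2"
  interpret GX: group ?GX by (rule group_cochain_group)
  interpret GY: group ?GY by (rule group_cochain_group)
  {
    assume ?lhs
    then obtain u where u: "u \<in> cocycle_set k Y Z2"
      and nontriv: "cohom_induced k X Z2 f (?HY #>\<^bsub>?GY\<^esub> u) \<noteq> ?HX"
      unfolding Bex_def cohomology_class_iff one_cohomology_group by blast
    have sub: "?HY #>\<^bsub>?GY\<^esub> u \<subseteq> cocycle_set k Y Z2"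
      using coboundary_subset_cocycle u subgroup.m_closed [OF subgroup_cocycle_set]
      by (fastforce simp: r_coset_def)
    have ne: "?HY #>\<^bsub>?GY\<^esub> u \<noteq> {}"
      using subgroup.one_closed [OF subgroup_coboundary_set, of k Y] by (auto simp: r_coset_def)
    show ?rhs
    proof (rule ccontr)
      assume "\<not> ?rhs"
      then have "?HX #>\<^bsub>?GX\<^esub> cochain_map k X f v = ?HX" if "v \<in> ?HY #>\<^bsub>?GY\<^esub> u" for v
        using that sub GX.coset_join2 subgroup_coboundary_set subgroup.mem_carrier [OF subgroup_coboundary_set]
        by blast
      then have "cohom_induced k X Z2 f (?HY #>\<^bsub>?GY\<^esub> u) = ?HX"
        unfolding cohom_induced_def using ne by auto
      then show False using nontriv by blast
    qed
  }
  {
    assume ?rhs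
    then obtain u where u: "u \<in> cocycle_set k Y Z2" "cochain_map k X f u \<notin> ?HX"
      by blast
    have uY: "u \<in> carrier ?GY" using u(1) cocycle_iff by blast
    have "u \<in> ?HY #>\<^bsub>?GY\<^esub> u"
      using GY.rcos_self [OF uY subgroup_coboundary_set] .
    moreover have "cochain_map k X f u \<in> ?HX #>\<^bsub>?GX\<^esub> cochain_map k X f u"
      using GX.rcos_self [OF cochain_map_closed [OF f uY] subgroup_coboundary_set] .
    ultimately have "cochain_map k X f u \<in> cohom_induced k X Z2 f (?HY #>\<^bsub>?GY\<^esub> u)"
      unfolding cohom_induced_def by blast
    then show ?lhs
      using u unfolding Bex_def cohomology_class_iff one_cohomology_group by blast
  }
qed

text \<open>A cochain of positive degree that vanishes on all cycles modulo 2 factors through the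
  boundary, and a separating functional extends the factor to all chains; in degree 0 every chain is
  a cycle.\<close>

lemma cochain_detected_by_cycle:
  assumes v: "v \<in> carrier (cochain_group k X Z2)" and nontriv: "v \<notin> coboundary_set k X Z2"
  obtains z where "singular_chain k X z" "even_chain (chain_boundary k z)" "v z = 1"
proof -
  have v01: "v c \<in> {0, 1}" if "singular_chain k X c" for c
    using v that unfolding cochain_iff by blast
  have v_diff: "v (c - d) = (v c + v d) mod 2" if c: "singular_chain k X c" and d: "singular_chain k X d" for c d
  proof -
    have "v (c - d) = v (c + d)"
      by (intro cochain_cong2 [OF v] singular_chain_diff singular_chain_add c d cong2_diff_add)
    then show ?thesis
      using v c d unfolding cochain_iff by simp
  qed
  have "v \<noteq> \<one>\<^bsub>cochain_group k X Z2\<^esub>"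
    using nontriv subgroup.one_closed [OF subgroup_coboundary_set] by metis
  then obtain c1 where c1: "singular_chain k X c1" "v c1 \<noteq> 0"
    using cochain_eqI [OF v one_cochain_closed] by (auto simp: one_cochain_group)
  then have vc1: "v c1 = 1" using v01 by blast
  have "\<exists>z. singular_chain k X z \<and> even_chain (chain_boundary k z) \<and> v z = 1"
  proof (cases k)
    case 0
    then show ?thesis
      using c1 vc1 by (auto simp: chain_boundary_def)
  next
    case (Suc q)
    show ?thesis
    proof (rule ccontr)
      assume neg: "\<not> ?thesis"
      \<comment> \<open>Every chain lies in the kernel of \<open>v\<close> or differs from
        \<open>c1\<close> by an element of it, so a functional that is 0 on the boundaries of the
        kernel and 1 on the boundary of \<open>c1\<close> has \<open>v\<close> as its
        coboundary.\<close>
      define A where "A = {c. singular_chain k X c \<and> v c = 0}"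
      have no_cycle: "\<not> chain_boundary k c1 \<approx>\<^sub>2 chain_boundary k c" if "c \<in> A" for c
      proof
        assume "chain_boundary k c1 \<approx>\<^sub>2 chain_boundary k c"
        then have "even_chain (chain_boundary k (c1 - c))"
          by (simp add: chain_boundary_diff cong2_def)
        moreover have "v (c1 - c) = 1" "singular_chain k X (c1 - c)"
          using that c1 vc1 singular_chain_diff by (auto simp: A_def v_diff)
        ultimately show False
          using neg by blast
      qed
      obtain w where w: "Modules.additive w" and wA: "\<And>c. c \<in> A \<Longrightarrow> w (chain_boundary k c) = 0"
        and wc1: "w (chain_boundary k c1) = (1::bit)"
      proof (rule exists_separating_additive_mod2 [of A "chain_boundary k" "chain_boundary k c1"])
        show "0 \<in> A"
          by (simp add: A_def cochain_zero [OF v])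
        show "x - y \<in> A" if "x \<in> A" "y \<in> A" for x y
          using that by (auto simp: A_def v_diff intro: singular_chain_diff)
      qed (use no_cycle in \<open>auto simp: chain_boundary_diff\<close>)
      define w' where "w' = (\<lambda>c\<in>singular_chain_set q X. if w c = 1 then 1 else (0::int))"
      have w': "w' \<in> carrier (cochain_group q X Z2)"
        unfolding w'_def using w by (rule additive_cochain)
      have "coboundary q X w' = v"
      proof (rule cochain_eqI)
        show "coboundary q X w' \<in> carrier (cochain_group k X Z2)"
          unfolding Suc using w' by (rule coboundary_closed)
        fix c assume c: "singular_chain k X c"
        have "w (chain_boundary k c) = 1 \<longleftrightarrow> v c = 1"
        proof (cases "v c = 0")
          case True
          then show ?thesis using wA [of c] c by (simp add: A_def)
        next
          case False
          then have "v c = 1" using v01 [OF c] by blast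
          then have "v (c1 - c) = 0" using c c1 vc1 by (simp add: v_diff)
          then have "w (chain_boundary k (c1 - c)) = 0"
            using wA [of "c1 - c"] singular_chain_diff [OF c1(1) c] by (simp add: A_def)
          then have "w (chain_boundary k c1) - w (chain_boundary k c) = 0"
            by (simp only: chain_boundary_diff Modules.additive.diff [OF w])
          then show ?thesis
            using wc1 \<open>v c = 1\<close> by (cases "w (chain_boundary k c)") auto
        qed
        then show "coboundary q X w' c = v c"
          using c singular_chain_boundary_alt [of q X c] v01 [OF c] Suc
          by (auto simp: coboundary_def w'_def)
      qed (rule v)
      then show False
        using nontriv w' by (auto simp: coboundary_set_def Suc)
    qed
  qed
  then show thesis using that by blast
qed

text \<open>The chain homotopy between subdivision and the identity changes a cycle modulo 2 by a
  boundary and an even chain, and cocycles vanish on both.\<close>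

lemma cocycle_subdivision:
  assumes u: "u \<in> cocycle_set k X Z2" and y: "singular_chain k X y" "even_chain (chain_boundary k y)"
  shows "u (sd k n y) = u y"
proof -
  have uc: "u \<in> carrier (cochain_group k X Z2)"
    using u cocycle_iff by blast
  obtain h where h: "\<And>p. h p 0 = (0 :: 'a chain)" "\<And>p c1 c2. h p (c1-c2) = h p c1 - h p c2"
    "\<And>p X c. singular_chain p X c \<Longrightarrow> singular_chain (Suc p) X (h p c)"
    "\<And>p X c. singular_chain p X c
       \<Longrightarrow> chain_boundary (Suc p) (h p c) + h (p - Suc 0) (chain_boundary p c) = sd p n c - c"
    by (rule chain_homotopic_iterated_singular_subdivision [of n]) blast
  have "even_chain (h (k - Suc 0) (chain_boundary k y))"
  proof -
    obtain b where "chain_boundary k y = frag_cmul 2 b"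
      using y(2) even_chain_def by blast
    \<comment> \<open>The homotopy is known to respect 0 and differences only, so the double is
      written with these.\<close>
    then have "chain_boundary k y = b - (0 - b)"
      using frag_cmul_distrib [of 1 1 b] by simp
    then have "h (k - Suc 0) (chain_boundary k y) = h (k - Suc 0) b - (0 - h (k - Suc 0) b)"
      by (simp only: h(1,2))
    then show ?thesis by simp
  qed
  then have "chain_boundary (Suc k) (h k y) + h (k - Suc 0) (chain_boundary k y) \<approx>\<^sub>2 chain_boundary (Suc k) (h k y)"
    by (simp add: cong2_def)
  then have "sd k n y - y \<approx>\<^sub>2 chain_boundary (Suc k) (h k y)"
    by (simp add: h(4) [OF y(1)])
  then have "sd k n y - y + y \<approx>\<^sub>2 chain_boundary (Suc k) (h k y) + y"
    by (rule cong2_add) simp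
  then have eq: "sd k n y \<approx>\<^sub>2 chain_boundary (Suc k) (h k y) + y"
    by simp
  have b: "singular_chain k X (chain_boundary (Suc k) (h k y))"
    using h(3) [OF y(1)] singular_chain_boundary_alt by blast
  have "u (sd k n y) = u (chain_boundary (Suc k) (h k y) + y)"
    using eq by (intro cochain_cong2 [OF uc] singular_chain_subdivision_power singular_chain_add y b)
  also have "\<dots> = (u (chain_boundary (Suc k) (h k y)) + u y) mod 2"
    using uc b y(1) unfolding cochain_iff by blast
  also have "\<dots> = u y"
  proof -
    have "u (chain_boundary (Suc k) (h k y)) = 0"
      using u h(3) [OF y(1)] unfolding cocycle_iff by blast
    moreover have "u y \<in> {0, 1}" using uc y(1) unfolding cochain_iff by blast
    ultimately show ?thesis by auto
  qed
  finally show ?thesis .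
qed

section \<open>The homological index and Smith sequences\<close>

lemma quotient_topology_cong:
  assumes "\<And>x. x \<in> topspace X \<Longrightarrow> q x = q' x"
  shows "quotient_topology X q = quotient_topology X q'"
proof -
  have "q ` topspace X = q' ` topspace X"
    using assms by (rule image_cong [OF refl])
  moreover have "{x \<in> topspace X. q x \<in> U} = {x \<in> topspace X. q' x \<in> U}" for U
    using assms by auto
  ultimately show ?thesis
    by (simp add: quotient_topology_def)
qed

interpretation EZ2: free_involution EZ2 antipode "\<lambda>x. x"
  by (rule free_involution_EZ2)

lemma orbit_space_eq:
  assumes "free_involution X (\<phi> 1) F" "\<And>x. x \<in> topspace X \<Longrightarrow> \<phi> 0 x = x"
  shows "orbit_space Z2 X \<phi> = quotient_topology X (free_involution.orb (\<phi> 1))"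
  unfolding orbit_space_def
proof (rule quotient_topology_cong)
  fix x assume "x \<in> topspace X"
  moreover have "orbit Z2 \<phi> x = {\<phi> 0 x, \<phi> 1 x}"
    unfolding orbit_def carrier_Z2 by auto
  ultimately show "orbit Z2 \<phi> x = free_involution.orb (\<phi> 1) x"
    unfolding free_involution.orb_def [OF assms(1)] using assms(2) by simp
qed

lemma BZ2_eq: "BZ2 = EZ2.Orb"
  unfolding BZ2_def by (rule orbit_space_eq [where \<phi> = EZ2_action, OF free_involution_EZ2]) (simp add: EZ2_action_def)

text \<open>The coordinates of an equivariant map to the sphere serve as the odd functions of the
  locale.\<close>

lemma equivariant_free_involution:
  assumes T: "continuous_map X X (\<phi> 1)" "\<And>x. x \<in> topspace X \<Longrightarrow> \<phi> 1 (\<phi> 1 x) = x"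
    and f: "equivariant_map Z2 X \<phi> EZ2 EZ2_action f"
  shows "free_involution X (\<phi> 1) f"
proof
  have fc: "continuous_map X EZ2 f" and equivariant_commute: "\<And>x. x \<in> topspace X \<Longrightarrow> f (\<phi> 1 x) = antipode (f x)"
    using f by (auto simp: equivariant_map_def carrier_Z2)
  have fE: "f x \<in> topspace EZ2" if "x \<in> topspace X" for x
    using fc that by (auto simp: continuous_map_def)
  show "continuous_map X euclideanreal (\<lambda>x. f x i)" for i
    using fc by (simp add: continuous_map_into_EZ2)
  show "f (\<phi> 1 x) i = - f x i" if "x \<in> topspace X" for x i
    using that equivariant_commute fE antipode by simp
  show "\<exists>i. f x i \<noteq> 0" if "x \<in> topspace X" for x
    using EZ2.F_nonzero fE that by blast
qed (use T in auto)

context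
  fixes X :: "'a topology" and \<phi> :: "int \<Rightarrow> 'a \<Rightarrow> 'a" and f :: "'a \<Rightarrow> nat \<Rightarrow> real"
  assumes id: "\<And>x. x \<in> topspace X \<Longrightarrow> \<phi> 0 x = x"
    and T: "continuous_map X X (\<phi> 1)" "\<And>x. x \<in> topspace X \<Longrightarrow> \<phi> 1 (\<phi> 1 x) = x"
    and f: "equivariant_map Z2 X \<phi> EZ2 EZ2_action f"
begin

interpretation X: free_involution X "\<phi> 1" f
  using T f by (rule equivariant_free_involution)

lemma equivariant_commute: "x \<in> topspace X \<Longrightarrow> f (\<phi> 1 x) = antipode (f x)"
  using f by (auto simp: equivariant_map_def carrier_Z2)

lemma equivariant_continuous: "continuous_map X EZ2 f"
  using f by (auto simp: equivariant_map_def)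

lemma image_orb: "x \<in> topspace X \<Longrightarrow> f ` X.orb x = EZ2.orb (f x)"
  by (simp add: X.orb_def EZ2.orb_def equivariant_commute)

lemma continuous_map_image: "continuous_map X.Orb EZ2.Orb (image f)"
proof (rule continuous_compose_quotient_map [OF quotient_map_quotient_topology])
  have "continuous_map X EZ2.Orb (EZ2.orb \<circ> f)"
    using equivariant_continuous EZ2.continuous_map_orb continuous_map_compose by blast
  then show "continuous_map X EZ2.Orb (image f \<circ> X.orb)"
    by (rule continuous_map_eq) (simp add: image_orb)
qed

lemma chain_map_image:
  assumes "singular_chain k X c"
  shows "chain_map k (image f) (chain_map k X.orb c) = chain_map k EZ2.orb (chain_map k f c)"
proof -
  have "chain_map k (image f \<circ> X.orb) c = chain_map k (EZ2.orb \<circ> f) c"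
    by (rule chain_map_eq [OF assms]) (simp add: image_orb)
  then show ?thesis by (simp add: chain_map_compose)
qed

lemma cocycle_nontrivial_imp_smith_index:
  assumes u: "u \<in> cocycle_set k EZ2.Orb Z2"
    and nontriv: "cochain_map k X.Orb (image f) u \<notin> coboundary_set k X.Orb Z2"
  shows "smith_index_ge X (\<phi> 1) k"
proof (rule ccontr)
  assume neg: "\<not> smith_index_ge X (\<phi> 1) k"
  let ?T = "\<phi> 1"
  have uc: "u \<in> carrier (cochain_group k EZ2.Orb Z2)"
    using u cocycle_iff by blast
  obtain z where z: "singular_chain k X.Orb z" "even_chain (chain_boundary k z)"
    and uz: "cochain_map k X.Orb (image f) u z = 1"
    using cochain_detected_by_cycle [OF cochain_map_closed [OF continuous_map_image uc] nontriv] .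
  let ?y = "chain_map k (image f) z"
  have y: "singular_chain k EZ2.Orb ?y"
    using singular_chain_chain_map [OF z(1) continuous_map_image] .
  have "chain_boundary k ?y = chain_map (k - Suc 0) (image f) (chain_boundary k z)"
    by (rule chain_boundary_chain_map [OF z(1)])
  then have "even_chain (chain_boundary k ?y)"
    using z(2) by (simp add: chain_map_def even_chain_extend)
  moreover have uy: "u ?y = 1"
    using uz z(1) by (simp add: cochain_map_def)
  ultimately have uSy: "u (sd k n ?y) = 1" for n
    using cocycle_subdivision [OF u y] by simp
  obtain n c where c: "singular_chain k X c" and cz: "chain_map k X.orb c = sd k n z"
    using X.subdivision_lifts [OF z(1)] .
  \<comment> \<open>The boundary of the lift projects to an even chain, so it is a transfer, and
    applying \<open>1 + T\<close> once more makes it even.\<close>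
  have "even_chain (chain_boundary k (c + chain_map k ?T c))"
  proof (cases k)
    case 0
    then show ?thesis by (simp add: chain_boundary_def)
  next
    case (Suc q)
    have cq: "singular_chain (Suc q) X c" using c Suc by simp
    let ?b = "chain_boundary (Suc q) c"
    have b: "singular_chain q X ?b" using cq singular_chain_boundary_alt by blast
    have "chain_map q X.orb ?b = chain_boundary (Suc q) (chain_map (Suc q) X.orb c)"
      using chain_boundary_chain_map [OF cq, of X.orb] by simp
    also have "\<dots> = sd q n (chain_boundary (Suc q) z)"
      using cz boundary_subdivision_power [OF z(1), of n] Suc by simp
    also have "\<dots> \<approx>\<^sub>2 sd q n 0"
      using z(2) Suc by (intro cong2_subdivision_power) (simp add: cong2_0_iff)
    finally have "even_chain (chain_map q X.orb ?b)"
      by (simp add: cong2_0_iff)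
    then obtain r where r: "singular_chain q X r" "?b \<approx>\<^sub>2 r + chain_map q ?T r"
      using X.ker_orb [OF b] by blast
    have "?b + chain_map q ?T ?b \<approx>\<^sub>2 (r + chain_map q ?T r) + chain_map q ?T (r + chain_map q ?T r)"
      using r(2) by (intro cong2_add cong2_chain_map)
    then show ?thesis
      using X.transfer_transfer [OF r(1)] even_chain_cong2 X.boundary_transfer [OF cq] Suc by metis
  qed
  then obtain d where d: "smith_seq k X ?T d" "d k = c"
    using X.smith_seq_descend [OF c] by blast
  then have "augm (d 0) = 0"
    using neg unfolding smith_index_ge_def by auto
  then obtain g r where g: "singular_chain (Suc k) EZ2 g" and r: "singular_chain k EZ2 r"
    and eq: "chain_map k f (d k) \<approx>\<^sub>2 chain_boundary (Suc k) g + (r + chain_map k antipode r)"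
    using EZ2.contractible_fill [OF contractible_EZ2 smith_seq_chain_map [OF d(1) equivariant_continuous equivariant_commute]]
    by auto
  \<comment> \<open>Projected to the orbit space, the transfer part of the filling is even and only
    a boundary remains, on which \<open>u\<close> vanishes.\<close>
  have "chain_map k EZ2.orb (chain_map k f c) \<approx>\<^sub>2
      chain_map k EZ2.orb (chain_boundary (Suc k) g + (r + chain_map k antipode r))"
    using eq d(2) cong2_chain_map by blast
  also have "\<dots> = chain_map k EZ2.orb (chain_boundary (Suc k) g) + chain_map k EZ2.orb (r + chain_map k antipode r)"
    by (rule chain_map_add)
  also have "\<dots> \<approx>\<^sub>2 chain_map k EZ2.orb (chain_boundary (Suc k) g) + 0"
    using EZ2.even_chain_orb_transfer [OF r] by (intro cong2_add) (simp_all add: cong2_0_iff)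
  also have "\<dots> = chain_boundary (Suc k) (chain_map (Suc k) EZ2.orb g)"
    using chain_boundary_chain_map [OF g, of EZ2.orb] by simp
  finally have eq': "chain_map k EZ2.orb (chain_map k f c) \<approx>\<^sub>2 chain_boundary (Suc k) (chain_map (Suc k) EZ2.orb g)" .
  have g': "singular_chain (Suc k) EZ2.Orb (chain_map (Suc k) EZ2.orb g)"
    using singular_chain_chain_map [OF g EZ2.continuous_map_orb] .
  have "u (chain_map k EZ2.orb (chain_map k f c)) = u (chain_boundary (Suc k) (chain_map (Suc k) EZ2.orb g))"
    using eq' by (intro cochain_cong2 [OF uc] singular_chain_boundary_alt g' singular_chain_chain_map
        [OF singular_chain_chain_map [OF c equivariant_continuous] EZ2.continuous_map_orb])
  also have "\<dots> = 0"
    using u g' unfolding cocycle_iff by blast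
  finally have "u (chain_map k (image f) (sd k n z)) = 0"
    using chain_map_image [OF c] cz by simp
  then show False
    using uSy [of n] chain_map_subdivision_power [OF z(1), of "image f" n] by simp
qed

text \<open>No generator of the cohomology of \<open>BZ2\<close> is constructed: the top of the
  sequence does not bound in \<open>BZ2\<close>, so some cocycle takes the value 1 on it. The
  pullback of this cocycle takes the value 1 on a cycle modulo 2 and cannot be a coboundary.\<close>

lemma smith_index_imp_cocycle_nontrivial:
  assumes "smith_index_ge X (\<phi> 1) k"
  obtains u where "u \<in> cocycle_set k EZ2.Orb Z2" "cochain_map k X.Orb (image f) u \<notin> coboundary_set k X.Orb Z2"
proof -
  let ?T = "\<phi> 1"
  obtain c where c: "smith_seq k X ?T c" "augm (c 0) = 1"
    using assms unfolding smith_index_ge_def by blast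
  have ck: "singular_chain k X (c k)" using c(1) by (simp add: smith_seq_def)
  define e where "e i = chain_map i f (c i)" for i
  have e: "smith_seq k EZ2 antipode e" "augm (e 0) = 1"
    unfolding e_def using smith_seq_chain_map [OF c(1) equivariant_continuous equivariant_commute] c(2) by auto
  define y where "y = chain_map k EZ2.orb (e k)"
  have y: "singular_chain k EZ2.Orb y"
    unfolding y_def e_def
    by (intro singular_chain_chain_map [OF singular_chain_chain_map [OF ck equivariant_continuous] EZ2.continuous_map_orb])
  obtain w where w: "Modules.additive w" and wy: "w y = (1::bit)"
    and w_boundary: "\<And>g. g \<in> singular_chain_set (Suc k) EZ2.Orb \<Longrightarrow> w (chain_boundary (Suc k) g) = 0"
  proof (rule exists_separating_additive_mod2 [of "singular_chain_set (Suc k) EZ2.Orb" "chain_boundary (Suc k)" y])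
    show "\<not> y \<approx>\<^sub>2 chain_boundary (Suc k) g" if "g \<in> singular_chain_set (Suc k) EZ2.Orb" for g
      using EZ2.smith_top_not_boundary [OF e] that by (simp add: y_def)
  qed (auto simp: chain_boundary_diff intro: singular_chain_diff)
  define u where "u = (\<lambda>c\<in>singular_chain_set k EZ2.Orb. if w c = 1 then 1 else (0::int))"
  have u: "u \<in> cocycle_set k EZ2.Orb Z2"
    unfolding cocycle_iff using additive_cochain [OF w, of k EZ2.Orb] singular_chain_boundary_alt w_boundary
    by (auto simp: u_def)
  let ?v = "cochain_map k X.Orb (image f) u"
  let ?z = "chain_map k X.orb (c k)"
  have z: "singular_chain k X.Orb ?z"
    using singular_chain_chain_map [OF ck X.continuous_map_orb] .
  have vz: "?v ?z = 1"
    using z y wy chain_map_image [OF ck] by (simp add: cochain_map_def u_def y_def e_def)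
  have "?v \<notin> coboundary_set k X.Orb Z2"
  proof
    assume v: "?v \<in> coboundary_set k X.Orb Z2"
    show False
    proof (cases k)
      case 0
      then show ?thesis
        using v vz z by (simp add: coboundary_set_def one_cochain_group)
    next
      case (Suc q)
      then obtain b where b: "b \<in> carrier (cochain_group q X.Orb Z2)" "?v = coboundary q X.Orb b"
        using v by (auto simp: coboundary_set_def)
      have cq: "singular_chain q X (c q)" "singular_chain (Suc q) X (c (Suc q))"
        using c(1) Suc by (auto simp: smith_seq_def)
      have zq: "singular_chain (Suc q) X.Orb ?z" using z Suc by simp
      have "chain_boundary (Suc q) ?z = chain_map q X.orb (chain_boundary (Suc q) (c (Suc q)))"
        using chain_boundary_chain_map [OF cq(2), of X.orb] Suc by simp
      also have "\<dots> \<approx>\<^sub>2 chain_map q X.orb (c q + chain_map q ?T (c q))"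
        using c(1) Suc by (intro cong2_chain_map) (auto simp: smith_seq_def)
      finally have "even_chain (chain_boundary (Suc q) ?z)"
        using X.even_chain_orb_transfer [OF cq(1)] even_chain_cong2 by blast
      then have "b (chain_boundary (Suc q) ?z) = 0"
        using cochain_even_chain [OF b(1)] singular_chain_boundary_alt [OF zq] by blast
      then show ?thesis
        using vz b(2) zq by (simp add: coboundary_def)
    qed
  qed
  then show thesis using that u by blast
qed

lemma image_nontrivial_iff:
  "(\<exists>\<xi>\<in>carrier (cohomology_group k BZ2 Z2).
      cohom_induced k (orbit_space Z2 X \<phi>) Z2 (image f) \<xi> \<noteq> \<one>\<^bsub>cohomology_group k (orbit_space Z2 X \<phi>) Z2\<^esub>)
   \<longleftrightarrow> smith_index_ge X (\<phi> 1) k"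
proof -
  have "orbit_space Z2 X \<phi> = X.Orb"
    by (rule orbit_space_eq [where F = f]) (use id X.free_involution_axioms in auto)
  then show ?thesis
    unfolding BZ2_eq
    using cohom_induced_nontrivial_iff [OF continuous_map_image, of k]
      cocycle_nontrivial_imp_smith_index smith_index_imp_cocycle_nontrivial by metis
qed

end

text \<open>The criterion by Smith sequences does not mention the classifying map, so the
  existential quantifier in \<open>hind\<close> disappears as soon as one such map exists.\<close>

theorem hind_eq_Max_smith_index:
  assumes id: "\<And>x. x \<in> topspace X \<Longrightarrow> \<phi> 0 x = x"
    and T: "continuous_map X X (\<phi> 1)" "\<And>x. x \<in> topspace X \<Longrightarrow> \<phi> 1 (\<phi> 1 x) = x"
    and f: "equivariant_map Z2 X \<phi> EZ2 EZ2_action f"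
  shows "hind X \<phi> = Max {k. smith_index_ge X (\<phi> 1) k}"
proof -
  have "(\<exists>f. equivariant_map Z2 X \<phi> EZ2 EZ2_action f \<and>
            (\<exists>\<xi>\<in>carrier (cohomology_group k BZ2 Z2).
               cohom_induced k (orbit_space Z2 X \<phi>) Z2 (image f) \<xi> \<noteq>
               \<one>\<^bsub>cohomology_group k (orbit_space Z2 X \<phi>) Z2\<^esub>)) \<longleftrightarrow> smith_index_ge X (\<phi> 1) k" for k
    using f image_nontrivial_iff [OF id T] by blast
  then show ?thesis
    by (simp add: hind_def)
qed

section \<open>Joins\<close>

definition join_class :: "'a topology \<Rightarrow> 'b topology \<Rightarrow> 'a \<Rightarrow> 'b \<Rightarrow> real \<Rightarrow> ('a \<times> 'b \<times> real) set" where
  "join_class X Y x y t = join_rel X Y `` {(x, y, t)}"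

lemma join_class_eq_iff:
  assumes "x \<in> topspace X" "x' \<in> topspace X" "y \<in> topspace Y" "y' \<in> topspace Y" "t \<in> {0..1}" "t' \<in> {0..1}"
  shows "join_class X Y x y t = join_class X Y x' y' t' \<longleftrightarrow>
    t = t' \<and> (t \<noteq> 1 \<longrightarrow> x = x') \<and> (t \<noteq> 0 \<longrightarrow> y = y')"
proof -
  have "join_class X Y x y t = join_class X Y x' y' t' \<longleftrightarrow> ((x, y, t), (x', y', t')) \<in> join_rel X Y"
    unfolding join_class_def
    by (rule eq_equiv_class_iff [OF equiv_join_rel]) (use assms in auto)
  also have "\<dots> \<longleftrightarrow> t = t' \<and> (t \<noteq> 1 \<longrightarrow> x = x') \<and> (t \<noteq> 0 \<longrightarrow> y = y')"
    using assms by (auto simp: join_rel_def)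
  finally show ?thesis .
qed

lemma in_join_class:
  assumes "x \<in> topspace X" "y \<in> topspace Y" "t \<in> {0..1}"
  shows "(x', y', t') \<in> join_class X Y x y t \<longleftrightarrow>
    x' \<in> topspace X \<and> y' \<in> topspace Y \<and> t' = t \<and> (t \<noteq> 1 \<longrightarrow> x' = x) \<and> (t \<noteq> 0 \<longrightarrow> y' = y)"
  unfolding join_class_def using assms by (auto simp: join_rel_def)

lemma topspace_join_space:
  "topspace (join_space X Y) = {join_class X Y x y t | x y t. x \<in> topspace X \<and> y \<in> topspace Y \<and> t \<in> {0..1}}"
  unfolding join_space_def join_class_def by force

lemma quotient_map_join:
  "quotient_map (prod_topology X (prod_topology Y (top_of_set {0..1}))) (join_space X Y)
     (\<lambda>(x, y, t). join_class X Y x y t)"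
  unfolding join_space_def join_class_def
  by (rule quotient_map_eq [OF quotient_map_quotient_topology]) auto

lemma image_join_class:
  assumes "\<And>x. x \<in> topspace X \<Longrightarrow> T x \<in> topspace X \<and> T (T x) = x"
    and "\<And>y. y \<in> topspace Y \<Longrightarrow> S y \<in> topspace Y \<and> S (S y) = y"
    and xyt: "x \<in> topspace X" "y \<in> topspace Y" "t \<in> {0..1}"
  shows "(\<lambda>(x, y, t). (T x, S y, t)) ` join_class X Y x y t = join_class X Y (T x) (S y) t"
proof -
  have Txy: "T x \<in> topspace X" "S y \<in> topspace Y"
    using assms by auto
  have "(a, b, s) \<in> (\<lambda>(x, y, t). (T x, S y, t)) ` join_class X Y x y t
    \<longleftrightarrow> (a, b, s) \<in> join_class X Y (T x) (S y) t" for a b s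
  proof
    assume "(a, b, s) \<in> (\<lambda>(x, y, t). (T x, S y, t)) ` join_class X Y x y t"
    then obtain x' y' where "(x', y', s) \<in> join_class X Y x y t" "a = T x'" "b = S y'"
      by auto
    then show "(a, b, s) \<in> join_class X Y (T x) (S y) t"
      using assms by (auto simp: in_join_class [OF xyt] in_join_class [OF Txy xyt(3)])
  next
    assume "(a, b, s) \<in> join_class X Y (T x) (S y) t"
    then have "(T a, S b, s) \<in> join_class X Y x y t" "a = T (T a)" "b = S (S b)"
      using assms by (auto simp: in_join_class [OF xyt] in_join_class [OF Txy xyt(3)])
    then show "(a, b, s) \<in> (\<lambda>(x, y, t). (T x, S y, t)) ` join_class X Y x y t"
      by force
  qed
  then show ?thesis
    by (simp only: set_eq_iff split_paired_All) blast
qed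

text \<open>The bound \<open>n\<close> leaves room to append the functions of \<open>Y\<close> to
  those of \<open>X\<close>.\<close>

locale join_involutions = X: free_involution X T F + Y: free_involution Y S G
  for X :: "'a topology" and T :: "'a \<Rightarrow> 'a" and F :: "'a \<Rightarrow> nat \<Rightarrow> real"
    and Y :: "'b topology" and S :: "'b \<Rightarrow> 'b" and G :: "'b \<Rightarrow> nat \<Rightarrow> real" +
  fixes n :: nat
  assumes F_finite: "\<And>x i. x \<in> topspace X \<Longrightarrow> F x i \<noteq> 0 \<Longrightarrow> i < n"
begin

abbreviation J :: "('a \<times> 'b \<times> real) set topology" where
  "J \<equiv> join_space X Y"

abbreviation P :: "('a \<times> 'b \<times> real) topology" where
  "P \<equiv> prod_topology X (prod_topology Y (top_of_set {0..1}))"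

abbreviation jc :: "'a \<Rightarrow> 'b \<Rightarrow> real \<Rightarrow> ('a \<times> 'b \<times> real) set" where
  "jc \<equiv> join_class X Y"

definition TJ :: "('a \<times> 'b \<times> real) set \<Rightarrow> ('a \<times> 'b \<times> real) set" where
  "TJ = (\<lambda>c\<in>topspace J. (\<lambda>(x, y, t). (T x, S y, t)) ` c)"

lemma jc_in: "x \<in> topspace X \<Longrightarrow> y \<in> topspace Y \<Longrightarrow> t \<in> {0..1} \<Longrightarrow> jc x y t \<in> topspace J"
  unfolding topspace_join_space by blast

lemma J_cases:
  assumes "c \<in> topspace J"
  obtains x y t where "x \<in> topspace X" "y \<in> topspace Y" "t \<in> {0..1}" "c = jc x y t"
  using assms unfolding topspace_join_space by blast

lemma TJ_jc: "x \<in> topspace X \<Longrightarrow> y \<in> topspace Y \<Longrightarrow> t \<in> {0..1} \<Longrightarrow> TJ (jc x y t) = jc (T x) (S y) t"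
  unfolding TJ_def using image_join_class [of X T Y S x y t] X.T_in X.T_T Y.T_in Y.T_T jc_in by simp

lemma continuous_map_jc: "continuous_map P J (\<lambda>(x, y, t). jc x y t)"
  by (rule quotient_imp_continuous_map [OF quotient_map_join])

lemma continuous_map_P_components:
  "continuous_map P X fst" "continuous_map P Y (\<lambda>z. fst (snd z))" "continuous_map P euclideanreal (\<lambda>z. snd (snd z))"
proof -
  show "continuous_map P X fst" by (rule continuous_map_fst)
  have "continuous_map P (prod_topology Y (top_of_set {0..1})) snd" by (rule continuous_map_snd)
  then have "continuous_map P Y (fst \<circ> snd)" "continuous_map P (top_of_set {0..1}) (snd \<circ> snd)"
    by (auto intro: continuous_map_fst_of continuous_map_snd_of)
  then show "continuous_map P Y (\<lambda>z. fst (snd z))" "continuous_map P euclideanreal (\<lambda>z. snd (snd z))"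
    by (auto simp: o_def continuous_map_in_subtopology)
qed

lemma continuous_map_from_J:
  assumes "continuous_map P Z (\<lambda>(x, y, t). g (jc x y t))"
  shows "continuous_map J Z g"
proof (rule continuous_compose_quotient_map [OF quotient_map_join])
  show "continuous_map P Z (g \<circ> (\<lambda>(x, y, t). jc x y t))"
    by (rule continuous_map_eq [OF assms]) auto
qed

text \<open>At each end of the join one component of the chosen triple is arbitrary;
  \<open>coords_jc\<close> records the components that the class determines.\<close>

definition coords :: "('a \<times> 'b \<times> real) set \<Rightarrow> 'a \<times> 'b \<times> real" where
  "coords c = (SOME z. z \<in> c)"

lemma coords_jc:
  assumes "x \<in> topspace X" "y \<in> topspace Y" "t \<in> {0..1}"
  shows "snd (snd (coords (jc x y t))) = t" "t \<noteq> 1 \<Longrightarrow> fst (coords (jc x y t)) = x"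
    "t \<noteq> 0 \<Longrightarrow> fst (snd (coords (jc x y t))) = y"
proof -
  have "(x, y, t) \<in> jc x y t"
    using assms by (simp add: in_join_class)
  then have "coords (jc x y t) \<in> jc x y t"
    unfolding coords_def by (rule someI)
  then show "snd (snd (coords (jc x y t))) = t" "t \<noteq> 1 \<Longrightarrow> fst (coords (jc x y t)) = x"
    "t \<noteq> 0 \<Longrightarrow> fst (snd (coords (jc x y t))) = y"
    using in_join_class [OF assms] by (metis prod.collapse)+
qed

definition height :: "('a \<times> 'b \<times> real) set \<Rightarrow> real" where
  "height c = snd (snd (coords c))"

lemma height_jc: "x \<in> topspace X \<Longrightarrow> y \<in> topspace Y \<Longrightarrow> t \<in> {0..1} \<Longrightarrow> height (jc x y t) = t"
  by (simp add: height_def coords_jc)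

lemma continuous_map_height: "continuous_map J euclideanreal height"
  by (rule continuous_map_from_J, rule continuous_map_eq [OF continuous_map_P_components(3)])
    (auto simp: height_jc)

text \<open>The join of the maps \<open>F\<close> and \<open>G\<close>. The weights
  \<open>1 - t\<close> and \<open>t\<close> annihilate the component that is undetermined at either
  end.\<close>

definition FJ :: "('a \<times> 'b \<times> real) set \<Rightarrow> nat \<Rightarrow> real" where
  "FJ c i = (let (x, y, t) = coords c in if i < n then (1 - t) * F x i else t * G y (i - n))"

lemma FJ_jc:
  assumes "x \<in> topspace X" "y \<in> topspace Y" "t \<in> {0..1}"
  shows "FJ (jc x y t) i = (if i < n then (1 - t) * F x i else t * G y (i - n))"
proof -
  obtain x' y' t' where z: "coords (jc x y t) = (x', y', t')"
    using prod_cases3 by blast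
  then have "t' = t" "t \<noteq> 1 \<Longrightarrow> x' = x" "t \<noteq> 0 \<Longrightarrow> y' = y"
    using coords_jc [OF assms] by auto
  then show ?thesis
    unfolding FJ_def z by (cases "t = 1"; cases "t = 0") auto
qed

lemma free_involution_join: "free_involution J TJ FJ"
proof
  have "continuous_map P P (\<lambda>(x, y, t). (T x, S y, t))"
    unfolding case_prod_unfold
    by (intro continuous_map_pairedI continuous_map_compose [OF continuous_map_P_components(1) X.T_cont, unfolded o_def]
        continuous_map_compose [OF continuous_map_P_components(2) Y.T_cont, unfolded o_def])
      (use continuous_map_P_components(3) in \<open>auto simp: continuous_map_in_subtopology\<close>)
  from continuous_map_compose [OF this continuous_map_jc]
  show "continuous_map J J TJ"
    by (intro continuous_map_from_J) (erule continuous_map_eq, auto simp: TJ_jc)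
  show "TJ (TJ c) = c" if "c \<in> topspace J" for c
    using that by (elim J_cases) (simp add: TJ_jc X.T_in Y.T_in X.T_T Y.T_T)
  show "continuous_map J euclideanreal (\<lambda>c. FJ c i)" for i
  proof (rule continuous_map_from_J)
    have "continuous_map P euclideanreal (\<lambda>z. (1 - snd (snd z)) * F (fst z) i)"
      by (intro continuous_map_real_mult continuous_map_diff continuous_map_P_components(3)
          continuous_map_compose [OF continuous_map_P_components(1) X.F_cont, unfolded o_def]) auto
    moreover have "continuous_map P euclideanreal (\<lambda>z. snd (snd z) * G (fst (snd z)) (i - n))"
      by (intro continuous_map_real_mult continuous_map_P_components(3)
          continuous_map_compose [OF continuous_map_P_components(2) Y.F_cont, unfolded o_def])
    ultimately have "continuous_map P euclideanreal
        (\<lambda>z. if i < n then (1 - snd (snd z)) * F (fst z) i else snd (snd z) * G (fst (snd z)) (i - n))"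
      by auto
    then show "continuous_map P euclideanreal (\<lambda>(x, y, t). FJ (jc x y t) i)"
      by (rule continuous_map_eq) (auto simp: FJ_jc)
  qed
  show "FJ (TJ c) i = - FJ c i" if "c \<in> topspace J" for c i
    using that by (elim J_cases) (simp add: TJ_jc FJ_jc X.T_in Y.T_in X.F_odd Y.F_odd)
  show "\<exists>i. FJ c i \<noteq> 0" if c: "c \<in> topspace J" for c
  proof -
    obtain x y t where xyt: "x \<in> topspace X" "y \<in> topspace Y" "t \<in> {0..1}" "c = jc x y t"
      using J_cases [OF c] .
    obtain i j where i: "F x i \<noteq> 0" and j: "G y j \<noteq> 0"
      using X.F_nonzero Y.F_nonzero xyt by blast
    show ?thesis
    proof (cases "t = 1")
      case True
      then have "FJ c (n + j) \<noteq> 0"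
        using j xyt by (simp add: FJ_jc)
      then show ?thesis by blast
    next
      case False
      then have "FJ c i \<noteq> 0"
        using i F_finite [OF xyt(1) i] xyt by (simp add: FJ_jc)
      then show ?thesis by blast
    qed
  qed
qed

sublocale J: free_involution J TJ FJ
  by (rule free_involution_join)

text \<open>A quotient map restricted to the preimage of an open set is again a quotient map, so
  continuity can be checked on triples.\<close>

lemma continuous_map_on_open:
  assumes V: "openin J V" and g: "continuous_map (subtopology P {z \<in> topspace P. (case z of (x, y, t) \<Rightarrow> jc x y t) \<in> V}) Z h"
    and eq: "\<And>x y t. x \<in> topspace X \<Longrightarrow> y \<in> topspace Y \<Longrightarrow> t \<in> {0..1} \<Longrightarrow> jc x y t \<in> V \<Longrightarrow> g (jc x y t) = h (x, y, t)"
  shows "continuous_map (subtopology J V) Z g"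
proof (rule continuous_compose_quotient_map)
  show "quotient_map (subtopology P {z \<in> topspace P. (case z of (x, y, t) \<Rightarrow> jc x y t) \<in> V}) (subtopology J V)
      (\<lambda>(x, y, t). jc x y t)"
    by (rule quotient_map_restriction [OF quotient_map_join]) (use V in auto)
  show "continuous_map (subtopology P {z \<in> topspace P. (case z of (x, y, t) \<Rightarrow> jc x y t) \<in> V}) Z
      (g \<circ> (\<lambda>(x, y, t). jc x y t))"
    by (rule continuous_map_eq [OF g]) (auto simp: eq)
qed

text \<open>
  The complements of the two ends of the join are open, cover it, and map equivariantly to the
  factors.
\<close>

theorem smith_index_join_le:
  assumes index: "smith_index_ge J TJ (Suc k + l)" and X: "\<not> smith_index_ge X T (Suc k)"
  shows "smith_index_ge Y S l"
proof -
  define U where "U = {c \<in> topspace J. height c \<in> {..<1}}"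
  define V where "V = {c \<in> topspace J. height c \<in> {0<..}}"
  have U: "openin J U" and V: "openin J V"
    unfolding U_def V_def by (rule openin_continuous_map_preimage [OF continuous_map_height]; simp)+
  have height_TJ: "height (TJ c) = height c" if "c \<in> topspace J" for c
    using that by (elim J_cases) (simp add: TJ_jc height_jc X.T_in Y.T_in)
  have "continuous_map (subtopology J U) X (\<lambda>c. fst (coords c))"
    by (rule continuous_map_on_open [OF U continuous_map_from_subtopology [OF continuous_map_P_components(1)]])
      (auto simp: U_def height_jc coords_jc)
  moreover have "fst (coords (TJ c)) = T (fst (coords c))" if "c \<in> topspace (subtopology J U)" for c
  proof -
    have "c \<in> topspace J" "height c < 1" using that by (auto simp: U_def)
    then show ?thesis
      by (elim J_cases) (simp add: TJ_jc height_jc coords_jc X.T_in Y.T_in)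
  qed
  ultimately have "\<not> smith_index_ge (subtopology J U) TJ (Suc k)"
    using X smith_index_ge_map by blast
  moreover have "TJ c \<in> U" if "c \<in> U" for c
    using that J.T_in height_TJ by (auto simp: U_def)
  moreover have "topspace J \<subseteq> U \<union> V"
    by (auto simp: U_def V_def)
  ultimately have "smith_index_ge (subtopology J V) TJ l"
    using J.smith_index_cover U V index by blast
  moreover have "continuous_map (subtopology J V) Y (\<lambda>c. fst (snd (coords c)))"
    by (rule continuous_map_on_open [OF V continuous_map_from_subtopology [OF continuous_map_P_components(2)]])
      (auto simp: V_def height_jc coords_jc)
  moreover have "fst (snd (coords (TJ c))) = S (fst (snd (coords c)))" if "c \<in> topspace (subtopology J V)" for c
  proof -
    have "c \<in> topspace J" "height c > 0" using that by (auto simp: V_def)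
    then show ?thesis
      by (elim J_cases) (simp add: TJ_jc height_jc coords_jc X.T_in Y.T_in)
  qed
  ultimately show ?thesis
    using smith_index_ge_map by blast
qed

end

subsection \<open>Joins of singular chains\<close>

text \<open>The total weight of the first \<open>p + 1\<close> vertices; in join coordinates it is
  \<open>1 - t\<close>.\<close>

definition low :: "nat \<Rightarrow> (nat \<Rightarrow> real) \<Rightarrow> real" where
  "low p x = (\<Sum>i\<le>p. x i)"

text \<open>
  The barycentric projections to the face spanned by the first \<open>p + 1\<close> vertices and to the
  opposite face; where a projection is undefined, a vertex is chosen.
\<close>

definition proj_low :: "nat \<Rightarrow> (nat \<Rightarrow> real) \<Rightarrow> nat \<Rightarrow> real" where
  "proj_low p x = (if low p x = 0 then (\<lambda>i. if i = 0 then 1 else 0) else (\<lambda>i. if i \<le> p then x i / low p x else 0))"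

definition proj_high :: "nat \<Rightarrow> (nat \<Rightarrow> real) \<Rightarrow> nat \<Rightarrow> real" where
  "proj_high p x = (if low p x = 1 then (\<lambda>i. if i = 0 then 1 else 0) else (\<lambda>i. x (Suc p + i) / (1 - low p x)))"

definition mix :: "nat \<Rightarrow> (nat \<Rightarrow> real) \<Rightarrow> (nat \<Rightarrow> real) \<Rightarrow> real \<Rightarrow> nat \<Rightarrow> real" where
  "mix p a b t = (\<lambda>i. if i \<le> p then (1 - t) * a i else t * b (i - Suc p))"

lemma sum_split_high:
  fixes x :: "nat \<Rightarrow> real"
  shows "(\<Sum>i\<le>Suc (p + q). x i) = low p x + (\<Sum>i\<le>q. x (Suc p + i))"
  using sum_atMost_split [of x p q] by (simp only: low_def add_Suc_right)

lemma low_bounds: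
  assumes x: "x \<in> standard_simplex (Suc (p + q))"
  shows "low p x \<in> {0..1}" "(\<Sum>i\<le>q. x (Suc p + i)) = 1 - low p x"
proof -
  have x0: "\<And>i. 0 \<le> x i" and s: "(\<Sum>i\<le>Suc (p + q). x i) = 1"
    using x by (auto simp: standard_simplex_def simp del: sum.atMost_Suc)
  show eq: "(\<Sum>i\<le>q. x (Suc p + i)) = 1 - low p x"
    using s unfolding sum_split_high by simp
  have "0 \<le> low p x" "0 \<le> (\<Sum>i\<le>q. x (Suc p + i))"
    unfolding low_def using x0 by (auto intro: sum_nonneg)
  then show "low p x \<in> {0..1}" using eq by simp
qed

lemma vertex_in: "(\<lambda>i. if i = 0 then 1 else 0) \<in> standard_simplex p"
  using basis_in_standard_simplex [of 0 p] by simp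

lemma standard_simplexI:
  assumes "\<And>i. 0 \<le> x i" "\<And>i. i > p \<Longrightarrow> x i = 0" "(\<Sum>i\<le>p. x i) = 1"
  shows "x \<in> standard_simplex p"
proof -
  have "x i \<le> 1" for i
  proof (cases "i \<le> p")
    case True
    then have "x i \<le> (\<Sum>i\<le>p. x i)"
      using assms(1) by (intro member_le_sum) auto
    then show ?thesis using assms(3) by simp
  next
    case False
    then show ?thesis using assms(2) [of i] by simp
  qed
  then show ?thesis
    using assms by (auto simp: standard_simplex_def)
qed

lemma proj_low_in:
  assumes x: "x \<in> standard_simplex (Suc (p + q))"
  shows "proj_low p x \<in> standard_simplex p"
proof (cases "low p x = 0")
  case True
  then show ?thesis by (simp add: proj_low_def vertex_in)
next
  case False
  then have "low p x > 0" using low_bounds(1) [OF x] by simp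
  show ?thesis
  proof (rule standard_simplexI)
    have "(\<Sum>i\<le>p. proj_low p x i) = (\<Sum>i\<le>p. x i / low p x)"
      using False by (simp add: proj_low_def)
    also have "\<dots> = low p x / low p x"
      unfolding low_def by (rule sum_divide_distrib [symmetric])
    finally show "(\<Sum>i\<le>p. proj_low p x i) = 1" using False by simp
  qed (use \<open>low p x > 0\<close> x in \<open>auto simp: proj_low_def standard_simplex_def\<close>)
qed

lemma proj_high_in:
  assumes x: "x \<in> standard_simplex (Suc (p + q))"
  shows "proj_high p x \<in> standard_simplex q"
proof (cases "low p x = 1")
  case True
  then show ?thesis by (simp add: proj_high_def vertex_in)
next
  case False
  then have "low p x < 1" using low_bounds(1) [OF x] by simp
  show ?thesis
  proof (rule standard_simplexI)
    have "(\<Sum>i\<le>q. proj_high p x i) = (\<Sum>i\<le>q. x (Suc p + i) / (1 - low p x))"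
      using False by (simp add: proj_high_def)
    also have "\<dots> = (1 - low p x) / (1 - low p x)"
      unfolding low_bounds(2) [OF x, symmetric] by (rule sum_divide_distrib [symmetric])
    finally show "(\<Sum>i\<le>q. proj_high p x i) = 1" using False by simp
  qed (use \<open>low p x < 1\<close> x in \<open>auto simp: proj_high_def standard_simplex_def\<close>)
qed

lemma low_mix: "a \<in> standard_simplex p \<Longrightarrow> low p (mix p a b t) = 1 - t"
  by (simp add: low_def mix_def standard_simplex_def flip: sum_distrib_left)

lemma mix_in:
  assumes a: "a \<in> standard_simplex p" and b: "b \<in> standard_simplex q" and t: "t \<in> {0..1}"
  shows "mix p a b t \<in> standard_simplex (Suc (p + q))"
proof (rule standard_simplexI)
  have "(\<Sum>i\<le>q. mix p a b t (Suc p + i)) = t"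
    using b by (simp add: mix_def standard_simplex_def flip: sum_distrib_left)
  then show "(\<Sum>i\<le>Suc (p + q). mix p a b t i) = 1"
    unfolding sum_split_high low_mix [OF a] by simp
qed (use a b t in \<open>auto simp: mix_def standard_simplex_def\<close>)

lemma proj_low_mix:
  assumes "a \<in> standard_simplex p" "t \<noteq> 1"
  shows "proj_low p (mix p a b t) = a"
  using assms unfolding proj_low_def low_mix [OF assms(1)]
  by (auto simp: mix_def standard_simplex_def fun_eq_iff)

lemma proj_high_mix:
  assumes "a \<in> standard_simplex p" "t \<noteq> 0"
  shows "proj_high p (mix p a b t) = b"
  using assms(2) unfolding proj_high_def low_mix [OF assms(1)] by (auto simp: mix_def)

text \<open>Where a projection falls back on a vertex, its weight is 0, and by nonnegativity the
  coordinates in question vanish.\<close>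

lemma mix_proj:
  assumes x: "x \<in> standard_simplex (Suc (p + q))"
  shows "mix p (proj_low p x) (proj_high p x) (1 - low p x) = x"
proof
  fix i
  have x0: "\<And>i. 0 \<le> x i" and xz: "\<And>i. i > Suc (p + q) \<Longrightarrow> x i = 0"
    using x by (auto simp: standard_simplex_def)
  show "mix p (proj_low p x) (proj_high p x) (1 - low p x) i = x i"
  proof (cases "i \<le> p")
    case True
    have "x i = 0" if "low p x = 0"
      using that True x0 by (simp add: low_def sum_nonneg_eq_0_iff)
    then show ?thesis
      using True by (auto simp: mix_def proj_low_def)
  next
    case False
    have "x i = 0" if "low p x = 1"
    proof (cases "i \<le> Suc (p + q)")
      case True
      have "(\<Sum>j\<le>q. x (Suc p + j)) = 0"
        using low_bounds(2) [OF x] that by simp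
      then have "\<forall>j\<le>q. x (Suc p + j) = 0"
        using x0 by (simp add: sum_nonneg_eq_0_iff)
      moreover have "i = Suc p + (i - Suc p)" "i - Suc p \<le> q"
        using True False by auto
      ultimately show ?thesis by metis
    qed (use xz in simp)
    moreover have "Suc p + (i - Suc p) = i" using False by simp
    ultimately show ?thesis
      using False by (auto simp: mix_def proj_high_def)
  qed
qed

text \<open>A compact parametrisation of the simplex as a join, used to show continuity at the ends.\<close>

lemma quotient_map_mix:
  "quotient_map (prod_topology (simplex_space p)
       (prod_topology (simplex_space q) (top_of_set {0..1})))
     (simplex_space (Suc (p + q))) (\<lambda>(a, b, t). mix p a b t)"
  (is "quotient_map ?D ?E ?f")
proof (rule continuous_closed_imp_quotient_map)
  have "continuous_map ?D (simplex_space q) (fst \<circ> snd)"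
    "continuous_map ?D (top_of_set {0..1}) (snd \<circ> snd)"
    by (rule continuous_map_fst_of continuous_map_snd_of, rule continuous_map_snd)+
  then have b: "continuous_map ?D euclideanreal (\<lambda>z. fst (snd z) i)" and t: "continuous_map ?D euclideanreal (\<lambda>z. snd (snd z))" for i
    using continuous_map_compose [OF _ continuous_map_coordinate [of _ i]]
    by (fastforce simp: o_def continuous_map_in_subtopology)+
  have a: "continuous_map ?D euclideanreal (\<lambda>z. fst z i)" for i
    using continuous_map_compose [OF continuous_map_fst continuous_map_coordinate [of _ i]] by (simp add: o_def)
  have "continuous_map ?D euclideanreal (\<lambda>z. ?f z i)" for i
  proof (cases "i \<le> p")
    case True
    have "continuous_map ?D euclideanreal (\<lambda>z. (1 - snd (snd z)) * fst z i)"
      by (intro continuous_map_real_mult continuous_map_diff a t) auto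
    then show ?thesis using True by (simp add: mix_def case_prod_unfold)
  next
    case False
    have "continuous_map ?D euclideanreal (\<lambda>z. snd (snd z) * fst (snd z) (i - Suc p))"
      by (intro continuous_map_real_mult b t)
    then show ?thesis using False by (simp add: mix_def case_prod_unfold)
  qed
  then show cont: "continuous_map ?D ?E ?f"
    unfolding continuous_map_in_subtopology continuous_map_componentwise_UNIV by (auto intro: mix_in)
  show "closed_map ?D ?E ?f"
  proof (rule continuous_imp_closed_map_gen [OF _ _ cont])
    show "compact_space ?D"
      by (simp add: compact_space_prod_topology compact_space_subtopology compactin_standard_simplex)
    have "Hausdorff_space (powertop_real (UNIV :: nat set))"
      by (simp add: Hausdorff_space_product_topology)
    then show "kc_space ?E"
      by (intro Hausdorff_imp_kc_space Hausdorff_space_subtopology)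
  qed
  show "?f ` topspace ?D = topspace ?E"
  proof
    show "?f ` topspace ?D \<subseteq> topspace ?E"
      by (auto intro: mix_in)
    show "topspace ?E \<subseteq> ?f ` topspace ?D"
    proof
      fix x assume "x \<in> topspace ?E"
      then have x: "x \<in> standard_simplex (Suc (p + q))" by simp
      then have "(proj_low p x, proj_high p x, 1 - low p x) \<in> topspace ?D"
        using proj_low_in [OF x] proj_high_in [OF x] low_bounds(1) [OF x] by simp
      moreover have "x = ?f (proj_low p x, proj_high p x, 1 - low p x)"
        using mix_proj [OF x] by simp
      ultimately show "x \<in> ?f ` topspace ?D" by blast
    qed
  qed
qed

lemma cong2_frag_extend_const:
  "frag_extend (\<lambda>_. W) z \<approx>\<^sub>2 (if augm z = 1 then W else 0)"
proof -
  have "Poly_Mapping.keys z \<subseteq> UNIV" by simp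
  then show ?thesis
  proof (induction z rule: frag_induction)
    case (diff a b)
    have "(if augm a = 1 then W else 0) - (if augm b = 1 then W else 0) \<approx>\<^sub>2 (if augm (a - b) = 1 then W else 0)"
      unfolding augm_diff by (cases "augm a"; cases "augm b") (auto simp: cong2_minus)
    then show ?case
      unfolding frag_extend_diff using cong2_diff [OF diff] cong2_trans by blast
  qed auto
qed

lemma chain_boundary_frag_extend:
  "chain_boundary p (frag_extend f c) = frag_extend (\<lambda>x. chain_boundary p (f x)) c"
proof -
  have "Poly_Mapping.keys c \<subseteq> UNIV" by simp
  then show ?thesis
    by (induction c rule: frag_induction) (auto simp: frag_extend_diff chain_boundary_diff)
qed

lemma chain_map_frag_extend:
  "chain_map p g (frag_extend f c) = frag_extend (\<lambda>x. chain_map p g (f x)) c"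
proof -
  have "Poly_Mapping.keys c \<subseteq> UNIV" by simp
  then show ?thesis
    by (induction c rule: frag_induction) (auto simp: frag_extend_diff chain_map_diff)
qed

lemma frag_extend_frag_extend:
  "frag_extend g (frag_extend f c) = frag_extend (\<lambda>x. frag_extend g (f x)) c"
proof -
  have "Poly_Mapping.keys c \<subseteq> UNIV" by simp
  then show ?thesis
    by (induction c rule: frag_induction) (auto simp: frag_extend_diff)
qed

lemma frag_extend_fun_add:
  "frag_extend (\<lambda>x. f x + g x) c = frag_extend f c + frag_extend g c"
proof -
  have "Poly_Mapping.keys c \<subseteq> UNIV" by simp
  then show ?thesis
    by (induction c rule: frag_induction) (auto simp: frag_extend_diff)
qed

lemma frag_extend_fun_sum:
  "finite I \<Longrightarrow> frag_extend (\<lambda>x. \<Sum>i\<in>I. g i x) c = (\<Sum>i\<in>I. frag_extend (g i) c)"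
  by (induction I rule: finite_induct) (simp_all add: frag_extend_fun_add frag_extend_eq_0)

lemma simplex_in:
  "singular_simplex p Z s \<Longrightarrow> x \<in> standard_simplex p \<Longrightarrow> s x \<in> topspace Z"
  by (auto simp: singular_simplex_def continuous_map_def)

section \<open>Barycentric projections and face maps\<close>

lemma low_face_low:
  assumes "i \<le> Suc p"
  shows "low (Suc p) (simplical_face i x) = low p x"
proof -
  have "(\<Sum>j\<le>Suc p. simplical_face i x j) = (\<Sum>j\<in>{..Suc p} - {i}. simplical_face i x j)"
    by (rule sum.mono_neutral_right) (auto simp: simplical_face_def)
  also have "\<dots> = (\<Sum>j\<le>p. x j)"
    by (rule sum.reindex_bij_witness [of _ "\<lambda>j. if j < i then j else Suc j" "\<lambda>j. if j < i then j else j - 1"])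
      (use assms in \<open>auto simp: simplical_face_def split: if_splits\<close>)
  finally show ?thesis by (simp add: low_def)
qed

lemma low_face_high: "p < i \<Longrightarrow> low p (simplical_face i x) = low p x"
  by (simp add: low_def simplical_face_def)

lemma proj_high_face_low:
  assumes "i \<le> Suc p"
  shows "proj_high (Suc p) (simplical_face i x) = proj_high p x"
  using assms unfolding proj_high_def low_face_low [OF assms]
  by (auto simp: simplical_face_def fun_eq_iff)

lemma proj_low_face_low:
  assumes "i \<le> Suc p" "low p x \<noteq> 0"
  shows "proj_low (Suc p) (simplical_face i x) = simplical_face i (proj_low p x)"
  using assms unfolding proj_low_def low_face_low [OF assms(1)]
  by (auto simp: simplical_face_def fun_eq_iff)

lemma proj_low_face_high:
  assumes "p < i"
  shows "proj_low p (simplical_face i x) = proj_low p x"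
  using assms unfolding proj_low_def low_face_high [OF assms]
  by (auto simp: simplical_face_def fun_eq_iff)

lemma proj_high_face_high:
  assumes "low p x \<noteq> 1"
  shows "proj_high p (simplical_face (Suc p + i) x) = simplical_face i (proj_high p x)"
proof -
  have "low p (simplical_face (Suc p + i) x) = low p x"
    by (rule low_face_high) simp
  then show ?thesis
    using assms unfolding proj_high_def by (auto simp: simplical_face_def fun_eq_iff)
qed

context join_involutions
begin

definition sjoin :: "nat \<Rightarrow> nat \<Rightarrow> ((nat \<Rightarrow> real) \<Rightarrow> 'a) \<Rightarrow> ((nat \<Rightarrow> real) \<Rightarrow> 'b) \<Rightarrow> (nat \<Rightarrow> real) \<Rightarrow> ('a \<times> 'b \<times> real) set" where
  "sjoin p q s r = (\<lambda>x\<in>standard_simplex (Suc (p + q)). jc (s (proj_low p x)) (r (proj_high p x)) (1 - low p x))"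

text \<open>The projections need not be continuous at the ends. After composition with the quotient
  map \<open>mix\<close> the simplex becomes the plain join of \<open>s\<close> and
  \<open>r\<close>, because the join class forgets the arbitrary components.\<close>

lemma singular_simplex_sjoin:
  assumes s: "singular_simplex p X s" and r: "singular_simplex q Y r"
  shows "singular_simplex (Suc (p + q)) J (sjoin p q s r)"
  unfolding singular_simplex_def
proof
  let ?D = "prod_topology (simplex_space p)
       (prod_topology (simplex_space q) (top_of_set {0..1::real}))"
  show "continuous_map (simplex_space (Suc (p + q))) J (sjoin p q s r)"
  proof (rule continuous_compose_quotient_map [OF quotient_map_mix])
    have "continuous_map (prod_topology (simplex_space q) (top_of_set {0..1::real}))
        (prod_topology Y (top_of_set {0..1::real})) (\<lambda>(b, t). (r b, t))"
      using r by (auto simp: continuous_map_prod_top singular_simplex_def)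
    then have "continuous_map ?D P (\<lambda>(a, z). (s a, (\<lambda>(b, t). (r b, t)) z))"
      using s unfolding continuous_map_prod_top by (auto simp: singular_simplex_def)
    from continuous_map_compose [OF this continuous_map_jc]
    show "continuous_map ?D J (sjoin p q s r \<circ> (\<lambda>(a, b, t). mix p a b t))"
    proof (rule continuous_map_eq)
      fix z assume z: "z \<in> topspace ?D"
      obtain a b t where abt: "z = (a, b, t)" by (rule prod_cases3)
      then have a: "a \<in> standard_simplex p" and b: "b \<in> standard_simplex q" and t: "t \<in> {0..1::real}"
        using z by auto
      have m: "mix p a b t \<in> standard_simplex (Suc (p + q))"
        using a b t by (rule mix_in)
      have "jc (s (proj_low p (mix p a b t))) (r (proj_high p (mix p a b t))) t = jc (s a) (r b) t"
        using simplex_in [OF s a] simplex_in [OF r b] simplex_in [OF s proj_low_in [OF m]]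
          simplex_in [OF r proj_high_in [OF m]] t
        by (subst join_class_eq_iff) (auto simp: proj_low_mix [OF a] proj_high_mix [OF a])
      then show "((\<lambda>(x, y, t). jc x y t) \<circ> (\<lambda>(a, z). (s a, (\<lambda>(b, t). (r b, t)) z))) z =
          (sjoin p q s r \<circ> (\<lambda>(a, b, t). mix p a b t)) z"
        using m by (simp add: abt sjoin_def low_mix [OF a])
    qed
  qed
qed (simp add: sjoin_def)

lemma simplex_map_sjoin:
  assumes s: "singular_simplex p X s" and r: "singular_simplex q Y r"
  shows "simplex_map (Suc (p + q)) TJ (sjoin p q s r) = sjoin p q (simplex_map p T s) (simplex_map q S r)"
proof
  fix x
  show "simplex_map (Suc (p + q)) TJ (sjoin p q s r) x = sjoin p q (simplex_map p T s) (simplex_map q S r) x"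
  proof (cases "x \<in> standard_simplex (Suc (p + q))")
    case True
    then show ?thesis
      using proj_low_in [OF True] proj_high_in [OF True] low_bounds(1) [OF True]
        simplex_in [OF s proj_low_in [OF True]] simplex_in [OF r proj_high_in [OF True]]
      by (simp add: simplex_map_def sjoin_def TJ_jc)
  qed (simp add: simplex_map_def sjoin_def)
qed

text \<open>For weight 0 the low projection is the default vertex, which face maps may move; but
  then the parameter is 1 and the join class ignores this component. Elsewhere projection and face
  map commute.\<close>

lemma singular_face_sjoin_low:
  assumes s: "singular_simplex (Suc p) X s" and r: "singular_simplex q Y r" and i: "i \<le> Suc p"
  shows "singular_face (Suc (Suc p + q)) i (sjoin (Suc p) q s r) = sjoin p q (singular_face (Suc p) i s) r"
proof
  fix x
  show "singular_face (Suc (Suc p + q)) i (sjoin (Suc p) q s r) x = sjoin p q (singular_face (Suc p) i s) r x"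
  proof (cases "x \<in> standard_simplex (Suc (p + q))")
    case True
    have f: "simplical_face i x \<in> standard_simplex (Suc (Suc p + q))"
      using simplical_face_in_standard_simplex [of "Suc (Suc p + q)" i x] True i by simp
    have l: "proj_low p x \<in> standard_simplex p"
      using proj_low_in [OF True] .
    have face: "singular_face (Suc p) i s (proj_low p x) = s (simplical_face i (proj_low p x))"
      using l by (simp add: singular_face_def)
    have "singular_simplex p X (singular_face (Suc p) i s)"
      using singular_simplex_singular_face [OF s] i by simp
    from simplex_in [OF this l]
    have "jc (s (proj_low (Suc p) (simplical_face i x))) (r (proj_high p x)) (1 - low p x)
      = jc (singular_face (Suc p) i s (proj_low p x)) (r (proj_high p x)) (1 - low p x)"
      unfolding face
      using simplex_in [OF s proj_low_in [OF f]] simplex_in [OF r proj_high_in [OF True]]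
        low_bounds(1) [OF True] i
      by (subst join_class_eq_iff) (auto simp: proj_low_face_low)
    then show ?thesis
      using True f i by (simp add: singular_face_def sjoin_def low_face_low proj_high_face_low)
  qed (simp add: singular_face_def sjoin_def)
qed

lemma singular_face_sjoin_high:
  assumes s: "singular_simplex p X s" and r: "singular_simplex (Suc q) Y r" and i: "i \<le> Suc q"
  shows "singular_face (Suc (p + Suc q)) (Suc p + i) (sjoin p (Suc q) s r) = sjoin p q s (singular_face (Suc q) i r)"
proof
  fix x
  show "singular_face (Suc (p + Suc q)) (Suc p + i) (sjoin p (Suc q) s r) x = sjoin p q s (singular_face (Suc q) i r) x"
  proof (cases "x \<in> standard_simplex (Suc (p + q))")
    case True
    have f: "simplical_face (Suc p + i) x \<in> standard_simplex (Suc (p + Suc q))"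
      using simplical_face_in_standard_simplex [of "Suc (p + Suc q)" "Suc p + i" x] True i by simp
    have l: "proj_high p x \<in> standard_simplex q"
      using proj_high_in [OF True] .
    have face: "singular_face (Suc q) i r (proj_high p x) = r (simplical_face i (proj_high p x))"
      using l by (simp add: singular_face_def)
    have "singular_simplex q Y (singular_face (Suc q) i r)"
      using singular_simplex_singular_face [OF r] i by simp
    from simplex_in [OF this l]
    have "jc (s (proj_low p x)) (r (proj_high p (simplical_face (Suc p + i) x))) (1 - low p x)
      = jc (s (proj_low p x)) (singular_face (Suc q) i r (proj_high p x)) (1 - low p x)"
      unfolding face
      using simplex_in [OF r proj_high_in [OF f]] simplex_in [OF s proj_low_in [OF True]]
        low_bounds(1) [OF True]
      by (subst join_class_eq_iff) (auto simp: proj_high_face_high simp del: add_Suc)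
    then show ?thesis
      using True f i by (simp add: singular_face_def sjoin_def low_face_high proj_low_face_high)
  qed (simp add: singular_face_def sjoin_def)
qed

text \<open>Omitting the only vertex of \<open>s\<close> leaves \<open>r\<close> at the end of the
  join where the first component is forgotten. Thus all \<open>s\<close> give the same face, written
  with an arbitrary base point \<open>x0\<close>.\<close>

lemma singular_face_sjoin_bottom:
  assumes s: "singular_simplex 0 X s" and r: "singular_simplex q Y r" and x0: "x0 \<in> topspace X"
  shows "singular_face (Suc q) 0 (sjoin 0 q s r) = simplex_map q (\<lambda>y. jc x0 y 1) r"
proof
  fix x
  show "singular_face (Suc q) 0 (sjoin 0 q s r) x = simplex_map q (\<lambda>y. jc x0 y 1) r x"
  proof (cases "x \<in> standard_simplex q")
    case True
    have f: "simplical_face 0 x \<in> standard_simplex (Suc (0 + q))"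
      using simplical_face_in_standard_simplex [of "Suc q" 0 x] True by simp
    have "low 0 (simplical_face 0 x) = 0" "proj_high 0 (simplical_face 0 x) = x"
      by (auto simp: low_def simplical_face_def proj_high_def)
    moreover have "jc (s (proj_low 0 (simplical_face 0 x))) (r x) 1 = jc x0 (r x) 1"
      using simplex_in [OF s proj_low_in [OF f]] simplex_in [OF r True] x0
      by (subst join_class_eq_iff) auto
    ultimately show ?thesis
      using True f by (simp add: singular_face_def sjoin_def simplex_map_def)
  qed (simp add: singular_face_def simplex_map_def)
qed

lemma singular_face_sjoin_top:
  assumes s: "singular_simplex p X s" and r: "singular_simplex 0 Y r" and y0: "y0 \<in> topspace Y"
  shows "singular_face (Suc p) (Suc p) (sjoin p 0 s r) = simplex_map p (\<lambda>x. jc x y0 0) s"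
proof
  fix x
  show "singular_face (Suc p) (Suc p) (sjoin p 0 s r) x = simplex_map p (\<lambda>x. jc x y0 0) s x"
  proof (cases "x \<in> standard_simplex p")
    case True
    have f: "simplical_face (Suc p) x = x"
      using simplical_face_standard [OF True, of "Suc p"] by simp
    have x': "x \<in> standard_simplex (Suc (p + 0))"
      using True standard_simplex_mono [of p "Suc p"] by auto
    have "low p x = 1"
      using True by (simp add: low_def standard_simplex_def)
    moreover have "proj_low p x = x"
      using True \<open>low p x = 1\<close> by (auto simp: proj_low_def standard_simplex_def fun_eq_iff)
    moreover have "jc (s x) (r (proj_high p x)) 0 = jc (s x) y0 0"
      using simplex_in [OF r proj_high_in [OF x']] simplex_in [OF s True] y0
      by (subst join_class_eq_iff) auto
    ultimately show ?thesis
      using True x' f by (simp add: singular_face_def sjoin_def simplex_map_def)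
  qed (simp add: singular_face_def simplex_map_def)
qed

definition cjoin :: "nat \<Rightarrow> nat \<Rightarrow> 'a chain \<Rightarrow> 'b chain \<Rightarrow> ('a \<times> 'b \<times> real) set chain" where
  "cjoin p q z d = frag_extend (\<lambda>s. frag_extend (\<lambda>r. frag_of (sjoin p q s r)) d) z"

lemma cjoin_add_right: "cjoin p q z (d + d') = cjoin p q z d + cjoin p q z d'"
  by (simp add: cjoin_def frag_extend_add frag_extend_fun_add)

lemma cong2_cjoin_left: "z \<approx>\<^sub>2 z' \<Longrightarrow> cjoin p q z d \<approx>\<^sub>2 cjoin p q z' d"
  unfolding cjoin_def by (rule cong2_extend)

lemma cong2_cjoin_right: "d \<approx>\<^sub>2 d' \<Longrightarrow> cjoin p q z d \<approx>\<^sub>2 cjoin p q z d'"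
  unfolding cjoin_def by (rule cong2_frag_extend_fun [OF subset_UNIV]) (rule cong2_extend)

lemma singular_chain_cjoin:
  assumes "singular_chain p X z" "singular_chain q Y d"
  shows "singular_chain (Suc (p + q)) J (cjoin p q z d)"
  unfolding cjoin_def using assms
  by (intro singular_chain_extend)
    (auto simp: singular_chain_of singular_chain_def intro!: singular_simplex_sjoin)

lemma chain_map_cjoin:
  assumes z: "singular_chain p X z" and d: "singular_chain q Y d"
  shows "chain_map (Suc (p + q)) TJ (cjoin p q z d) = cjoin p q (chain_map p T z) (chain_map q S d)"
proof -
  have "chain_map (Suc (p + q)) TJ (cjoin p q z d) =
    frag_extend (\<lambda>s. frag_extend (\<lambda>r. frag_of (simplex_map (Suc (p + q)) TJ (sjoin p q s r))) d) z"
    by (simp add: cjoin_def chain_map_frag_extend)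
  also have "\<dots> = frag_extend (\<lambda>s. frag_extend (\<lambda>r. frag_of (sjoin p q (simplex_map p T s) (simplex_map q S r))) d) z"
    using z d by (intro frag_extend_eq) (simp_all add: simplex_map_sjoin singular_chain_def subset_iff)
  also have "\<dots> = cjoin p q (chain_map p T z) (chain_map q S d)"
    by (simp add: cjoin_def chain_map_def frag_extend_compose) (simp add: o_def frag_extend_frag_extend)
  finally show ?thesis .
qed

lemma boundary_cjoin:
  assumes z: "singular_chain p X z" and d: "singular_chain q Y d"
  shows "chain_boundary (Suc (p + q)) (cjoin p q z d) \<approx>\<^sub>2
    frag_extend (\<lambda>s. frag_extend (\<lambda>r. \<Sum>i\<le>p. frag_of (singular_face (Suc (p + q)) i (sjoin p q s r))) d) z +
    frag_extend (\<lambda>s. frag_extend (\<lambda>r. \<Sum>i\<le>q. frag_of (singular_face (Suc (p + q)) (Suc p + i) (sjoin p q s r))) d) z"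
proof -
  have gen: "chain_boundary (Suc (p + q)) (frag_of (sjoin p q s r)) \<approx>\<^sub>2
    (\<Sum>i\<le>p. frag_of (singular_face (Suc (p + q)) i (sjoin p q s r))) +
    (\<Sum>i\<le>q. frag_of (singular_face (Suc (p + q)) (Suc p + i) (sjoin p q s r)))" for s r
  proof -
    let ?f = "\<lambda>i. frag_of (singular_face (Suc (p + q)) i (sjoin p q s r))"
    have "(\<Sum>i\<le>p + Suc q. ?f i) = (\<Sum>i\<le>p. ?f i) + (\<Sum>i\<le>q. ?f (Suc p + i))"
      by (rule sum_atMost_split)
    then show ?thesis
      using chain_boundary_of_cong2 [of "Suc (p + q)" "sjoin p q s r"] by (simp only: add_Suc_right zero_less_Suc)
  qed
  have eq: "chain_boundary (Suc (p + q)) (cjoin p q z d) =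
    frag_extend (\<lambda>s. frag_extend (\<lambda>r. chain_boundary (Suc (p + q)) (frag_of (sjoin p q s r))) d) z"
    by (simp only: cjoin_def chain_boundary_frag_extend)
  have "frag_extend (\<lambda>s. frag_extend (\<lambda>r. chain_boundary (Suc (p + q)) (frag_of (sjoin p q s r))) d) z \<approx>\<^sub>2
   frag_extend (\<lambda>s. frag_extend (\<lambda>r.
    (\<Sum>i\<le>p. frag_of (singular_face (Suc (p + q)) i (sjoin p q s r))) +
    (\<Sum>i\<le>q. frag_of (singular_face (Suc (p + q)) (Suc p + i) (sjoin p q s r)))) d) z"
    by (rule cong2_frag_extend_fun [OF subset_UNIV], rule cong2_frag_extend_fun [OF subset_UNIV], rule gen)
  then show ?thesis
    unfolding eq frag_extend_fun_add .
qed

text \<open>These faces form the join of the boundary of \<open>z\<close> with \<open>d\<close>. In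
  degree 0 they are instead copies of one chain at the end of the join, as many as the augmentation
  of \<open>z\<close>, so \<open>z\<close> has to be a cycle of the augmented complex.\<close>

lemma boundary_cjoin_low:
  assumes z: "singular_chain p X z" and d: "singular_chain q Y d"
    and cycle: "p = 0 \<Longrightarrow> augm z = 0" "even_chain (chain_boundary p z)"
  shows "even_chain (frag_extend (\<lambda>s. frag_extend (\<lambda>r. \<Sum>i\<le>p. frag_of (singular_face (Suc (p + q)) i (sjoin p q s r))) d) z)"
proof (cases p)
  case 0
  show ?thesis
  proof (cases "topspace X = {}")
    case True
    then have "z = 0" using z singular_chain_empty by blast
    then show ?thesis by simp
  next
    case False
    then obtain x0 where x0: "x0 \<in> topspace X" by blast
    have "frag_extend (\<lambda>s. frag_extend (\<lambda>r. \<Sum>i\<le>p. frag_of (singular_face (Suc (p + q)) i (sjoin p q s r))) d) z =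
      frag_extend (\<lambda>_. frag_extend (\<lambda>r. frag_of (simplex_map q (\<lambda>y. jc x0 y 1) r)) d) z"
      using z d 0 by (intro frag_extend_eq) (simp add: singular_face_sjoin_bottom [OF _ _ x0] singular_chain_def subset_iff)
    moreover have "frag_extend (\<lambda>_. W) z \<approx>\<^sub>2 0" for W :: "('a \<times> 'b \<times> real) set chain"
      using cong2_frag_extend_const [of W z] cycle(1) [OF 0] by simp
    ultimately show ?thesis by (simp only: cong2_0_iff)
  qed
next
  case (Suc p')
  have gen: "frag_extend (\<lambda>r. \<Sum>i\<le>p. frag_of (singular_face (Suc (p + q)) i (sjoin p q s r))) d \<approx>\<^sub>2
      cjoin p' q (chain_boundary p (frag_of s)) d" if s: "singular_simplex p X s" for s
  proof -
    have "cjoin p' q (chain_boundary p (frag_of s)) d \<approx>\<^sub>2 cjoin p' q (\<Sum>i\<le>p. frag_of (singular_face p i s)) d"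
      by (rule cong2_cjoin_left [OF chain_boundary_of_cong2]) (simp add: Suc)
    also have "\<dots> = (\<Sum>i\<le>p. frag_extend (\<lambda>r. frag_of (sjoin p' q (singular_face p i s) r)) d)"
      unfolding cjoin_def by (subst frag_extend_sum) (simp_all only: o_def frag_extend_of finite_atMost)
    also have "\<dots> = (\<Sum>i\<le>p. frag_extend (\<lambda>r. frag_of (singular_face (Suc (p + q)) i (sjoin p q s r))) d)"
      using d s by (intro sum.cong refl frag_extend_eq)
        (simp add: Suc singular_face_sjoin_low [unfolded add_Suc] singular_chain_def subset_iff)
    also have "\<dots> = frag_extend (\<lambda>r. \<Sum>i\<le>p. frag_of (singular_face (Suc (p + q)) i (sjoin p q s r))) d"
      by (simp only: frag_extend_fun_sum finite_atMost)
    finally show ?thesis by (rule cong2_sym)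
  qed
  have "frag_extend (\<lambda>s. frag_extend (\<lambda>r. \<Sum>i\<le>p. frag_of (singular_face (Suc (p + q)) i (sjoin p q s r))) d) z \<approx>\<^sub>2
    frag_extend (\<lambda>s. cjoin p' q (chain_boundary p (frag_of s)) d) z"
    using z gen by (intro cong2_frag_extend_fun [of z "singular_simplex_set p X"]) (auto simp: singular_chain_def)
  also have "\<dots> = cjoin p' q (chain_boundary p z) d"
    unfolding cjoin_def chain_boundary_def by (simp add: Suc frag_extend_frag_extend)
  also have "\<dots> \<approx>\<^sub>2 cjoin p' q 0 d"
    using cycle(2) by (intro cong2_cjoin_left) (simp add: cong2_0_iff)
  finally show ?thesis
    by (simp add: cong2_0_iff cjoin_def)
qed

lemma boundary_cjoin_Suc:
  assumes z: "singular_chain p X z" and d: "singular_chain (Suc q) Y d"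
    and cycle: "p = 0 \<Longrightarrow> augm z = 0" "even_chain (chain_boundary p z)"
  shows "chain_boundary (Suc (p + Suc q)) (cjoin p (Suc q) z d) \<approx>\<^sub>2 cjoin p q z (chain_boundary (Suc q) d)"
proof -
  let ?R = "\<lambda>s r. \<Sum>i\<le>Suc q. frag_of (singular_face (Suc (p + Suc q)) (Suc p + i) (sjoin p (Suc q) s r))"
  have gen: "?R s r \<approx>\<^sub>2 frag_extend (\<lambda>r. frag_of (sjoin p q s r)) (chain_boundary (Suc q) (frag_of r))"
    if s: "singular_simplex p X s" and r: "singular_simplex (Suc q) Y r" for s r
  proof -
    have "?R s r = (\<Sum>i\<le>Suc q. frag_of (sjoin p q s (singular_face (Suc q) i r)))"
      by (rule sum.cong [OF refl]) (simp only: singular_face_sjoin_high [OF s r] atMost_iff)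
    also have "\<dots> = frag_extend (\<lambda>r. frag_of (sjoin p q s r)) (\<Sum>i\<le>Suc q. frag_of (singular_face (Suc q) i r))"
      by (subst frag_extend_sum) (simp_all only: o_def frag_extend_of finite_atMost)
    also have "\<dots> \<approx>\<^sub>2 frag_extend (\<lambda>r. frag_of (sjoin p q s r)) (chain_boundary (Suc q) (frag_of r))"
      by (rule cong2_extend [OF cong2_sym [OF chain_boundary_of_cong2]]) simp
    finally show ?thesis .
  qed
  have "chain_boundary (Suc (p + Suc q)) (cjoin p (Suc q) z d) \<approx>\<^sub>2
      0 + frag_extend (\<lambda>s. frag_extend (?R s) d) z"
    using boundary_cjoin_low [OF z d cycle]
    by (intro cong2_trans [OF boundary_cjoin [OF z d]] cong2_add) (simp_all only: cong2_0_iff cong2_refl)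
  also have "\<dots> = frag_extend (\<lambda>s. frag_extend (?R s) d) z" by simp
  also have "\<dots> \<approx>\<^sub>2 frag_extend (\<lambda>s. frag_extend (\<lambda>r. frag_extend (\<lambda>r. frag_of (sjoin p q s r)) (chain_boundary (Suc q) (frag_of r))) d) z"
    using z d gen
    by (intro cong2_frag_extend_fun [of z "singular_simplex_set p X"] cong2_frag_extend_fun [of d "singular_simplex_set (Suc q) Y"])
      (simp_all only: singular_chain_def mem_Collect_eq)
  also have "\<dots> = cjoin p q z (chain_boundary (Suc q) d)"
    unfolding cjoin_def chain_boundary_def by (simp add: frag_extend_frag_extend)
  finally show ?thesis .
qed

text \<open>Omitting the vertex of a 0-simplex of \<open>d\<close> leaves \<open>z\<close> at the
  end \<open>t = 0\<close>, and an odd number of such copies amounts to one.\<close>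

lemma boundary_cjoin_0:
  assumes z: "singular_chain p X z" and d: "singular_chain 0 Y d" "augm d = 1"
    and cycle: "p = 0 \<Longrightarrow> augm z = 0" "even_chain (chain_boundary p z)" and y0: "y0 \<in> topspace Y"
  shows "chain_boundary (Suc p) (cjoin p 0 z d) \<approx>\<^sub>2 chain_map p (\<lambda>x. jc x y0 0) z"
proof -
  have "chain_boundary (Suc (p + 0)) (cjoin p 0 z d) \<approx>\<^sub>2
      0 + frag_extend (\<lambda>s. frag_extend (\<lambda>r. \<Sum>i\<le>0. frag_of (singular_face (Suc (p + 0)) (Suc p + i) (sjoin p 0 s r))) d) z"
    using boundary_cjoin_low [OF z d(1) cycle]
    by (intro cong2_trans [OF boundary_cjoin [OF z d(1)]] cong2_add) (simp_all only: cong2_0_iff cong2_refl)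
  also have "\<dots> = frag_extend (\<lambda>s. frag_extend (\<lambda>r. frag_of (simplex_map p (\<lambda>x. jc x y0 0) s)) d) z"
    unfolding add_0 using z d(1)
    by (intro frag_extend_eq) (simp add: singular_face_sjoin_top [OF _ _ y0] singular_chain_def subset_iff)
  also have "\<dots> \<approx>\<^sub>2 frag_extend (\<lambda>s. frag_of (simplex_map p (\<lambda>x. jc x y0 0) s)) z"
  proof (rule cong2_frag_extend_fun [OF subset_UNIV])
    show "frag_extend (\<lambda>r. frag_of (simplex_map p (\<lambda>x. jc x y0 0) s)) d \<approx>\<^sub>2
        frag_of (simplex_map p (\<lambda>x. jc x y0 0) s)" for s
      using cong2_frag_extend_const [of "frag_of (simplex_map p (\<lambda>x. jc x y0 0) s)" d] d(2) by simp
  qed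
  also have "\<dots> = chain_map p (\<lambda>x. jc x y0 0) z"
    by (simp add: chain_map_def o_def)
  finally show ?thesis by simp
qed

text \<open>
  Below dimension \<open>m\<close> the sequence of the join is that of \<open>X\<close>; above, it is the join of the
  cycle \<open>c m + T c m\<close> with the sequence of \<open>Y\<close>.
\<close>

theorem smith_index_join_ge:
  assumes "smith_index_ge X T m" "smith_index_ge Y S l" and ne: "topspace Y \<noteq> {}"
  shows "smith_index_ge J TJ (Suc (m + l))"
proof -
  obtain c where c: "smith_seq m X T c" "augm (c 0) = 1"
    using assms(1) unfolding smith_index_ge_def by blast
  obtain d where d: "smith_seq l Y S d" "augm (d 0) = 1"
    using assms(2) unfolding smith_index_ge_def by blast
  obtain y0 where y0: "y0 \<in> topspace Y" using ne by blast
  have cX: "singular_chain i X (c i)" if "i \<le> m" for i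
    using c(1) that by (simp add: smith_seq_def)
  have dY: "singular_chain j Y (d j)" if "j \<le> l" for j
    using d(1) that by (simp add: smith_seq_def)
  define z where "z = c m + chain_map m T (c m)"
  have z: "singular_chain m X z"
    unfolding z_def using cX X.chain_T(1) by (intro singular_chain_add) auto
  \<comment> \<open>Invariance of \<open>z\<close> lets the involution of the join act on the second
    factor of \<open>cjoin\<close> alone.\<close>
  have Tz: "chain_map m T z = z"
    unfolding z_def using X.chain_T(2) [OF cX [of m]] by (simp add: chain_map_add add.commute)
  \<comment> \<open>The boundary of \<open>c m\<close> is a transfer, so the transfer
    \<open>z\<close> is a cycle modulo 2. In degree 0 it is also a cycle of the augmented
    complex.\<close>
  have cycle: "m = 0 \<Longrightarrow> augm z = 0" "even_chain (chain_boundary m z)"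
  proof -
    show "augm z = 0"
      unfolding z_def augm_add by simp
    show "even_chain (chain_boundary m z)"
    proof (cases m)
      case 0
      then show ?thesis by (simp add: chain_boundary_def)
    next
      case (Suc k)
      let ?b = "chain_boundary (Suc k) (c (Suc k))"
      have "?b \<approx>\<^sub>2 c k + chain_map k T (c k)"
        using c(1) Suc by (simp add: smith_seq_def)
      then have "?b + chain_map k T ?b \<approx>\<^sub>2 (c k + chain_map k T (c k)) + chain_map k T (c k + chain_map k T (c k))"
        by (intro cong2_add cong2_chain_map)
      then have "even_chain (?b + chain_map k T ?b)"
        using X.transfer_transfer [OF cX [of k]] even_chain_cong2 Suc by (metis le_SucI order_refl)
      then show ?thesis
        using X.boundary_transfer [of k "c (Suc k)"] cX [of m] Suc by (simp add: z_def)
    qed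
  qed
  let ?i = "\<lambda>x. jc x y0 0"
  have i_cont: "continuous_map X J ?i"
  proof -
    have "continuous_map X P (\<lambda>x. (x, y0, 0))"
      using y0 by (intro continuous_map_pairedI) auto
    from continuous_map_compose [OF this continuous_map_jc] show ?thesis
      by (simp add: o_def)
  qed
  have i_T: "?i (T x) = TJ (?i x)" if "x \<in> topspace X" for x
    using that y0 X.T_in Y.T_in by (simp add: TJ_jc join_class_eq_iff)
  \<comment> \<open>Joining raises the dimension by one, so \<open>d j\<close> enters in degree
    \<open>Suc m + j\<close>.\<close>
  define e where "e i = (if i \<le> m then chain_map i ?i (c i) else cjoin m (i - Suc m) z (d (i - Suc m)))" for i
  have e_low: "e i = chain_map i ?i (c i)" if "i \<le> m" for i
    using that by (simp add: e_def)
  have e_high: "e (Suc (m + j)) = cjoin m j z (d j)" for j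
    by (simp add: e_def)
  have "smith_seq (Suc (m + l)) J TJ e"
    unfolding smith_seq_def
  proof (intro conjI allI impI)
    fix i assume i: "i \<le> Suc (m + l)"
    show "singular_chain i J (e i)"
    proof (cases "i \<le> m")
      case True
      then show ?thesis
        using e_low singular_chain_chain_map [OF cX i_cont] by simp
    next
      case False
      then obtain j where "i = Suc (m + j)" "j \<le> l"
        using i by (metis Suc_le_mono add_le_cancel_left le_Suc_ex not_less_eq_eq add_Suc)
      then show ?thesis
        using singular_chain_cjoin [OF z dY] e_high by simp
    qed
  next
    fix i assume i: "i < Suc (m + l)"
    consider "i < m" | "i = m" | j where "i = Suc (m + j)" "j < l"
      using i by (metis Suc_less_eq add_Suc less_Suc_eq less_imp_Suc_add linorder_neqE_nat nat_add_left_cancel_less)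
    then show "chain_boundary (Suc i) (e (Suc i)) \<approx>\<^sub>2 e i + chain_map i TJ (e i)"
    proof cases
      case 1
      then show ?thesis
        using smith_seq_chain_map [OF c(1) i_cont, of TJ] i_T by (simp add: smith_seq_def e_low)
    next
      case 2
      have "chain_boundary (Suc m) (e (Suc m)) \<approx>\<^sub>2 chain_map m ?i z"
        using boundary_cjoin_0 [OF z dY d(2) cycle y0] e_high [of 0] by simp
      also have "\<dots> = e m + chain_map m TJ (e m)"
        unfolding z_def e_low [OF order_refl] chain_map_add
        by (subst chain_map_comm [OF cX, of m ?i T TJ]) (simp_all add: i_T)
      finally show ?thesis using 2 by simp
    next
      case 3
      have "chain_boundary (Suc i) (e (Suc i)) = chain_boundary (Suc (m + Suc j)) (cjoin m (Suc j) z (d (Suc j)))"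
        using e_high [of "Suc j"] 3 by simp
      also have "\<dots> \<approx>\<^sub>2 cjoin m j z (chain_boundary (Suc j) (d (Suc j)))"
        using 3 by (intro boundary_cjoin_Suc [OF z dY cycle]) auto
      also have "\<dots> \<approx>\<^sub>2 cjoin m j z (d j + chain_map j S (d j))"
        using d(1) 3 by (intro cong2_cjoin_right) (simp add: smith_seq_def)
      also have "\<dots> = cjoin m j z (d j) + chain_map (Suc (m + j)) TJ (cjoin m j z (d j))"
        using chain_map_cjoin [OF z dY, of j] 3 by (simp add: cjoin_add_right Tz)
      finally show ?thesis
        using 3 e_high by simp
    qed
  qed
  moreover have "augm (e 0) = 1"
    using c(2) by (simp add: e_low)
  ultimately show ?thesis
    unfolding smith_index_ge_def by blast
qed

end

section \<open>Polyhedra\<close>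

text \<open>Only functions of index below \<open>n\<close> can be nonzero, so the Euclidean norm is
  a finite sum and thus continuous, and dividing by it lands in a finite-dimensional sphere.\<close>

lemma normalized_equivariant_map:
  assumes FI: "free_involution X (\<phi> 1) F" and id: "\<And>x. x \<in> topspace X \<Longrightarrow> \<phi> 0 x = x"
    and fin: "\<And>x i. x \<in> topspace X \<Longrightarrow> F x i \<noteq> 0 \<Longrightarrow> i < n"
  shows "\<exists>f. equivariant_map Z2 X \<phi> EZ2 EZ2_action f"
proof -
  interpret free_involution X "\<phi> 1" F by (rule FI)
  define N where "N x = sqrt (\<Sum>i<n. (F x i)\<^sup>2)" for x
  define f where "f x i = F x i / N x" for x i
  have N_pos: "N x > 0" if x: "x \<in> topspace X" for x
  proof -
    obtain i where i: "F x i \<noteq> 0" using F_nonzero x by blast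
    then have "0 < (F x i)\<^sup>2" by simp
    also have "\<dots> \<le> (\<Sum>i<n. (F x i)\<^sup>2)"
      using fin [OF x i] by (intro member_le_sum) auto
    finally show ?thesis by (simp add: N_def)
  qed
  have N_cont: "continuous_map X euclideanreal N"
  proof -
    have "continuous_map X euclideanreal (\<lambda>x. \<Sum>i<n. (F x i)\<^sup>2)"
      by (intro continuous_map_sum continuous_map_real_pow F_cont) auto
    then have "continuous_map X euclideanreal (sqrt \<circ> (\<lambda>x. \<Sum>i<n. (F x i)\<^sup>2))"
      by (rule continuous_map_compose) (simp add: continuous_on_real_sqrt)
    then show ?thesis by (simp add: N_def [abs_def] o_def)
  qed
  have N_T: "N (\<phi> 1 x) = N x" if "x \<in> topspace X" for x
    using that by (simp add: N_def F_odd)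
  have f_in: "f x \<in> topspace EZ2" if x: "x \<in> topspace X" for x
  proof -
    have "F x n = 0"
      using fin [OF x, of n] by blast
    then have "(\<Sum>i\<le>n. (f x i)\<^sup>2) = (\<Sum>i<n. (f x i)\<^sup>2)"
      by (simp add: lessThan_Suc_atMost [symmetric] f_def)
    also have "\<dots> = (\<Sum>i<n. (F x i)\<^sup>2) / (N x)\<^sup>2"
      by (simp add: f_def power_divide sum_divide_distrib)
    also have "\<dots> = 1"
      using N_pos [OF x] by (simp add: N_def real_sqrt_gt_0_iff sum_nonneg)
    finally have "(\<Sum>i\<le>n. (f x i)\<^sup>2) = 1" .
    moreover have "\<forall>i>n. f x i = 0"
      using fin [OF x] by (fastforce simp: f_def)
    ultimately show ?thesis
      unfolding topspace_EZ2 by blast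
  qed
  have "continuous_map X EZ2 f"
    unfolding continuous_map_into_EZ2
  proof (intro conjI allI)
    show "continuous_map X euclideanreal (\<lambda>x. f x i)" for i
      unfolding f_def
      by (intro continuous_map_real_divide F_cont) (use N_cont N_pos in \<open>auto simp: order_less_imp_not_eq2\<close>)
  qed (use f_in in auto)
  moreover have "f (\<phi> g x) = EZ2_action g (f x)" if "g \<in> carrier Z2" "x \<in> topspace X" for g x
    using that f_in [OF that(2)] by (auto simp: carrier_Z2 id EZ2_action_def f_def F_odd N_T fun_eq_iff)
  ultimately show ?thesis
    unfolding equivariant_map_def by blast
qed

lemma Z2_action_facts:
  assumes "free_action Z2 X \<phi>"
  shows "x \<in> topspace X \<Longrightarrow> \<phi> 0 x = x" "continuous_map X X (\<phi> 1)"
    "x \<in> topspace X \<Longrightarrow> \<phi> 1 (\<phi> 1 x) = x" "x \<in> topspace X \<Longrightarrow> \<phi> 1 x \<noteq> x"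
proof -
  interpret group_action Z2 "topspace X" \<phi>
    using assms by (simp add: free_action_def continuous_action_def)
  show id: "\<phi> 0 x = x" if "x \<in> topspace X" for x
    using id_eq_one that by (metis one_integer_mod_group restrict_apply')
  show "continuous_map X X (\<phi> 1)"
    using assms by (simp add: free_action_def continuous_action_def carrier_Z2)
  show "\<phi> 1 (\<phi> 1 x) = x" if x: "x \<in> topspace X"
    using composition_rule [OF x, of 1 1] id [OF x] by (simp add: carrier_Z2)
  show "\<phi> 1 x \<noteq> x" if "x \<in> topspace X"
    using assms that by (auto simp: free_action_def carrier_Z2)
qed

text \<open>
  In a Euclidean embedding \<open>g\<close>, the coordinates of \<open>g x - g (T x)\<close> are odd and have no common
  zero.
\<close>

lemma embedded_free_involution:
  fixes g :: "'a \<Rightarrow> 'e::euclidean_space"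
  assumes T: "continuous_map X X T" "\<And>x. x \<in> topspace X \<Longrightarrow> T (T x) = x" "\<And>x. x \<in> topspace X \<Longrightarrow> T x \<noteq> x"
    and g: "continuous_map X euclidean g" "inj_on g (topspace X)"
  shows "\<exists>F. free_involution X T F \<and> (\<forall>x i. F x i \<noteq> 0 \<longrightarrow> i < DIM('e))"
proof -
  obtain b where b: "bij_betw b {..<DIM('e)} (Basis :: 'e set)"
    using ex_bij_betw_nat_finite [OF finite_Basis] by (metis atLeast0LessThan)
  define F where "F x i = (if i < DIM('e) then (g x - g (T x)) \<bullet> b i else 0)" for x i
  have "free_involution X T F"
  proof
    have gT: "continuous_map X euclidean (\<lambda>x. g x - g (T x))"
      using continuous_map_diff [OF g(1) continuous_map_compose [OF T(1) g(1)]] by (simp add: o_def)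
    show "continuous_map X euclideanreal (\<lambda>x. F x i)" for i
    proof (cases "i < DIM('e)")
      case True
      have "continuous_map X euclideanreal ((\<lambda>v. v \<bullet> b i) \<circ> (\<lambda>x. g x - g (T x)))"
        by (rule continuous_map_compose [OF gT]) (auto intro: continuous_intros)
      then show ?thesis using True by (simp add: F_def o_def)
    qed (simp add: F_def)
    show "F (T x) i = - F x i" if "x \<in> topspace X" for x i
      using that T(2) by (simp add: F_def inner_diff_left)
    show "\<exists>i. F x i \<noteq> 0" if x: "x \<in> topspace X" for x
    proof -
      have "T x \<in> topspace X" using T(1) x by (auto simp: continuous_map_def)
      then have "g x - g (T x) \<noteq> 0"
        using g(2) x T(3) [OF x] by (auto simp: inj_on_def)
      then obtain v where v: "v \<in> Basis" "(g x - g (T x)) \<bullet> v \<noteq> 0"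
        using euclidean_all_zero_iff by blast
      then obtain i where "i < DIM('e)" "v = b i"
        using b by (auto simp: bij_betw_def)
      then show ?thesis using v by (auto simp: F_def)
    qed
  qed (use T in auto)
  then show ?thesis
    by (intro exI [of _ F]) (auto simp: F_def)
qed

text \<open>The inverse of the triangulating homeomorphism embeds \<open>X\<close> in the Euclidean
  space that contains the complex.\<close>

lemma polyhedron_free_involution:
  fixes \<K> :: "'e::euclidean_space set set"
  assumes "free_action Z2 X \<phi>" and "invariant_triangulation Z2 X \<phi> \<K> h"
  shows "\<exists>F. free_involution X (\<phi> 1) F \<and> (\<forall>x i. F x i \<noteq> 0 \<longrightarrow> i < DIM('e))"
proof -
  obtain g where g: "homeomorphic_maps (top_of_set (\<Union>\<K>)) X h g"
    using assms(2) by (auto simp: invariant_triangulation_def homeomorphic_map_maps)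
  have "continuous_map X euclidean g"
    using g by (auto simp: homeomorphic_maps_def continuous_map_in_subtopology)
  moreover have "inj_on g (topspace X)"
    using g unfolding homeomorphic_maps_def by (metis inj_on_inverseI)
  ultimately show ?thesis
    using Z2_action_facts [OF assms(1)] by (intro embedded_free_involution) auto
qed

section \<open>Attainment of the index and the formula for joins\<close>

lemma smith_index_ge_0:
  assumes "topspace X \<noteq> {}"
  shows "smith_index_ge X T 0"
proof -
  obtain x where "x \<in> topspace X" using assms by blast
  then have "singular_simplex 0 X (restrict (\<lambda>_. x) (standard_simplex 0))"
    by (simp add: singular_simplex_def)
  then show ?thesis
    unfolding smith_index_ge_def smith_seq_def
    by (intro exI [of _ "\<lambda>_. frag_of (restrict (\<lambda>_. x) (standard_simplex 0))"]) (simp add: singular_chain_of)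
qed

text \<open>Lengths of Smith sequences are closed downwards, so one excluded \<open>n\<close> makes
  the set finite; a point puts 0 into it. Only then does \<open>Max\<close> have its
  meaning.\<close>

lemma smith_index_Max:
  assumes "topspace X \<noteq> {}" "\<not> smith_index_ge X T n"
  shows "smith_index_ge X T (Max {k. smith_index_ge X T k})" "\<not> smith_index_ge X T (Suc (Max {k. smith_index_ge X T k}))"
proof -
  let ?S = "{k. smith_index_ge X T k}"
  have "?S \<subseteq> {..<n}"
    using assms(2) smith_index_ge_mono by (metis lessThan_iff linorder_not_less mem_Collect_eq subsetI)
  then have fin: "finite ?S"
    using finite_subset by blast
  have "?S \<noteq> {}"
    using smith_index_ge_0 [OF assms(1)] by blast
  then show "smith_index_ge X T (Max ?S)"
    using Max_in [OF fin] by blast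
  show "\<not> smith_index_ge X T (Suc (Max ?S))"
    using Max_ge [OF fin, of "Suc (Max ?S)"] by auto
qed

theorem theorem2p4:
  fixes X :: "'a topology" and \<phi> :: "int \<Rightarrow> 'a \<Rightarrow> 'a"
    and Y :: "'b topology" and \<psi> :: "int \<Rightarrow> 'b \<Rightarrow> 'b"
    and \<K> :: "'c::euclidean_space set set" and h :: "'c \<Rightarrow> 'a"
    and \<L> :: "'d::euclidean_space set set" and k :: "'d \<Rightarrow> 'b"
  assumes "topspace X \<noteq> {}" and "topspace Y \<noteq> {}"
    and "free_action Z2 X \<phi>" and "free_action Z2 Y \<psi>"
    and "invariant_triangulation Z2 X \<phi> \<K> h"
    and "invariant_triangulation Z2 Y \<psi> \<L> k"
  shows "hind (join_space X Y) (join_action X \<phi> Y \<psi>) = hind X \<phi> + hind Y \<psi> + 1"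
proof -
  note \<phi> = Z2_action_facts [OF assms(3)] and \<psi> = Z2_action_facts [OF assms(4)]
  obtain F where F: "free_involution X (\<phi> 1) F" "\<And>x i. F x i \<noteq> 0 \<Longrightarrow> i < DIM('c)"
    using polyhedron_free_involution [OF assms(3,5)] by blast
  obtain G where G: "free_involution Y (\<psi> 1) G" "\<And>y i. G y i \<noteq> 0 \<Longrightarrow> i < DIM('d)"
    using polyhedron_free_involution [OF assms(4,6)] by blast
  interpret join_involutions X "\<phi> 1" F Y "\<psi> 1" G "DIM('c)"
    unfolding join_involutions_def join_involutions_axioms_def using F G by blast
  let ?J = "join_action X \<phi> Y \<psi>"
  have J1: "?J 1 = TJ"
    by (simp add: join_action_def TJ_def)
  have J0: "?J 0 c = c" if "c \<in> topspace J" for c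
    using that
  proof (elim J_cases)
    fix x y t assume xyt: "x \<in> topspace X" "y \<in> topspace Y" "t \<in> {0..1}" and c: "c = jc x y t"
    then have "?J 0 c = jc (\<phi> 0 x) (\<psi> 0 y) t"
      using image_join_class [of X "\<phi> 0" Y "\<psi> 0" x y t] \<phi>(1) \<psi>(1) that by (simp add: join_action_def)
    then show "?J 0 c = c"
      using xyt c \<phi>(1) \<psi>(1) by simp
  qed
  have FJ_fin: "i < DIM('c) + DIM('d)" if c: "c \<in> topspace J" and nz: "FJ c i \<noteq> 0" for c i
  proof -
    obtain x y t where "x \<in> topspace X" "y \<in> topspace Y" "t \<in> {0..1}" "c = jc x y t"
      using J_cases [OF c] .
    then show ?thesis
      using nz F(2) [of x i] G(2) [of y "i - DIM('c)"] by (auto simp: FJ_jc split: if_splits)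
  qed
  obtain f1 where f1: "equivariant_map Z2 X \<phi> EZ2 EZ2_action f1"
    using normalized_equivariant_map [OF F(1) \<phi>(1)] F(2) by blast
  obtain f2 where f2: "equivariant_map Z2 Y \<psi> EZ2 EZ2_action f2"
    using normalized_equivariant_map [OF G(1) \<psi>(1)] G(2) by blast
  obtain f3 where f3: "equivariant_map Z2 J ?J EZ2 EZ2_action f3"
    using normalized_equivariant_map [of J ?J FJ "DIM('c) + DIM('d)"] J.free_involution_axioms J1 J0 FJ_fin by metis
  have hX: "hind X \<phi> = Max {k. smith_index_ge X (\<phi> 1) k}"
    using \<phi> f1 by (intro hind_eq_Max_smith_index) auto
  have hY: "hind Y \<psi> = Max {k. smith_index_ge Y (\<psi> 1) k}"
    using \<psi> f2 by (intro hind_eq_Max_smith_index) auto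
  have hJ: "hind J ?J = Max {k. smith_index_ge J TJ k}"
    unfolding J1 [symmetric] using J0 J.T_cont J.T_T f3 J1 by (intro hind_eq_Max_smith_index) auto
  \<comment> \<open>The odd functions are coordinates in the ambient Euclidean space, so its
    dimension bounds the index.\<close>
  have "\<not> smith_index_ge X (\<phi> 1) DIM('c)"
    using X.F_nonzero F(2) by (intro smith_index_bounded [OF F(1)]) blast
  note X_index = smith_index_Max [OF assms(1) this, folded hX]
  have "\<not> smith_index_ge Y (\<psi> 1) DIM('d)"
    using Y.F_nonzero G(2) by (intro smith_index_bounded [OF G(1)]) blast
  note Y_index = smith_index_Max [OF assms(2) this, folded hY]
  have ge: "smith_index_ge J TJ (Suc (hind X \<phi> + hind Y \<psi>))"
    using smith_index_join_ge X_index(1) Y_index(1) assms(2) by blast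
  \<comment> \<open>A longer sequence would leave \<open>Suc (hind Y \<psi>)\<close> for
    \<open>Y\<close> after \<open>Suc (hind X \<phi>)\<close> has been spent on
    \<open>X\<close>.\<close>
  have le: "\<not> smith_index_ge J TJ (Suc (hind X \<phi>) + Suc (hind Y \<psi>))"
    using smith_index_join_le X_index(2) Y_index(2) by blast
  have "Max {k. smith_index_ge J TJ k} = Suc (hind X \<phi> + hind Y \<psi>)"
  proof (rule Max_eqI)
    have le': "k \<le> Suc (hind X \<phi> + hind Y \<psi>)" if "smith_index_ge J TJ k" for k
    proof (rule ccontr)
      assume "\<not> ?thesis"
      then have "Suc (hind X \<phi>) + Suc (hind Y \<psi>) \<le> k" by simp
      then show False using le that smith_index_ge_mono by blast
    qed
    then show "finite {k. smith_index_ge J TJ k}"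
      using finite_nat_set_iff_bounded_le by blast
    show "\<And>k. k \<in> {k. smith_index_ge J TJ k} \<Longrightarrow> k \<le> Suc (hind X \<phi> + hind Y \<psi>)"
      using le' by blast
  qed (use ge in blast)
  then show ?thesis
    using hJ by simp
qed

end
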